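(* Suppose that $b>1$ and $m\in\{0,1,2,\dots\}$. Then $$\Phi_b^{m+1}\left(I_{\log^{m+1}}(\mathbb{R}^d)\right)=L_m(b,\mathbb{R}^d).$$
   Context: $I(\mathbb{R}^d)$ is the class of all infinitely divisible distributions on $\mathbb{R}^d$; $\widehat\mu$ is the characteristic function of $\mu$; $\mathcal{L}(X)$ is the law of $X$; $[x]$ is the largest integer not greater than $x$; $\log^+|x|=(\log|x|)\vee 0$. For $k\in\mathbb{N}$, $I_{\log^k}(\mathbb{R}^d)=\{\mu\in I(\mathbb{R}^d):\int_{\mathbb{R}^d}(\log^+|x|)^k\,\mu(dx)<\infty\}$. For $\mu\in I(\mathbb{R}^d)$, $\{X_t^{(\mu)},t\ge 0\}$ denotes an $\mathbb{R}^d$-valued Lévy process with $\mathcal{L}(X_1^{(\mu)})=\mu$. For $b>1$, $$\Phi_b(\mu):=\mathcal{L}\left(\int_0^\infty b^{-[t]}\,dX_t^{(\mu)}\right),$$ where the improper stochastic integral is the limit in probability, as $t\to\infty$ (through the reals), of $\int_0^t b^{-[s]}dX_s^{(\mu)}=\sum_{j=0}^{[t]-1}b^{-j}(X^{(\mu)}_{j+1}-X^{(\mu)}_j)+b^{-[t]}(X^{(\mu)}_t-X^{(\mu)}_{[t]})$; the domain $\mathfrak{D}(\Phi_b)$ is the set of $\mu\in I(\mathbb{R}^d)$ for which this limit exists. $\Phi_b^{m}$ is the $m$-fold composition of $\Phi_b$ with itself, with $\mathfrak{D}(\Phi_b^{m+1})=\{\mu\in\mathfrak{D}(\Phi_b^m):\Phi_b^m(\mu)\in\mathfrak{D}(\Phi_b)\}$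 for $m\ge 1$; one has $\mathfrak{D}(\Phi_b^{m+1})=I_{\log^{m+1}}(\mathbb{R}^d)$ for $m\ge 0$. $L_0(b,\mathbb{R}^d)=L(b,\mathbb{R}^d)$ is the class of semi-selfdecomposable distributions with span $b$: those $\mu\in I(\mathbb{R}^d)$ for which there exists $\rho\in I(\mathbb{R}^d)$ with $\widehat\mu(z)=\widehat\mu(b^{-1}z)\widehat\rho(z)$ for all $z\in\mathbb{R}^d$. For $m\ge1$, $\mu\in L_m(b,\mathbb{R}^d)$ if and only if there exists $\rho\in L_{m-1}(b,\mathbb{R}^d)$ such that $\widehat\mu(z)=\widehat\mu(b^{-1}z)\widehat\rho(z)$ for all $z$. *)

theory Defs
  imports "HOL-Probability.Probability"
begin

section \<open>Infinitely divisible distributions on \<open>\<real>\<^sup>d\<close>\<close>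

text \<open>A distribution on \<open>\<real>\<^sup>d\<close> is a probability measure on the Borel sets of \<^typ>\<open>real ^ 'n\<close>,
  with \<open>d = CARD('n)\<close>.\<close>

definition distributions :: "(real ^ 'n) measure set" where
  "distributions = {\<mu>. prob_space \<mu> \<and> sets \<mu> = sets borel}"

definition char_fun :: "(real ^ 'n) measure \<Rightarrow> real ^ 'n \<Rightarrow> complex" where
  "char_fun \<mu> z = (CLINT x|\<mu>. iexp (z \<bullet> x))"

primrec convolution_power :: "(real ^ 'n) measure \<Rightarrow> nat \<Rightarrow> (real ^ 'n) measure" where
  "convolution_power \<nu> 0 = return borel 0"
| "convolution_power \<nu> (Suc n) = convolution (convolution_power \<nu> n) \<nu>"

definition inf_divisible :: "(real ^ 'n) measure set" where
  "inf_divisible = {\<mu> \<in> distributions. \<forall>n\<ge>1. \<exists>\<nu>\<in>distributions. convolution_power \<nu> n = \<mu>}"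

definition log_plus :: "real \<Rightarrow> real" where
  "log_plus r = (if r = 0 then 0 else max (ln r) 0)"

definition I_log :: "nat \<Rightarrow> (real ^ 'n) measure set" where
  "I_log k = {\<mu> \<in> inf_divisible. (\<integral>\<^sup>+x. ennreal (log_plus (norm x) ^ k) \<partial>\<mu>) < \<infinity>}"

section \<open>Levy processes\<close>

text \<open>Processes are indexed by \<^typ>\<open>real\<close>; only times \<open>t \<ge> 0\<close> matter. Since \<open>X\<^sub>0 = 0\<close> a.s., it makes
  no difference whether \<open>X\<^bsub>t\<^sub>0\<^esub>\<close> itself is listed among the independent increments.\<close>

definition levy_process :: "'w measure \<Rightarrow> (real \<Rightarrow> 'w \<Rightarrow> real ^ 'n) \<Rightarrow> bool" where
  "levy_process M X \<longleftrightarrow>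
     prob_space M \<and>
     (\<forall>t\<ge>0. X t \<in> borel_measurable M) \<and>
     (AE \<omega> in M. X 0 \<omega> = 0) \<and>
     (\<forall>(n::nat) t. 0 \<le> t 0 \<and> (\<forall>i<n. t i \<le> t (Suc i)) \<longrightarrow>
        prob_space.indep_vars M (\<lambda>_. borel) (\<lambda>i \<omega>. X (t (Suc i)) \<omega> - X (t i) \<omega>) {..<n}) \<and>
     (\<forall>s\<ge>0. \<forall>h\<ge>0. distr M borel (\<lambda>\<omega>. X (s + h) \<omega> - X s \<omega>) = distr M borel (X h)) \<and>
     (\<forall>t\<ge>0. \<forall>\<epsilon>>0.
        ((\<lambda>s. measure M {\<omega> \<in> space M. norm (X s \<omega> - X t \<omega>) > \<epsilon>}) \<longlongrightarrow> 0) (at t within {0..})) \<and>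
     (AE \<omega> in M. \<forall>t\<ge>0. continuous (at_right t) (\<lambda>s. X s \<omega>) \<and>
        (t > 0 \<longrightarrow> (\<exists>l. ((\<lambda>s. X s \<omega>) \<longlongrightarrow> l) (at_left t))))"

section \<open>The mapping \<open>\<Phi>\<^sub>b\<close>\<close>

text \<open>The integral of \<open>b\<^bsup>-[s]\<^esup>\<close> over \<open>[0, t]\<close> with respect to \<open>X\<close>, for \<open>t \<ge> 0\<close>.\<close>

definition step_integral :: "real \<Rightarrow> (real \<Rightarrow> 'w \<Rightarrow> real ^ 'n) \<Rightarrow> real \<Rightarrow> 'w \<Rightarrow> real ^ 'n" where
  "step_integral b X t \<omega> =
     (\<Sum>j<nat \<lfloor>t\<rfloor>. (1 / b) ^ j *\<^sub>R (X (real j + 1) \<omega> - X (real j) \<omega>))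
     + (1 / b) ^ nat \<lfloor>t\<rfloor> *\<^sub>R (X t \<omega> - X (of_int \<lfloor>t\<rfloor>) \<omega>)"

definition tendsto_in_prob ::
  "'w measure \<Rightarrow> ('i \<Rightarrow> 'w \<Rightarrow> real ^ 'n) \<Rightarrow> ('w \<Rightarrow> real ^ 'n) \<Rightarrow> 'i filter \<Rightarrow> bool" where
  "tendsto_in_prob M Z Y F \<longleftrightarrow>
     (\<forall>\<epsilon>>0. ((\<lambda>t. measure M {\<omega> \<in> space M. norm (Z t \<omega> - Y \<omega>) > \<epsilon>}) \<longlongrightarrow> 0) F)"

text \<open>\<open>Phi_law b \<mu> \<nu>\<close>: for a Levy process \<open>X\<close> with \<open>X\<^sub>1\<close> distributed according to \<open>\<mu>\<close>, the improper
  integral of \<open>b\<^bsup>-[t]\<^esup>\<close> with respect to \<open>X\<close> exists and has law \<open>\<nu>\<close>. A definition cannot quantify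
  over the type of the sample space, so the points of the sample space are taken to be paths
  \<^typ>\<open>real \<Rightarrow> real ^ 'n\<close>. The sigma-algebra is arbitrary and \<open>X\<close> need not be the coordinate process.
  There is no loss of generality, as every Levy process can be transferred to its path space.\<close>

definition Phi_law :: "real \<Rightarrow> (real ^ 'n) measure \<Rightarrow> (real ^ 'n) measure \<Rightarrow> bool" where
  "Phi_law b \<mu> \<nu> \<longleftrightarrow>
     (\<exists>(M :: (real \<Rightarrow> real ^ 'n) measure) X Y.
        levy_process M X \<and> distr M borel (X 1) = \<mu> \<and>
        Y \<in> borel_measurable M \<and> tendsto_in_prob M (step_integral b X) Y at_top \<and>
        distr M borel Y = \<nu>)"

text \<open>\<open>\<Phi>\<^sub>b\<close> is a partial function, and \<^term>\<open>dom (Phi b)\<close> is its domain. The description by \<open>THE\<close> is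
  proper because the law of the limit depends only on \<open>\<mu>\<close>.\<close>

definition Phi :: "real \<Rightarrow> (real ^ 'n) measure \<rightharpoonup> (real ^ 'n) measure" where
  "Phi b \<mu> = (if \<mu> \<in> inf_divisible \<and> (\<exists>\<nu>. Phi_law b \<mu> \<nu>) then Some (THE \<nu>. Phi_law b \<mu> \<nu>) else None)"

primrec Phi_iter :: "real \<Rightarrow> nat \<Rightarrow> (real ^ 'n) measure \<rightharpoonup> (real ^ 'n) measure" where
  "Phi_iter b 0 = Some"
| "Phi_iter b (Suc k) = Phi b \<circ>\<^sub>m Phi_iter b k"

lemma Phi_iter_1: "Phi_iter b 1 = Phi b"
  by (simp add: map_comp_def)

lemma dom_Phi_iter_Suc:
  "dom (Phi_iter b (Suc k)) = {\<mu> \<in> dom (Phi_iter b k). the (Phi_iter b k \<mu>) \<in> dom (Phi b)}"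
  by (auto simp: map_comp_def dom_def split: option.splits)

section \<open>Semi-selfdecomposable distributions and their nested subclasses\<close>

primrec L :: "nat \<Rightarrow> real \<Rightarrow> (real ^ 'n) measure set" where
  "L 0 b = {\<mu> \<in> inf_divisible. \<exists>\<rho>\<in>inf_divisible.
      \<forall>z. char_fun \<mu> z = char_fun \<mu> ((1 / b) *\<^sub>R z) * char_fun \<rho> z}"
| "L (Suc m) b = {\<mu> \<in> inf_divisible. \<exists>\<rho>\<in>L m b.
      \<forall>z. char_fun \<mu> z = char_fun \<mu> ((1 / b) *\<^sub>R z) * char_fun \<rho> z}"

end

theory Submission
  imports Defs
begin

text \<open>Write \<open>\<nu> = \<Phi>\<^sub>b(\<mu>)\<close>. On integer times the integral is a sum of independent terms \<open>b\<^sup>-\<^sup>j \<xi>\<^sub>j\<close> with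
  \<open>\<xi>\<^sub>j\<close> distributed according to \<open>\<mu>\<close>, so \<open>\<nu>\<close> is the unique distribution with
  \<open>\<nu>^(z) = \<nu>^(b\<^sup>-\<^sup>1 z) \<mu>^(z)\<close>. For \<open>\<mu>\<close> and \<open>\<nu>\<close> related in this way, \<open>\<nu>\<close> has a logarithmic moment of
  order \<open>k\<close> if and only if \<open>\<mu>\<close> has one of order \<open>k + 1\<close>: the tail of \<open>\<nu>\<close> at \<open>t\<close> is comparable with
  the sum over \<open>j\<close> of the tails of \<open>\<mu>\<close> at \<open>b\<^sup>j t\<close>, by a union bound in one direction and by Ottaviani's
  inequality in the other. Iterating this gives both inclusions.

  That every infinitely divisible \<open>\<mu>\<close> is the law of \<open>X\<^sub>1\<close> for a Levy process needs a construction.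
  The roots of \<open>\<mu>\<close> of order \<open>2\<^sup>N\<close> yield a process on the dyadic times by Kolmogorov's theorem.
  The number of its oscillations by more than a fixed amount on a short interval has geometric tails,
  again by Ottaviani's inequality, so almost all paths have one-sided limits along the dyadic
  numbers, and the right limits form the process.\<close>

text \<open>\<open>L m b\<close> carries no moment condition, whereas \<open>I_log (m + 1)\<close>
  does. The gap is closed at order 0, where the moment condition is void: any \<rho> with
  \<open>\<nu>^(z) = \<nu>^(z/b) \<rho>^(z)\<close> has a logarithmic moment of order 1 for free,
  and each application of \<open>Phi\<close> carries one more order back to \<mu>. This is why
  moments have to be traced in both directions. Membership in \<open>L\<close> also asks for
  infinite divisibility of \<nu>, which the functional equation does not show. It comes from the
  same series formed with roots of \<mu>, whose moments are controlled by Ottaviani's inequality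
  once more. Roots of different orders chosen separately need not fit together. The characteristic
  function of \<mu> has no zeros and hence a continuous logarithm \<psi> with \<psi>(0) = 0, and
  \<open>exp (\<psi> / n)\<close> gives roots that do fit. The same \<psi> settles the limit through
  the reals: the incomplete last period of the integral at time t has characteristic function
  \<open>exp (s \<psi>(b^-n z))\<close> with n = [t] and s = t - n, which tends to 1.\<close>

lemma distributionsD:
  assumes "\<mu> \<in> distributions"
  shows "prob_space \<mu>" "sets \<mu> = sets borel" "space \<mu> = UNIV"
  using assms sets_eq_imp_space_eq[of \<mu> borel] by (auto simp: distributions_def)

lemma (in prob_space) distr_in_distributions:
  "X \<in> borel_measurable M \<Longrightarrow> distr M borel X \<in> distributions"
  by (simp add: distributions_def prob_space_distr)

lemma measure_distr_norm_greater:
  fixes X :: "'a \<Rightarrow> 'b::{second_countable_topology, real_normed_vector}"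
  assumes [measurable]: "X \<in> borel_measurable M"
  shows "measure (distr M borel X) {x. norm x > t} = measure M {\<omega> \<in> space M. norm (X \<omega>) > t}"
  by (subst measure_distr) (auto simp: vimage_def Int_def conj_commute)

lemma emeasure_distr_norm_greater:
  fixes X :: "'a \<Rightarrow> 'b::{second_countable_topology, real_normed_vector}"
  assumes [measurable]: "X \<in> borel_measurable M"
  shows "emeasure (distr M borel X) {x. norm x > t} = emeasure M {\<omega> \<in> space M. norm (X \<omega>) > t}"
  by (subst emeasure_distr) (auto simp: vimage_def Int_def conj_commute)

lemma distr_id_distributions: "\<mu> \<in> distributions \<Longrightarrow> distr \<mu> borel (\<lambda>x. x) = \<mu>"
  by (rule distr_id2) (simp add: distributionsD)

section \<open>Characteristic functions of images, independent sums and convolutions\<close>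

lemma char_fun_distr:
  assumes [measurable]: "X \<in> borel_measurable M"
  shows "char_fun (distr M borel X) z = (CLINT x|M. iexp (z \<bullet> X x))"
  unfolding char_fun_def by (subst integral_distr) auto

lemma char_fun_scaleR:
  assumes [measurable]: "X \<in> borel_measurable M"
  shows "char_fun (distr M borel (\<lambda>x. c *\<^sub>R X x)) z = char_fun (distr M borel X) (c *\<^sub>R z)"
  by (simp add: char_fun_distr mult.commute)

lemma (in prob_space) integrable_iexp_inner:
  fixes X :: "'a \<Rightarrow> real ^ 'n"
  assumes [measurable]: "X \<in> borel_measurable M"
  shows "integrable M (\<lambda>x. iexp (z \<bullet> X x))"
  by (rule integrable_const_bound[of _ 1]) auto

lemma char_fun_0: "\<mu> \<in> distributions \<Longrightarrow> char_fun \<mu> 0 = 1"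
  using prob_space.prob_space[of \<mu>] distributionsD(1)[of \<mu>] by (simp add: char_fun_def)

lemma continuous_on_char_fun:
  fixes \<mu> :: "(real ^ 'n) measure"
  assumes "\<mu> \<in> distributions" shows "continuous_on A (char_fun \<mu>)"
proof (rule continuous_on_subset[OF _ subset_UNIV], unfold continuous_on_sequentially comp_def, intro ballI allI impI)
  interpret prob_space \<mu> by (rule distributionsD[OF assms])
  have [measurable_cong]: "sets \<mu> = sets borel" by (rule distributionsD[OF assms])
  fix u :: "nat \<Rightarrow> real ^ 'n" and z assume u: "(\<forall>n. u n \<in> UNIV) \<and> u \<longlonglongrightarrow> z"
  show "(\<lambda>n. char_fun \<mu> (u n)) \<longlonglongrightarrow> char_fun \<mu> z"
    unfolding char_fun_def
    by (rule integral_dominated_convergence[where w="\<lambda>_. 1"])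
       (use u in \<open>auto intro!: tendsto_intros\<close>)
qed

lemma (in prob_space) char_fun_indep_sum:
  fixes X :: "'i \<Rightarrow> 'a \<Rightarrow> real ^ 'n"
  assumes ind: "indep_vars (\<lambda>_. borel) X I" and "finite I"
  shows "char_fun (distr M borel (\<lambda>x. \<Sum>i\<in>I. X i x)) z = (\<Prod>i\<in>I. char_fun (distr M borel (X i)) z)"
proof -
  have [measurable]: "i \<in> I \<Longrightarrow> X i \<in> borel_measurable M" for i
    using ind by (auto simp: indep_vars_def)
  have ind': "indep_vars (\<lambda>_. borel) (\<lambda>i x. iexp (z \<bullet> X i x)) I"
    by (rule indep_vars_compose2[OF ind]) auto
  have "(CLINT x|M. iexp (z \<bullet> (\<Sum>i\<in>I. X i x))) = (CLINT x|M. (\<Prod>i\<in>I. iexp (z \<bullet> X i x)))"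
    using \<open>finite I\<close> by (simp add: inner_sum_right sum_distrib_left exp_sum)
  also have "\<dots> = (\<Prod>i\<in>I. CLINT x|M. iexp (z \<bullet> X i x))"
    by (rule indep_vars_lebesgue_integral[OF \<open>finite I\<close> ind']) (auto intro!: integrable_iexp_inner)
  finally show ?thesis by (simp add: char_fun_distr)
qed

lemma convolution_in_distributions:
  assumes "\<mu> \<in> distributions" "\<nu> \<in> distributions"
  shows "convolution \<mu> \<nu> \<in> distributions"
proof -
  interpret \<mu>: prob_space \<mu> by (rule distributionsD[OF assms(1)])
  interpret \<nu>: prob_space \<nu> by (rule distributionsD[OF assms(2)])
  interpret pair_prob_space \<mu> \<nu> ..
  have [measurable_cong]: "sets \<mu> = sets borel" "sets \<nu> = sets borel"
    using assms distributionsD by auto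
  show ?thesis unfolding convolution_def by (intro P.distr_in_distributions) simp
qed

lemma char_fun_convolution:
  assumes "\<mu> \<in> distributions" "\<nu> \<in> distributions"
  shows "char_fun (convolution \<mu> \<nu>) z = char_fun \<mu> z * char_fun \<nu> z"
proof -
  interpret \<mu>: prob_space \<mu> by (rule distributionsD[OF assms(1)])
  interpret \<nu>: prob_space \<nu> by (rule distributionsD[OF assms(2)])
  interpret pair_prob_space \<mu> \<nu> ..
  have [measurable_cong]: "sets \<mu> = sets borel" "sets \<nu> = sets borel"
    using assms distributionsD by auto
  have *: "integrable (\<mu> \<Otimes>\<^sub>M \<nu>) (\<lambda>(x, y). iexp (z \<bullet> (x + y)))"
    by (rule P.integrable_const_bound[of _ 1]) auto
  have "char_fun (convolution \<mu> \<nu>) z = (CLINT p|\<mu> \<Otimes>\<^sub>M \<nu>. (case p of (x, y) \<Rightarrow> iexp (z \<bullet> (x + y))))"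
    unfolding convolution_def by (subst char_fun_distr) (auto simp: case_prod_beta')
  also have "\<dots> = (CLINT x|\<mu>. CLINT y|\<nu>. iexp (z \<bullet> (x + y)))"
    using integral_fst'[OF *] by simp
  finally show ?thesis
    by (simp add: char_fun_def inner_add_right distrib_left exp_add)
qed

lemma convolution_power_in_distributions:
  "\<nu> \<in> distributions \<Longrightarrow> convolution_power \<nu> n \<in> distributions"
proof (induction n)
  case 0
  then show ?case by (simp add: distributions_def prob_space_return)
qed (simp add: convolution_in_distributions)

lemma char_fun_convolution_power:
  "\<nu> \<in> distributions \<Longrightarrow> char_fun (convolution_power \<nu> n) z = char_fun \<nu> z ^ n"
proof (induction n)
  case 0
  then show ?case by (simp add: char_fun_def integral_return)
next
  case (Suc n)
  then show ?case by (simp add: char_fun_convolution convolution_power_in_distributions mult.commute)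
qed

section \<open>Uniqueness\<close>

lemma integral_cos_eq_char_fun:
  assumes "\<mu> \<in> distributions"
  shows "(LINT x|\<mu>. cos (z \<bullet> x + t)) = Re (iexp t * char_fun \<mu> z)"
proof -
  interpret prob_space \<mu> by (rule distributionsD[OF assms])
  have [measurable_cong]: "sets \<mu> = sets borel" by (rule distributionsD[OF assms])
  have "integrable \<mu> (\<lambda>x. iexp (z \<bullet> x))" by (rule integrable_iexp_inner) simp
  then have "iexp t * char_fun \<mu> z = (CLINT x|\<mu>. iexp t * iexp (z \<bullet> x))"
    unfolding char_fun_def by simp
  also have "\<dots> = (CLINT x|\<mu>. iexp (z \<bullet> x + t))"
    by (intro Bochner_Integration.integral_cong) (auto simp: exp_add[symmetric] algebra_simps)
  finally have "Re (iexp t * char_fun \<mu> z) = Re (CLINT x|\<mu>. iexp (z \<bullet> x + t))" by simp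
  also have "\<dots> = (LINT x|\<mu>. Re (iexp (z \<bullet> x + t)))"
    by (rule integral_Re[symmetric]) (rule integrable_const_bound[of _ 1], auto simp flip: of_real_add)
  finally show ?thesis by (simp add: Re_exp)
qed

text \<open>Cosines with a free phase include the sines and, at frequency 0, the constants. By the
  product-to-sum formula the class is an algebra, although only one kind of generator has to be
  integrated.\<close>

inductive trig_poly :: "('a::real_inner \<Rightarrow> real) \<Rightarrow> bool" where
  cos: "trig_poly (\<lambda>x. c * cos (z \<bullet> x + t))"
| add: "trig_poly f \<Longrightarrow> trig_poly g \<Longrightarrow> trig_poly (\<lambda>x. f x + g x)"

lemma trig_poly_const: "trig_poly (\<lambda>_. c)"
  using trig_poly.cos[of c 0 0] by simp

lemma trig_poly_mult:
  assumes "trig_poly f" "trig_poly g" shows "trig_poly (\<lambda>x. f x * g x)"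
  using assms
proof (induction arbitrary: g)
  case (cos c z t)
  from cos show ?case
  proof induction
    case (cos d w u)
    have "trig_poly (\<lambda>x. (c*d/2) * cos ((z - w) \<bullet> x + (t - u)) + (c*d/2) * cos ((z + w) \<bullet> x + (t + u)))"
      by (intro trig_poly.intros)
    moreover have "(c*d/2) * cos ((z - w) \<bullet> x + (t - u)) + (c*d/2) * cos ((z + w) \<bullet> x + (t + u)) =
        c * cos (z \<bullet> x + t) * (d * cos (w \<bullet> x + u))" for x
    proof -
      have "(z - w) \<bullet> x + (t - u) = (z \<bullet> x + t) - (w \<bullet> x + u)" "(z + w) \<bullet> x + (t + u) = (z \<bullet> x + t) + (w \<bullet> x + u)"
        by (simp_all add: inner_diff_left inner_add_left)
      then show ?thesis by (simp only: cos_diff cos_add) (simp add: field_simps)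
    qed
    ultimately show ?case by (simp only:)
  next
    case (add f g)
    show ?case unfolding distrib_left by (rule trig_poly.add[OF add.IH])
  qed
next
  case (add f h)
  show ?case unfolding distrib_right by (rule trig_poly.add[OF add.IH(1)[OF add.prems] add.IH(2)[OF add.prems]])
qed

lemma trig_poly_bounded: "trig_poly f \<Longrightarrow> \<exists>B. \<forall>x. \<bar>f x\<bar> \<le> B"
proof (induction rule: trig_poly.induct)
  case (cos c z t)
  show ?case by (rule exI[of _ "\<bar>c\<bar>"]) (auto simp: abs_mult intro!: mult_left_le)
next
  case (add f g)
  then obtain B C where "\<forall>x. \<bar>f x\<bar> \<le> B" "\<forall>x. \<bar>g x\<bar> \<le> C" by auto
  then show ?case by (intro exI[of _ "B + C"]) (auto intro: order_trans[OF abs_triangle_ineq] add_mono)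
qed

lemma trig_poly_continuous: "trig_poly f \<Longrightarrow> continuous_on A f"
  by (induction rule: trig_poly.induct) (auto intro!: continuous_intros)

lemma trig_poly_polynomial:
  assumes "real_polynomial_function p" "trig_poly f" shows "trig_poly (\<lambda>x. p (f x))"
  using assms(1)
proof induction
  case (linear g)
  then interpret bounded_linear g .
  have "g y = g 1 * y" for y using scaleR[of y 1] by simp
  then have "(\<lambda>x. g (f x)) = (\<lambda>x. g 1 * f x)" by (metis)
  then show ?case using trig_poly_mult[OF trig_poly_const assms(2)] by (simp only:)
next
  case (add g h)
  then show ?case by (intro trig_poly.add)
next
  case (mult g h)
  then show ?case by (intro trig_poly_mult)
qed (rule trig_poly_const)

lemma trig_poly_integral_eq:
  fixes \<mu> \<nu> :: "(real ^ 'n) measure"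
  assumes d: "\<mu> \<in> distributions" "\<nu> \<in> distributions" and eq: "\<And>z. char_fun \<mu> z = char_fun \<nu> z"
    and "trig_poly f"
  shows "integral\<^sup>L \<mu> f = integral\<^sup>L \<nu> f"
  using assms(4)
proof (induction rule: trig_poly.induct)
  case (cos c z t)
  show ?case by (simp add: integral_cos_eq_char_fun d eq)
next
  case (add f g)
  have "integrable \<mu> f" if "trig_poly f" "\<mu> \<in> distributions" for f and \<mu> :: "(real ^ 'n) measure"
  proof -
    interpret prob_space \<mu> by (rule distributionsD[OF that(2)])
    have [measurable_cong]: "sets \<mu> = sets borel" by (rule distributionsD[OF that(2)])
    have "f \<in> borel_measurable borel" by (intro borel_measurable_continuous_onI trig_poly_continuous that)
    then have "f \<in> borel_measurable \<mu>" by simp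
    then show ?thesis using trig_poly_bounded[OF that(1)] integrable_const_bound[of f] by auto
  qed
  then show ?case using add d by simp
qed

text \<open>A trigonometric polynomial approximating \<open>f\<close> on a ball need not be small elsewhere; composing
  it with a polynomial that approximates the truncation to \<open>[0, 1]\<close> repairs this.\<close>

lemma trig_poly_approx:
  fixes f :: "'a::euclidean_space \<Rightarrow> real"
  assumes f: "continuous_on UNIV f" "\<And>x. f x \<in> {0..1}" and e: "0 < e"
  shows "\<exists>g. trig_poly g \<and> (\<forall>x\<in>cball 0 R. \<bar>f x - g x\<bar> < e) \<and> (\<forall>x. \<bar>g x\<bar> \<le> 1 + e)"
proof -
  have "function_ring_on (Collect trig_poly) (cball (0::'a) R)"
  proof
    fix x y :: 'a assume xy: "x \<noteq> y"
    \<comment> \<open>The frequency is scaled so that the phases at x and y differ by exactly 1. If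
      cosine and sine agreed at both points, this would give \<open>cos 1 = 1\<close>.\<close>
    define c where "c = 1 / (norm (x - y))\<^sup>2"
    define z where "z = c *\<^sub>R (x - y)"
    have d: "z \<bullet> x - z \<bullet> y = 1"
      using xy unfolding z_def c_def inner_diff_right[symmetric] by (simp add: power2_norm_eq_inner)
    have "\<exists>f. trig_poly f \<and> f x \<noteq> f y"
    proof (rule ccontr)
      assume "\<not> ?thesis"
      then have *: "trig_poly f \<Longrightarrow> f x = f y" for f by auto
      have "cos (z \<bullet> x) = cos (z \<bullet> y)" "sin (z \<bullet> x) = sin (z \<bullet> y)"
        using *[OF trig_poly.cos[of 1 z 0]] *[OF trig_poly.cos[of 1 z "- (pi / 2)"]] by (simp_all add: cos_diff)
      then have "cos (z \<bullet> x - z \<bullet> y) = (sin (z \<bullet> y))\<^sup>2 + (cos (z \<bullet> y))\<^sup>2"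
        by (simp add: cos_diff power2_eq_square add.commute)
      then have "cos (1::real) = 1" using d by (simp only: sin_cos_squared_add)
      moreover have "cos (1::real) < cos 0" by (rule cos_monotone_0_pi) (use pi_gt3 in auto)
      ultimately show False by simp
    qed
    then show "\<exists>f\<in>Collect trig_poly. f x \<noteq> f y" by blast
  qed (auto intro: trig_poly_continuous trig_poly.add trig_poly_mult trig_poly_const)
  then obtain h where h: "trig_poly h" "\<forall>x\<in>cball 0 R. \<bar>f x - h x\<bar> < e / 2"
    using function_ring_on.Stone_Weierstrass_basic[of "Collect trig_poly" "cball 0 R" f "e / 2"]
      continuous_on_subset[OF f(1)] e by auto
  obtain B where B: "\<bar>h x\<bar> \<le> B" for x using trig_poly_bounded[OF h(1)] by auto
  have "continuous_on {-B..B} (\<lambda>y::real. max 0 (min 1 y))" by (intro continuous_intros)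
  then obtain p where p: "real_polynomial_function p" "\<And>y. y \<in> {-B..B} \<Longrightarrow> \<bar>max 0 (min 1 y) - p y\<bar> < e / 2"
    using Stone_Weierstrass_real_polynomial_function[of "{-B..B}" _ "e / 2"] e by auto
  show ?thesis
  proof (intro exI[of _ "\<lambda>x. p (h x)"] conjI ballI allI)
    show "trig_poly (\<lambda>x. p (h x))" by (rule trig_poly_polynomial[OF p(1) h(1)])
    have *: "\<bar>max 0 (min 1 (h x)) - p (h x)\<bar> < e / 2" for x using p(2)[of "h x"] B[of x] by (auto simp: abs_le_iff)
    show "\<bar>f x - p (h x)\<bar> < e" if "x \<in> cball 0 R" for x
    proof -
      have "\<bar>f x - h x\<bar> < e / 2" using h(2) that by blast
      then show ?thesis using *[of x] f(2)[of x] by (auto simp: abs_if min_def max_def split: if_splits)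
    qed
    show "\<bar>p (h x)\<bar> \<le> 1 + e" for x using *[of x] e by (auto simp: abs_if min_def max_def split: if_splits)
  qed
qed

text \<open>The link between integrals of continuous functions and measures of closed sets. The
  empty set is excluded because \<open>infdist\<close> to it is 0 by convention, so that the limit
  would be 1.\<close>

lemma closed_indicator_limit:
  fixes F :: "'a::metric_space set"
  assumes "closed F" "F \<noteq> {}"
  shows "(\<lambda>n. max 0 (1 - real n * infdist x F)) \<longlonglongrightarrow> indicator F x"
proof (cases "x \<in> F")
  case False
  then have "0 < infdist x F" using assms in_closed_iff_infdist_zero infdist_nonneg[of x F] by (metis less_eq_real_def)
  then obtain N where N: "1 < real N * infdist x F" using reals_Archimedean3 by blast
  have "\<forall>n\<ge>N. max 0 (1 - real n * infdist x F) = 0"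
  proof (intro allI impI)
    fix n assume "N \<le> n"
    then have "real N * infdist x F \<le> real n * infdist x F" by (intro mult_right_mono) (auto simp: infdist_nonneg)
    then show "max 0 (1 - real n * infdist x F) = 0" using N by simp
  qed
  then have "eventually (\<lambda>n. max 0 (1 - real n * infdist x F) = indicator F x) sequentially"
    using False unfolding eventually_sequentially by (intro exI[of _ N]) simp
  then show ?thesis by (rule tendsto_eventually)
qed simp

lemma distributions_eqI_closed:
  fixes \<mu> \<nu> :: "(real ^ 'n) measure"
  assumes d: "\<mu> \<in> distributions" "\<nu> \<in> distributions"
    and eq: "\<And>F. closed F \<Longrightarrow> emeasure \<mu> F = emeasure \<nu> F"
  shows "\<mu> = \<nu>"
proof (rule measure_eqI_generator_eq[where E="Collect closed" and \<Omega>=UNIV and A="\<lambda>_. UNIV"])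
  show "sets \<mu> = sigma_sets UNIV (Collect closed)" "sets \<nu> = sigma_sets UNIV (Collect closed)"
    using distributionsD[OF d(1)] distributionsD[OF d(2)] by (auto simp: borel_eq_closed)
  show "\<And>i. emeasure \<mu> UNIV \<noteq> \<infinity>"
    using distributionsD[OF d(1)] prob_space.emeasure_space_1[of \<mu>] by simp
qed (auto simp: Int_stable_def eq)

text \<open>Trigonometric polynomials have equal integrals under both measures. They approximate a
  continuous function on a ball that carries nearly all of both masses, and their global bound
  controls the rest. Closed sets are then reached through distance functions.\<close>

theorem char_fun_unique:
  fixes \<mu> \<nu> :: "(real ^ 'n) measure"
  assumes d: "\<mu> \<in> distributions" "\<nu> \<in> distributions" and eq: "\<And>z. char_fun \<mu> z = char_fun \<nu> z"
  shows "\<mu> = \<nu>"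
proof (rule distributions_eqI_closed[OF d])
  interpret \<mu>: prob_space \<mu> by (rule distributionsD[OF d(1)])
  interpret \<nu>: prob_space \<nu> by (rule distributionsD[OF d(2)])
  note sp = distributionsD(3)[OF d(1)] distributionsD(3)[OF d(2)]
  have sm: "sets \<mu> = sets borel" and sn: "sets \<nu> = sets borel" using d distributionsD by auto
  note [measurable_cong] = sm sn
  have close: "\<exists>R. measure \<mu> (- cball 0 R) < e \<and> measure \<nu> (- cball 0 R) < e" if "0 < e" for e
  proof -
    have *: "(\<lambda>n. measure N (- cball 0 (real n))) \<longlonglongrightarrow> 0" if N: "N \<in> distributions" for N :: "(real^'n) measure"
    proof -
      interpret N: prob_space N by (rule distributionsD[OF N])
      have [measurable_cong]: "sets N = sets borel" using N distributionsD by auto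
      have "(\<lambda>n. measure N (- cball 0 (real n))) \<longlonglongrightarrow> measure N (\<Inter>n. - cball 0 (real n))"
        by (rule N.finite_Lim_measure_decseq) (auto simp: decseq_def)
      moreover have "(\<Inter>n. - cball (0::real^'n) (real n)) = {}"
        using real_arch_simple by (fastforce simp: not_le[symmetric])
      ultimately show ?thesis by simp
    qed
    from eventually_conj[OF order_tendstoD(2)[OF *[OF d(1)] that] order_tendstoD(2)[OF *[OF d(2)] that]]
    show ?thesis by (auto simp: eventually_sequentially)
  qed
  have int: "integral\<^sup>L \<mu> f = integral\<^sup>L \<nu> f"
    if f: "continuous_on UNIV f" "\<And>x. f x \<in> {0..1}" for f :: "real ^ 'n \<Rightarrow> real"
  proof -
    \<comment> \<open>Each measure contributes at most \<open>5 * e\<close>: an error e on the ball,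
      and at most 4 times the mass outside, since there \<open>\<bar>f\<bar> \<le> 1\<close> and
      \<open>\<bar>g\<bar> \<le> 2\<close>.\<close>
    have "\<bar>integral\<^sup>L \<mu> f - integral\<^sup>L \<nu> f\<bar> \<le> 0 + 10 * e" if e: "0 < e" "e < 1" for e
    proof -
      obtain R where R: "measure \<mu> (- cball 0 R) < e" "measure \<nu> (- cball 0 R) < e" using close e by blast
      obtain g where g: "trig_poly g" "\<forall>x\<in>cball 0 R. \<bar>f x - g x\<bar> < e" "\<forall>x. \<bar>g x\<bar> \<le> 1 + e"
        using trig_poly_approx[OF f e(1)] by blast
      have [measurable]: "f \<in> borel_measurable borel" "g \<in> borel_measurable borel"
        using f(1) trig_poly_continuous[OF g(1)] by (auto intro: borel_measurable_continuous_onI)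
      have *: "\<bar>integral\<^sup>L N f - integral\<^sup>L N g\<bar> \<le> 5 * e" if N: "N \<in> distributions" "measure N (- cball 0 R) < e" for N
      proof -
        interpret N: prob_space N by (rule distributionsD[OF N(1)])
        have [measurable_cong]: "sets N = sets borel" using N distributionsD by auto
        have i: "integrable N f" "integrable N g"
          by (rule N.integrable_const_bound[of _ 1], use f(2) in simp_all)
             (rule N.integrable_const_bound[of _ "1 + e"], use g(3) in simp_all)
        have "\<bar>integral\<^sup>L N f - integral\<^sup>L N g\<bar> = \<bar>LINT x|N. f x - g x\<bar>" using i by simp
        also have "\<dots> \<le> (LINT x|N. \<bar>f x - g x\<bar>)" by (rule integral_abs_bound)
        also have "\<dots> \<le> (LINT x|N. e + 4 * indicator (- cball 0 R) x)"
        proof (rule integral_mono)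
          fix x
          show "\<bar>f x - g x\<bar> \<le> e + 4 * indicator (- cball 0 R) x"
          proof (cases "x \<in> cball 0 R")
            case True then show ?thesis using g(2) by (auto intro: less_imp_le)
          next
            case False
            have "\<bar>f x\<bar> \<le> 1" using f(2)[of x] by auto
            moreover have "\<bar>g x\<bar> \<le> 2" using g(3)[rule_format, of x] e by auto
            ultimately show ?thesis using False e by (simp add: indicator_def)
          qed
        qed (use i e in \<open>auto intro!: N.integrable_const_bound[of _ 5] simp: indicator_def\<close>)
        also have "\<dots> = e + 4 * measure N (- cball 0 R)"
          by (subst Bochner_Integration.integral_add) (auto simp: N.prob_space integrable_indicator_iff N.emeasure_eq_measure)
        finally show ?thesis using N(2) by simp
      qed
      show ?thesis using *[OF d(1) R(1)] *[OF d(2) R(2)] trig_poly_integral_eq[OF d eq g(1)] by linarith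
    qed
    note small = this
    have "\<bar>integral\<^sup>L \<mu> f - integral\<^sup>L \<nu> f\<bar> \<le> 0"
    proof (rule field_le_epsilon)
      fix e :: real assume "0 < e"
      then show "\<bar>integral\<^sup>L \<mu> f - integral\<^sup>L \<nu> f\<bar> \<le> 0 + e"
        using small[of "min (1/2) (e / 10)"] by (cases "e \<ge> 5") (auto simp: min_def)
    qed
    then show ?thesis by simp
  qed
  fix F :: "(real ^ 'n) set" assume F: "closed F"
  show "emeasure \<mu> F = emeasure \<nu> F"
  proof (cases "F = {}")
    case False
    have [measurable]: "F \<in> sets borel" using F by simp
    have [measurable]: "(\<lambda>x. infdist x F) \<in> borel_measurable borel"
      by (intro borel_measurable_continuous_onI continuous_intros)
    have lim: "(\<lambda>n. LINT x|N. max 0 (1 - real n * infdist x F)) \<longlonglongrightarrow> measure N F" if N: "N \<in> distributions" for N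
    proof -
      interpret N: prob_space N by (rule distributionsD[OF N(1)])
      have [measurable_cong]: "sets N = sets borel" using N distributionsD by auto
      have "(\<lambda>n. LINT x|N. max 0 (1 - real n * infdist x F)) \<longlonglongrightarrow> (LINT x|N. indicator F x)"
      proof (rule integral_dominated_convergence[where w="\<lambda>_. 1"])
        show "AE x in N. (\<lambda>n. max 0 (1 - real n * infdist x F)) \<longlonglongrightarrow> indicat_real F x"
          by (intro AE_I2 closed_indicator_limit F False)
        have "\<bar>max 0 (1 - real n * infdist x F)\<bar> \<le> 1" for n x
          using infdist_nonneg[of x F] by (auto simp: max_def)
        then show "AE x in N. norm (max 0 (1 - real n * infdist x F)) \<le> 1" for n by auto
      qed auto
      then show ?thesis using N distributionsD(3)[OF N] by simp
    qed
    have "(\<lambda>n. LINT x|\<mu>. max 0 (1 - real n * infdist x F)) = (\<lambda>n. LINT x|\<nu>. max 0 (1 - real n * infdist x F))"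
      by (intro ext int) (auto intro!: continuous_intros simp: infdist_nonneg)
    then have "measure \<mu> F = measure \<nu> F" using lim[OF d(1)] lim[OF d(2)] LIMSEQ_unique by metis
    then show ?thesis by (simp add: \<mu>.emeasure_eq_measure \<nu>.emeasure_eq_measure)
  qed simp
qed

lemma inf_divisible_imp_distributions: "\<mu> \<in> inf_divisible \<Longrightarrow> \<mu> \<in> distributions"
  by (simp add: inf_divisible_def)

text \<open>By uniqueness, convolution powers can be replaced by powers of characteristic functions,
  the only form used in the sequel.\<close>

lemma inf_divisible_iff:
  "\<mu> \<in> inf_divisible \<longleftrightarrow> \<mu> \<in> distributions \<and>
     (\<forall>n\<ge>1. \<exists>\<nu>\<in>distributions. \<forall>z. char_fun \<nu> z ^ n = char_fun \<mu> z)"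
proof -
  have "convolution_power \<nu> n = \<mu> \<longleftrightarrow> (\<forall>z. char_fun \<nu> z ^ n = char_fun \<mu> z)"
    if "\<mu> \<in> distributions" "\<nu> \<in> distributions" for \<nu> n
    using that char_fun_unique[of "convolution_power \<nu> n" \<mu>] convolution_power_in_distributions[of \<nu> n]
    by (auto simp: char_fun_convolution_power)
  then show ?thesis by (auto simp: inf_divisible_def)
qed

section \<open>Characteristic functions and convergence\<close>

lemma norm_iexp_diff_le: "norm (iexp a - iexp b) \<le> \<bar>a - b\<bar>"
proof -
  have "iexp a - iexp b = iexp b * (iexp (a - b) - 1)"
    by (simp add: right_diff_distrib exp_add[symmetric] algebra_simps)
  then have "norm (iexp a - iexp b) = norm (iexp (a - b) - 1)" by (simp add: norm_mult)
  also have "\<dots> \<le> \<bar>a - b\<bar>" using iexp_approx1[of "a - b" 0] by simp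
  finally show ?thesis .
qed

text \<open>Where X and Y are within \<epsilon>, the exponentials differ by at most
  \<open>norm z * \<epsilon>\<close>; elsewhere they differ by at most 2.\<close>

lemma (in prob_space) norm_char_fun_diff_le:
  fixes X Y :: "'a \<Rightarrow> real ^ 'n"
  assumes [measurable]: "X \<in> borel_measurable M" "Y \<in> borel_measurable M" and "0 \<le> \<epsilon>"
  shows "norm (char_fun (distr M borel X) z - char_fun (distr M borel Y) z)
    \<le> norm z * \<epsilon> + 2 * prob {\<omega> \<in> space M. norm (X \<omega> - Y \<omega>) > \<epsilon>}"
proof -
  have "char_fun (distr M borel X) z - char_fun (distr M borel Y) z =
      (CLINT x|M. iexp (z \<bullet> X x) - iexp (z \<bullet> Y x))"
    by (simp add: char_fun_distr integrable_iexp_inner)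
  then have "norm (char_fun (distr M borel X) z - char_fun (distr M borel Y) z)
      \<le> (\<integral>x. norm (iexp (z \<bullet> X x) - iexp (z \<bullet> Y x)) \<partial>M)"
    by (simp only: integral_norm_bound)
  also have "\<dots> \<le> (\<integral>x. norm z * \<epsilon> + 2 * indicator {\<omega> \<in> space M. norm (X \<omega> - Y \<omega>) > \<epsilon>} x \<partial>M)"
  proof (rule integral_mono)
    fix x assume x: "x \<in> space M"
    show "norm (iexp (z \<bullet> X x) - iexp (z \<bullet> Y x)) \<le> norm z * \<epsilon> + 2 * indicator {\<omega> \<in> space M. norm (X \<omega> - Y \<omega>) > \<epsilon>} x"
    proof (cases "norm (X x - Y x) > \<epsilon>")
      case True
      have "norm (iexp (z \<bullet> X x) - iexp (z \<bullet> Y x)) \<le> 1 + 1"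
        by (rule order_trans[OF norm_triangle_ineq4]) simp
      then show ?thesis using True x \<open>0 \<le> \<epsilon>\<close> by (simp add: add_increasing)
    next
      case False
      have "norm (iexp (z \<bullet> X x) - iexp (z \<bullet> Y x)) \<le> \<bar>z \<bullet> (X x - Y x)\<bar>"
        using norm_iexp_diff_le[of "z \<bullet> X x" "z \<bullet> Y x"] by (simp add: inner_diff_right)
      also have "\<dots> \<le> norm z * norm (X x - Y x)" by (rule Cauchy_Schwarz_ineq2)
      also have "\<dots> \<le> norm z * \<epsilon>" using False by (intro mult_left_mono) auto
      finally show ?thesis using False by simp
    qed
  next
    show "integrable M (\<lambda>x. norm (iexp (z \<bullet> X x) - iexp (z \<bullet> Y x)))"
      by (intro integrable_norm Bochner_Integration.integrable_diff integrable_iexp_inner) auto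
    show "integrable M (\<lambda>x. norm z * \<epsilon> + 2 * indicator {\<omega> \<in> space M. norm (X \<omega> - Y \<omega>) > \<epsilon>} x)"
      by (auto simp: integrable_indicator_iff emeasure_eq_measure)
  qed
  also have "\<dots> = norm z * \<epsilon> + 2 * prob {\<omega> \<in> space M. norm (X \<omega> - Y \<omega>) > \<epsilon>}"
    by (subst Bochner_Integration.integral_add) (auto simp: prob_space emeasure_eq_measure)
  finally show ?thesis .
qed

lemma (in prob_space) tendsto_char_fun_in_prob:
  fixes Y :: "'a \<Rightarrow> real ^ 'n"
  assumes [measurable]: "\<And>t. Z t \<in> borel_measurable M" "Y \<in> borel_measurable M"
    and lim: "tendsto_in_prob M Z Y F"
  shows "((\<lambda>t. char_fun (distr M borel (Z t)) z) \<longlongrightarrow> char_fun (distr M borel Y) z) F"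
proof (rule tendstoI)
  fix e :: real assume e: "0 < e"
  define \<epsilon> where "\<epsilon> = e / (2 * (norm z + 1))"
  have \<epsilon>: "0 < \<epsilon>" "norm z * \<epsilon> \<le> e / 2" using e by (auto simp: \<epsilon>_def field_simps add_pos_nonneg)
  have "\<forall>\<^sub>F t in F. prob {\<omega> \<in> space M. norm (Z t \<omega> - Y \<omega>) > \<epsilon>} < e / 4"
    using lim \<epsilon>(1) e by (intro order_tendstoD(2)[of _ 0]) (auto simp: tendsto_in_prob_def)
  then show "\<forall>\<^sub>F t in F. dist (char_fun (distr M borel (Z t)) z) (char_fun (distr M borel Y) z) < e"
  proof eventually_elim
    case (elim t)
    then show ?case
      using norm_char_fun_diff_le[of "Z t" Y \<epsilon> z] \<epsilon> by (auto simp: dist_norm)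
  qed
qed

lemma (in prob_space) tendsto_char_fun_AE:
  fixes Y :: "'a \<Rightarrow> real ^ 'n"
  assumes [measurable]: "\<And>n. Z n \<in> borel_measurable M" "Y \<in> borel_measurable M"
    and lim: "AE x in M. (\<lambda>n. Z n x) \<longlonglongrightarrow> Y x"
  shows "(\<lambda>n. char_fun (distr M borel (Z n)) z) \<longlonglongrightarrow> char_fun (distr M borel Y) z"
  unfolding char_fun_distr[OF assms(1)] char_fun_distr[OF assms(2)]
  by (rule integral_dominated_convergence[where w="\<lambda>_. 1"])
     (use lim in \<open>auto intro!: tendsto_intros elim!: eventually_mono\<close>)

section \<open>Tails and convergence to 0 in probability\<close>

lemma tail_tendsto_0:
  fixes \<mu> :: "(real ^ 'n) measure"
  assumes "\<mu> \<in> distributions"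
  shows "((\<lambda>K. measure \<mu> {x. norm x > K}) \<longlongrightarrow> 0) at_top"
proof -
  interpret prob_space \<mu> by (rule distributionsD[OF assms])
  have [measurable_cong]: "sets \<mu> = sets borel" by (rule distributionsD[OF assms])
  have sp: "space \<mu> = UNIV" by (rule distributionsD[OF assms])
  have "(\<lambda>n. measure \<mu> {x. norm x > real n}) \<longlonglongrightarrow> measure \<mu> (\<Inter>n. {x. norm x > real n})"
    by (rule finite_Lim_measure_decseq) (auto simp: decseq_def distributionsD[OF assms])
  moreover have "(\<Inter>n. {x::real^'n. norm x > real n}) = {}"
    using real_arch_simple by (fastforce simp: not_less[symmetric])
  ultimately have *: "(\<lambda>n. measure \<mu> {x. norm x > real n}) \<longlonglongrightarrow> 0" by simp
  show ?thesis
  proof (rule tendsto_0_le[where K=1])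
    show "((\<lambda>K. measure \<mu> {x. norm x > real (nat \<lfloor>K\<rfloor>)}) \<longlongrightarrow> 0) at_top"
      by (rule filterlim_compose[OF *])
         (auto intro: filterlim_compose[OF filterlim_nat_sequentially filterlim_floor_sequentially])
    show "\<forall>\<^sub>F K in at_top. norm (measure \<mu> {x. norm x > K}) \<le> norm (measure \<mu> {x. norm x > real (nat \<lfloor>K\<rfloor>)}) * 1"
      using eventually_ge_at_top[of 0]
    proof eventually_elim
      case (elim K)
      have "measure \<mu> {x. norm x > K} \<le> measure \<mu> {x. norm x > real (nat \<lfloor>K\<rfloor>)}"
        using elim by (intro finite_measure_mono) (auto simp: distributionsD[OF assms] intro: le_less_trans[OF of_int_floor_le])
      then show ?case by simp
    qed
  qed
qed

text \<open>Levy's continuity theorem on the line is applied to each coordinate, whose laws converge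
  weakly to the unit mass at 0. A vector of norm above \<epsilon> has a coordinate above
  \<epsilon>/d in modulus.\<close>

lemma tail_tendsto_0_of_char_fun:
  fixes \<mu> :: "nat \<Rightarrow> (real ^ 'n) measure"
  assumes d: "\<And>n. \<mu> n \<in> distributions" and lim: "\<And>z. (\<lambda>n. char_fun (\<mu> n) z) \<longlonglongrightarrow> 1" and "0 < \<epsilon>"
  shows "(\<lambda>n. measure (\<mu> n) {x. norm x > \<epsilon>}) \<longlonglongrightarrow> 0"
proof -
  interpret prob_space "\<mu> n" for n by (rule distributionsD[OF d])
  have [measurable_cong]: "sets (\<mu> n) = sets borel" for n by (rule distributionsD[OF d])
  have sp: "space (\<mu> n) = UNIV" for n by (rule distributionsD[OF d])
  define \<delta> where "\<delta> = \<epsilon> / CARD('n)"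
  have \<delta>: "0 < \<delta>" using \<open>0 < \<epsilon>\<close> by (simp add: \<delta>_def)
  define S where "S = {y::real. \<bar>y\<bar> > \<delta>}"
  have S: "S = {..<-\<delta>} \<union> {\<delta><..}" using \<delta> by (auto simp: S_def abs_if)
  have [measurable]: "S \<in> sets borel" unfolding S by simp
  have coord: "(\<lambda>n. measure (\<mu> n) {x. \<bar>x $ i\<bar> > \<delta>}) \<longlonglongrightarrow> 0" for i
  proof -
    let ?N = "\<lambda>n. distr (\<mu> n) borel (\<lambda>x. x $ i)"
    have ch: "char (?N n) t = char_fun (\<mu> n) (t *\<^sub>R axis i 1)" for n t
      unfolding char_def char_fun_def by (subst integral_distr) (auto simp: inner_axis')
    have ch1: "char (return borel 0) t = 1" for t
      unfolding char_def by (subst integral_return) auto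
    interpret R: real_distribution "return borel (0::real)"
      by (simp add: real_distribution_def real_distribution_axioms_def prob_space_return)
    have w: "weak_conv_m ?N (return borel 0)"
      by (rule levy_continuity) (use lim in \<open>auto simp: ch ch1 intro: R.real_distribution_axioms\<close>)
    have "frontier S \<subseteq> {-\<delta>, \<delta>}" unfolding S
      by (rule order_trans[OF frontier_Un_subset]) (auto simp: frontier_def interior_open)
    then have fr: "emeasure (return borel 0) (frontier S) = 0"
      using \<delta> by (subst emeasure_return) (auto simp: indicator_def)
    have "(\<lambda>n. measure (?N n) S) \<longlonglongrightarrow> measure (return borel 0) S"
      by (rule weak_conv_imp_continuity_set_conv[OF _ _ w]) (auto simp: fr intro: R.real_distribution_axioms)
    moreover have "measure (return borel 0) S = 0" using \<delta> by (simp add: measure_return S_def)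
    moreover have "measure (?N n) S = measure (\<mu> n) {x. \<bar>x $ i\<bar> > \<delta>}" for n
      by (subst measure_distr) (auto simp: S_def vimage_def sp)
    ultimately show ?thesis by simp
  qed
  show ?thesis
  proof (rule tendsto_0_le[where K=1])
    show "(\<lambda>n. \<Sum>i\<in>UNIV. measure (\<mu> n) {x. \<bar>x $ i\<bar> > \<delta>}) \<longlonglongrightarrow> 0"
      by (rule tendsto_null_sum) (rule coord)
    show "\<forall>\<^sub>F n in sequentially. norm (measure (\<mu> n) {x. norm x > \<epsilon>}) \<le> norm (\<Sum>i\<in>UNIV. measure (\<mu> n) {x. \<bar>x $ i\<bar> > \<delta>}) * 1"
    proof (intro always_eventually allI)
      fix n
      have sub: "{x::real^'n. norm x > \<epsilon>} \<subseteq> (\<Union>i\<in>UNIV. {x. \<bar>x $ i\<bar> > \<delta>})"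
      proof (rule ccontr)
        assume "\<not> ?thesis"
        then obtain x :: "real^'n" where x: "norm x > \<epsilon>" "\<And>i. \<bar>x $ i\<bar> \<le> \<delta>" by (force simp: not_less[symmetric])
        have "norm x \<le> (\<Sum>i\<in>UNIV. \<bar>x $ i\<bar>)" by (rule norm_le_l1_cart)
        also have "\<dots> \<le> (\<Sum>i\<in>(UNIV::'n set). \<delta>)" by (intro sum_mono x)
        also have "\<dots> = \<epsilon>" by (simp add: \<delta>_def)
        finally show False using x by simp
      qed
      have "measure (\<mu> n) {x. norm x > \<epsilon>} \<le> measure (\<mu> n) (\<Union>i\<in>UNIV. {x. \<bar>x $ i\<bar> > \<delta>})"
        using sub by (intro finite_measure_mono) (auto simp: distributionsD[OF d])
      also have "\<dots> \<le> (\<Sum>i\<in>UNIV. measure (\<mu> n) {x. \<bar>x $ i\<bar> > \<delta>})"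
        by (rule finite_measure_subadditive_finite) (auto simp: distributionsD[OF d])
      finally show "norm (measure (\<mu> n) {x. norm x > \<epsilon>}) \<le> norm (\<Sum>i\<in>UNIV. measure (\<mu> n) {x. \<bar>x $ i\<bar> > \<delta>}) * 1"
        by (simp add: sum_nonneg)
    qed
  qed
qed

lemma (in prob_space) tendsto_prob_0_of_char_fun:
  fixes W :: "nat \<Rightarrow> 'a \<Rightarrow> real ^ 'n"
  assumes W[measurable]: "\<And>i. W i \<in> borel_measurable M"
    and "\<And>z. (\<lambda>i. char_fun (distr M borel (W i)) z) \<longlonglongrightarrow> 1" and "0 < \<epsilon>"
  shows "(\<lambda>i. prob {\<omega> \<in> space M. norm (W i \<omega>) > \<epsilon>}) \<longlonglongrightarrow> 0"
proof -
  have "(\<lambda>i. measure (distr M borel (W i)) {x. norm x > \<epsilon>}) \<longlonglongrightarrow> 0"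
    by (intro tail_tendsto_0_of_char_fun distr_in_distributions assms)
  then show ?thesis by (simp add: measure_distr_norm_greater)
qed

section \<open>The exponent of an infinitely divisible distribution\<close>

text \<open>Rotation by the argument of \<open>char_fun \<mu> z\<close> turns its modulus into the
  integral of a cosine. The pointwise inequality for the doubled angle is then integrated. As a
  result, a modulus above 3/4 at z excludes a zero at 2z.\<close>

lemma char_fun_double_bound:
  assumes "\<mu> \<in> distributions"
  shows "1 - norm (char_fun \<mu> (2 *\<^sub>R z)) \<le> 4 * (1 - norm (char_fun \<mu> z))"
proof -
  interpret prob_space \<mu> by (rule distributionsD[OF assms])
  have [measurable_cong]: "sets \<mu> = sets borel" by (rule distributionsD[OF assms])
  define \<theta> where "\<theta> = Arg (char_fun \<mu> z)"
  have pol: "char_fun \<mu> z = norm (char_fun \<mu> z) * iexp \<theta>"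
    using rcis_cmod_Arg[of "char_fun \<mu> z"] by (simp add: rcis_def cis_conv_exp \<theta>_def)
  have rot: "Re (iexp (- c) * char_fun \<mu> w) = (LINT x|\<mu>. cos (w \<bullet> x - c))" for c w
    using integral_cos_eq_char_fun[OF assms, of w "- c"] by simp
  have i: "integrable \<mu> (\<lambda>x. cos (w \<bullet> x - c))" for w c
    by (rule integrable_const_bound[of _ 1]) auto
  have "iexp (- \<theta>) * char_fun \<mu> z = norm (char_fun \<mu> z)"
    by (subst pol) (simp add: exp_add[symmetric] mult.left_commute)
  then have 1: "norm (char_fun \<mu> z) = (LINT x|\<mu>. cos (z \<bullet> x - \<theta>))"
    using rot[of \<theta> z] by simp
  have "(LINT x|\<mu>. cos ((2 *\<^sub>R z) \<bullet> x - 2 * \<theta>)) = Re (iexp (- (2 * \<theta>)) * char_fun \<mu> (2 *\<^sub>R z))"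
    by (rule rot[symmetric])
  also have "\<dots> \<le> norm (iexp (- (2 * \<theta>)) * char_fun \<mu> (2 *\<^sub>R z))" by (rule complex_Re_le_cmod)
  also have "\<dots> = norm (char_fun \<mu> (2 *\<^sub>R z))" by (simp only: norm_mult norm_exp_i_times mult_1)
  finally have 2: "(LINT x|\<mu>. cos ((2 *\<^sub>R z) \<bullet> x - 2 * \<theta>)) \<le> norm (char_fun \<mu> (2 *\<^sub>R z))" .
  have "(LINT x|\<mu>. 1 - cos ((2 *\<^sub>R z) \<bullet> x - 2 * \<theta>)) \<le> (LINT x|\<mu>. 4 * (1 - cos (z \<bullet> x - \<theta>)))"
  proof (rule integral_mono)
    fix x
    define u where "u = z \<bullet> x - \<theta>"
    have "(2 *\<^sub>R z) \<bullet> x - 2 * \<theta> = 2 * u" by (simp add: u_def)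
    \<comment> \<open>The right side minus the left side is twice the square of
      \<open>cos u - 1\<close>.\<close>
    moreover have "1 - cos (2 * u) \<le> 4 * (1 - cos u)"
      using zero_le_power2[of "cos u - 1"] unfolding cos_double_cos power2_eq_square
      by (simp add: algebra_simps)
    ultimately show "1 - cos ((2 *\<^sub>R z) \<bullet> x - 2 * \<theta>) \<le> 4 * (1 - cos (z \<bullet> x - \<theta>))" by (simp add: u_def)
  qed (use i[of "2 *\<^sub>R z" "2 * \<theta>"] i in auto)
  then show ?thesis using 1 2 i[of "2 *\<^sub>R z" "2 * \<theta>"] i by (simp add: prob_space)
qed

text \<open>If \<open>char_fun \<mu> z\<close> is nonzero, the moduli of its roots at z tend to 1.
  Once one of them exceeds 3/4, the doubling bound excludes a zero of that root at 2z, and so a zero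
  of \<open>char_fun \<mu>\<close>. Every point is reached by doublings from a point near 0, where
  the value is close to 1.\<close>

lemma char_fun_inf_divisible_nonzero:
  fixes \<mu> :: "(real ^ 'n) measure"
  assumes "\<mu> \<in> inf_divisible"
  shows "char_fun \<mu> z \<noteq> 0"
proof -
  have \<mu>: "\<mu> \<in> distributions" using assms by (rule inf_divisible_imp_distributions)
  have dbl: "char_fun \<mu> (2 *\<^sub>R z) \<noteq> 0" if "char_fun \<mu> z \<noteq> 0" for z
  proof -
    have "\<forall>n. \<exists>\<nu>\<in>distributions. \<forall>z. char_fun \<nu> z ^ Suc n = char_fun \<mu> z"
      using conjunct2[OF assms[unfolded inf_divisible_iff]] by (simp del: power_Suc)
    then obtain \<nu> where \<nu>: "\<And>n. \<nu> n \<in> distributions" "\<And>n z. char_fun (\<nu> n) z ^ Suc n = char_fun \<mu> z"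
      by metis
    have "norm (char_fun (\<nu> n) z) = root (Suc n) (norm (char_fun \<mu> z))" for n
      by (metis \<nu>(2) norm_ge_zero norm_power real_root_power_cancel zero_less_Suc)
    moreover have "(\<lambda>n. root (Suc n) (norm (char_fun \<mu> z))) \<longlonglongrightarrow> 1"
      using LIMSEQ_root_const[of "norm (char_fun \<mu> z)"] that by (intro LIMSEQ_Suc) simp
    ultimately have "(\<lambda>n. norm (char_fun (\<nu> n) z)) \<longlonglongrightarrow> 1" by simp
    then have "\<forall>\<^sub>F n in sequentially. norm (char_fun (\<nu> n) z) > 3 / 4" by (rule order_tendstoD) simp
    then obtain n where "norm (char_fun (\<nu> n) z) > 3 / 4" by (auto simp: eventually_sequentially)
    then have "char_fun (\<nu> n) (2 *\<^sub>R z) \<noteq> 0" using char_fun_double_bound[OF \<nu>(1), of n z] by auto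
    then show ?thesis using \<nu>(2)[of n "2 *\<^sub>R z", symmetric] by simp
  qed
  have pow: "char_fun \<mu> (2 ^ n *\<^sub>R z) \<noteq> 0" if "char_fun \<mu> z \<noteq> 0" for n z
    by (induction n) (use that dbl in \<open>auto simp: scaleR_scaleR[symmetric] simp del: scaleR_scaleR\<close>)
  have "(\<lambda>n. (1/2) ^ n *\<^sub>R z) \<longlonglongrightarrow> 0 *\<^sub>R z" by (intro tendsto_scaleR LIMSEQ_power_zero) auto
  then have "(\<lambda>n. char_fun \<mu> ((1/2) ^ n *\<^sub>R z)) \<longlonglongrightarrow> char_fun \<mu> 0"
    using continuous_on_tendsto_compose[OF continuous_on_char_fun[OF \<mu>, of UNIV]] by auto
  then have "(\<lambda>n. char_fun \<mu> ((1/2) ^ n *\<^sub>R z)) \<longlonglongrightarrow> 1" by (simp add: char_fun_0[OF \<mu>])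
  then have "\<forall>\<^sub>F n in sequentially. char_fun \<mu> ((1/2) ^ n *\<^sub>R z) \<noteq> 0"
    by (rule tendsto_imp_eventually_ne) simp
  then obtain n where "char_fun \<mu> ((1/2) ^ n *\<^sub>R z) \<noteq> 0" by (auto simp: eventually_sequentially)
  from pow[OF this, of n] show ?thesis by (simp add: power_mult_distrib[symmetric])
qed

text \<open>All roots are taken from one logarithm. Those of order \<open>2 ^ N\<close> are then
  automatically compatible: the characteristic function at level N is the square of the one at level
  N + 1, as the dyadic construction requires.\<close>

definition exponent_of :: "(real ^ 'n) measure \<Rightarrow> (real ^ 'n \<Rightarrow> complex) \<Rightarrow> bool" where
  "exponent_of \<mu> \<psi> \<longleftrightarrow> continuous_on UNIV \<psi> \<and> \<psi> 0 = 0 \<and> (\<forall>z. char_fun \<mu> z = exp (\<psi> z)) \<and>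
     (\<forall>n\<ge>1. \<exists>\<nu>\<in>distributions. \<forall>z. char_fun \<nu> z = exp (\<psi> z / of_nat n))"

text \<open>A continuous function without zeros on a contractible space has a continuous logarithm.
  The quotient of an n-th root by \<open>exp (\<psi> z / n)\<close> is continuous with values among
  the n-th roots of unity, hence constant, and it is 1 at 0.\<close>

lemma inf_divisible_exponent:
  fixes \<mu> :: "(real ^ 'n) measure"
  assumes "\<mu> \<in> inf_divisible"
  obtains \<psi> where "exponent_of \<mu> \<psi>"
proof -
  have \<mu>: "\<mu> \<in> distributions" using assms by (rule inf_divisible_imp_distributions)
  obtain g where g: "continuous_on UNIV g" "\<And>z. char_fun \<mu> z = exp (g z)"
    using continuous_logarithm_on_contractible[OF continuous_on_char_fun[OF \<mu>, of UNIV]]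
      char_fun_inf_divisible_nonzero[OF assms] contractible_UNIV by (metis UNIV_I)
  define \<psi> where "\<psi> z = g z - g 0" for z
  have \<psi>: "continuous_on UNIV \<psi>" "\<psi> 0 = 0" "\<And>z. char_fun \<mu> z = exp (\<psi> z)"
  proof -
    show "continuous_on UNIV \<psi>" unfolding \<psi>_def by (intro continuous_intros g)
    show "char_fun \<mu> z = exp (\<psi> z)" for z
      using g(2)[of 0] g(2)[of z] by (simp add: \<psi>_def exp_diff char_fun_0[OF \<mu>])
  qed (simp add: \<psi>_def)
  have "\<exists>\<nu>\<in>distributions. \<forall>z. char_fun \<nu> z = exp (\<psi> z / of_nat n)" if "n \<ge> 1" for n
  proof -
    obtain \<nu> where \<nu>: "\<nu> \<in> distributions" "\<And>z. char_fun \<nu> z ^ n = char_fun \<mu> z"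
      using assms \<open>n \<ge> 1\<close> by (auto simp: inf_divisible_iff)
    define h where "h z = char_fun \<nu> z / exp (\<psi> z / of_nat n)" for z
    have "continuous_on UNIV h" unfolding h_def
      using that by (intro continuous_intros continuous_on_char_fun \<nu> \<psi>) auto
    moreover have "h z ^ n = 1" for z
      using that by (simp add: h_def power_divide \<nu>(2) \<psi>(3) exp_of_nat_mult[symmetric])
    then have "finite (range h)"
      by (intro finite_subset[OF _ finite_roots_unity[OF that]]) auto
    ultimately have "h constant_on UNIV"
      by (intro continuous_finite_range_constant connected_UNIV)
    then have "h z = h 0" for z unfolding constant_on_def by (metis UNIV_I)
    moreover have "h 0 = 1" by (simp add: h_def \<psi> char_fun_0[OF \<nu>(1)])
    ultimately have "h z = 1" for z by simp
    then have "char_fun \<nu> z = exp (\<psi> z / of_nat n)" for z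
      by (simp add: h_def)
    then show ?thesis using \<nu>(1) by blast
  qed
  then show thesis using that[of \<psi>] \<psi> by (auto simp: exponent_of_def)
qed

section \<open>Sums of independent random vectors\<close>

text \<open>Made for a first passage against the terms that follow it. Invariance under
  \<open>restrict\<close> expresses that P depends on the coordinates in A only, and allows events
  to be written with the full family.\<close>

lemma (in prob_space) indep_vars_blocks:
  assumes ind: "indep_vars (\<lambda>_. N) X I" and AB: "A \<inter> B = {}" "A \<subseteq> I" "B \<subseteq> I"
    and [measurable]: "Measurable.pred (PiM A (\<lambda>_. N)) P" "Measurable.pred (PiM B (\<lambda>_. N)) Q"
    and P: "\<And>x. P (restrict x A) = P x" and Q: "\<And>x. Q (restrict x B) = Q x"
  shows "prob {\<omega> \<in> space M. P (\<lambda>i. X i \<omega>) \<and> Q (\<lambda>i. X i \<omega>)} =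
    prob {\<omega> \<in> space M. P (\<lambda>i. X i \<omega>)} * prob {\<omega> \<in> space M. Q (\<lambda>i. X i \<omega>)}"
proof -
  have X: "i \<in> I \<Longrightarrow> X i \<in> measurable M N" for i using ind by (auto simp: indep_vars_def)
  have sp: "\<omega> \<in> space M \<Longrightarrow> K \<subseteq> I \<Longrightarrow> restrict (\<lambda>i. X i \<omega>) K \<in> space (PiM K (\<lambda>_. N))" for \<omega> K
    by (auto simp: space_PiM intro!: measurable_space[OF X])
  have "prob ((\<lambda>\<omega>. (restrict (\<lambda>i. X i \<omega>) A, restrict (\<lambda>i. X i \<omega>) B)) -`
      ({x \<in> space (PiM A (\<lambda>_. N)). P x} \<times> {x \<in> space (PiM B (\<lambda>_. N)). Q x}) \<inter> space M) =
    prob ((\<lambda>\<omega>. restrict (\<lambda>i. X i \<omega>) A) -` {x \<in> space (PiM A (\<lambda>_. N)). P x} \<inter> space M) *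
    prob ((\<lambda>\<omega>. restrict (\<lambda>i. X i \<omega>) B) -` {x \<in> space (PiM B (\<lambda>_. N)). Q x} \<inter> space M)"
    by (rule indep_varD[OF indep_var_restrict[OF ind AB]]) measurable
  also have "(\<lambda>\<omega>. (restrict (\<lambda>i. X i \<omega>) A, restrict (\<lambda>i. X i \<omega>) B)) -`
      ({x \<in> space (PiM A (\<lambda>_. N)). P x} \<times> {x \<in> space (PiM B (\<lambda>_. N)). Q x}) \<inter> space M =
      {\<omega> \<in> space M. P (\<lambda>i. X i \<omega>) \<and> Q (\<lambda>i. X i \<omega>)}"
    using sp AB by (auto simp: P Q)
  also have "(\<lambda>\<omega>. restrict (\<lambda>i. X i \<omega>) A) -` {x \<in> space (PiM A (\<lambda>_. N)). P x} \<inter> space M =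
      {\<omega> \<in> space M. P (\<lambda>i. X i \<omega>)}"
    using sp AB by (auto simp: P)
  also have "(\<lambda>\<omega>. restrict (\<lambda>i. X i \<omega>) B) -` {x \<in> space (PiM B (\<lambda>_. N)). Q x} \<inter> space M =
      {\<omega> \<in> space M. Q (\<lambda>i. X i \<omega>)}"
    using sp AB by (auto simp: Q)
  finally show ?thesis .
qed

lemma sets_pred_restrict:
  assumes "\<And>i. i \<in> A \<Longrightarrow> X i \<in> measurable M N" "Measurable.pred (PiM A (\<lambda>_. N)) P"
    and "\<And>x. P (restrict x A) = P x"
  shows "{\<omega> \<in> space M. P (\<lambda>i. X i \<omega>)} \<in> sets M"
proof -
  have "(\<lambda>\<omega>. restrict (\<lambda>i. X i \<omega>) A) \<in> measurable M (PiM A (\<lambda>_. N))"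
    by (rule measurable_restrict) (use assms in auto)
  from measurable_compose[OF this assms(2)] show ?thesis by (simp add: assms(3) pred_def)
qed

section \<open>First passage of partial sums, Ottaviani's inequality and oscillation counts\<close>

lemma measurable_sum_component:
  fixes A :: "nat set"
  assumes "A \<subseteq> I"
  shows "(\<lambda>x. \<Sum>i\<in>A. x i) \<in> borel_measurable (PiM I (\<lambda>_. borel :: 'b::{second_countable_topology, real_normed_vector} measure))"
  using assms by (intro borel_measurable_sum measurable_component_singleton) auto

text \<open>The sums are half-open so that the event is decided by the terms from k to l - 1 and is
  independent of the terms from l on.\<close>

definition first_exceeds :: "real \<Rightarrow> nat \<Rightarrow> nat \<Rightarrow> (nat \<Rightarrow> 'b::real_normed_vector) \<Rightarrow> bool" where
  "first_exceeds r k l x \<longleftrightarrow> norm (\<Sum>i=k..<l. x i) > r \<and> (\<forall>j\<in>{k..<l}. norm (\<Sum>i=k..<j. x i) \<le> r)"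

lemma first_exceeds_unique:
  "first_exceeds r k l x \<Longrightarrow> first_exceeds r k l' x \<Longrightarrow> k \<le> l \<Longrightarrow> k \<le> l' \<Longrightarrow> l = l'"
  unfolding first_exceeds_def by (metis atLeastLessThan_iff linorder_neqE_nat not_le)

lemma first_exceeds_exists:
  assumes "norm (\<Sum>i=k..<j. x i) > r" "k \<le> j"
  obtains l where "k \<le> l" "l \<le> j" "first_exceeds r k l x"
proof -
  define l where "l = (LEAST l. k \<le> l \<and> norm (\<Sum>i=k..<l. x i) > r)"
  have l: "k \<le> l \<and> norm (\<Sum>i=k..<l. x i) > r"
    unfolding l_def by (rule LeastI[of _ j]) (use assms in auto)
  have "l \<le> j" unfolding l_def by (rule Least_le) (use assms in auto)
  moreover have "norm (\<Sum>i=k..<i. x i) \<le> r" if "i \<in> {k..<l}" for i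
    using not_less_Least[of i "\<lambda>l. k \<le> l \<and> norm (\<Sum>i=k..<l. x i) > r"] that by (auto simp: l_def[symmetric])
  ultimately show thesis using that[of l] l by (auto simp: first_exceeds_def)
qed

lemma first_exceeds_restrict: "{k..<l} \<subseteq> A \<Longrightarrow> first_exceeds r k l (restrict x A) = first_exceeds r k l x"
proof -
  assume A: "{k..<l} \<subseteq> A"
  then have "(\<Sum>i=k..<j. restrict x A i) = (\<Sum>i=k..<j. x i)" if "j \<le> l" for j
    using that A by (intro sum.cong) (auto simp: subset_iff)
  then show ?thesis by (auto simp: first_exceeds_def)
qed

lemma measurable_first_exceeds:
  assumes "{k..<l} \<subseteq> A"
  shows "Measurable.pred (PiM A (\<lambda>_. borel :: 'b::{second_countable_topology, real_normed_vector} measure)) (first_exceeds r k l)"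
proof -
  have S: "(\<lambda>x. norm (\<Sum>i=k..<j. x i)) \<in> borel_measurable (PiM A (\<lambda>_. borel :: 'b measure))" if "j \<le> l" for j
    by (rule measurable_compose[OF measurable_sum_component borel_measurable_norm]) (use assms that in \<open>auto simp: subset_iff\<close>)
  show ?thesis unfolding first_exceeds_def[abs_def]
  proof (intro pred_intros_finite pred_intros_logic finite_atLeastLessThan)
    show "Measurable.pred (PiM A (\<lambda>_. borel :: 'b measure)) (\<lambda>x. r < norm (\<Sum>i=k..<l. x i))"
      by (rule borel_measurable_less[OF borel_measurable_const S, unfolded pred_def[symmetric]]) simp
    show "Measurable.pred (PiM A (\<lambda>_. borel :: 'b measure)) (\<lambda>x. norm (\<Sum>i=k..<j. x i) \<le> r)" if "j \<in> {k..<l}" for j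
      by (rule borel_measurable_le[OF S borel_measurable_const, unfolded pred_def[symmetric]]) (use that in simp)
  qed
qed

lemma (in prob_space) prob_first_exceeds:
  fixes X :: "nat \<Rightarrow> 'a \<Rightarrow> 'b::{second_countable_topology, real_normed_vector}"
  assumes [measurable]: "\<And>i. i < n \<Longrightarrow> X i \<in> borel_measurable M" and "k \<le> n"
  shows "prob {\<omega> \<in> space M. \<exists>l\<in>{k..n}. norm (\<Sum>i=k..<l. X i \<omega>) > r} =
    (\<Sum>l\<in>{k..n}. prob {\<omega> \<in> space M. first_exceeds r k l (\<lambda>i. X i \<omega>)})"
proof -
  have "{\<omega> \<in> space M. \<exists>l\<in>{k..n}. norm (\<Sum>i=k..<l. X i \<omega>) > r} =
    (\<Union>l\<in>{k..n}. {\<omega> \<in> space M. first_exceeds r k l (\<lambda>i. X i \<omega>)})"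
  proof (intro equalityI subsetI)
    fix \<omega> assume "\<omega> \<in> {\<omega> \<in> space M. \<exists>l\<in>{k..n}. norm (\<Sum>i=k..<l. X i \<omega>) > r}"
    then obtain j where "\<omega> \<in> space M" "j \<in> {k..n}" "norm (\<Sum>i=k..<j. X i \<omega>) > r" by auto
    moreover from this obtain l where "k \<le> l" "l \<le> j" "first_exceeds r k l (\<lambda>i. X i \<omega>)"
      by (auto elim: first_exceeds_exists[of r _ k j])
    ultimately show "\<omega> \<in> (\<Union>l\<in>{k..n}. {\<omega> \<in> space M. first_exceeds r k l (\<lambda>i. X i \<omega>)})" by auto
  qed (auto simp: first_exceeds_def)
  moreover have "prob (\<Union>l\<in>{k..n}. {\<omega> \<in> space M. first_exceeds r k l (\<lambda>i. X i \<omega>)}) =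
    (\<Sum>l\<in>{k..n}. prob {\<omega> \<in> space M. first_exceeds r k l (\<lambda>i. X i \<omega>)})"
  proof (rule finite_measure_finite_Union)
    show "disjoint_family_on (\<lambda>l. {\<omega> \<in> space M. first_exceeds r k l (\<lambda>i. X i \<omega>)}) {k..n}"
      by (auto simp: disjoint_family_on_def dest: first_exceeds_unique)
    have "{\<omega> \<in> space M. first_exceeds r k l (\<lambda>i. X i \<omega>)} \<in> events" if "l \<in> {k..n}" for l
      by (rule sets_pred_restrict[where A="{k..<l}" and N=borel and X=X and P="first_exceeds r k l"])
         (use that assms in \<open>auto intro!: measurable_first_exceeds simp: first_exceeds_restrict\<close>)
    then show "(\<lambda>l. {\<omega> \<in> space M. first_exceeds r k l (\<lambda>i. X i \<omega>)}) ` {k..n} \<subseteq> events" by auto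
  qed auto
  ultimately show ?thesis by simp
qed

text \<open>Split according to the first l at which the partial sum exceeds \<open>s + t\<close>.
  The remainder from l to n is independent of this event and is at most t in norm with probability
  at least \<open>1 - a\<close>; when both occur, the full sum still exceeds s. The pieces for
  different l are disjoint, so their probabilities add up.\<close>

lemma (in prob_space) ottaviani:
  fixes X :: "nat \<Rightarrow> 'a \<Rightarrow> 'b::{second_countable_topology, real_normed_vector}"
  assumes ind: "indep_vars (\<lambda>_. borel) X {..<n}" and "k \<le> n"
    and a: "\<And>l. k \<le> l \<Longrightarrow> l \<le> n \<Longrightarrow> prob {\<omega> \<in> space M. norm (\<Sum>i=l..<n. X i \<omega>) > t} \<le> a"
  shows "(1 - a) * prob {\<omega> \<in> space M. \<exists>l\<in>{k..n}. norm (\<Sum>i=k..<l. X i \<omega>) > s + t}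
    \<le> prob {\<omega> \<in> space M. norm (\<Sum>i=k..<n. X i \<omega>) > s}"
proof -
  have X[measurable]: "\<And>i. i < n \<Longrightarrow> X i \<in> borel_measurable M" using ind by (auto simp: indep_vars_def)
  have S[measurable]: "(\<lambda>\<omega>. \<Sum>i=j..<l. X i \<omega>) \<in> borel_measurable M" if "l \<le> n" for j l
    using that by (intro borel_measurable_sum) auto
  have fe: "{\<omega> \<in> space M. first_exceeds (s + t) k l (\<lambda>i. X i \<omega>)} \<in> events" if "l \<le> n" for l
    by (rule sets_pred_restrict[where A="{k..<l}" and N=borel and X=X and P="first_exceeds (s + t) k l"])
       (use that X in \<open>auto intro!: measurable_first_exceeds simp: first_exceeds_restrict\<close>)
  let ?E = "\<lambda>l. {\<omega> \<in> space M. first_exceeds (s + t) k l (\<lambda>i. X i \<omega>)}"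
  let ?F = "\<lambda>l. {\<omega> \<in> space M. norm (\<Sum>i=l..<n. X i \<omega>) \<le> t}"
  let ?EF = "\<lambda>l. {\<omega> \<in> space M. first_exceeds (s + t) k l (\<lambda>i. X i \<omega>) \<and> norm (\<Sum>i=l..<n. X i \<omega>) \<le> t}"
  have EF: "?EF l = ?E l \<inter> ?F l" for l by auto
  have step: "(1 - a) * prob (?E l) \<le> prob (?EF l)" if l: "l \<in> {k..n}" for l
  proof -
    have "prob (?EF l) = prob (?E l) * prob (?F l)"
    proof (rule indep_vars_blocks[OF ind, of "{k..<l}" "{l..<n}" "first_exceeds (s + t) k l" "\<lambda>x. norm (\<Sum>i=l..<n. x i) \<le> t"])
      show "Measurable.pred (PiM {k..<l} (\<lambda>_. borel)) (first_exceeds (s + t) k l :: (nat \<Rightarrow> 'b) \<Rightarrow> bool)"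
        by (rule measurable_first_exceeds) simp
      have [measurable]: "(\<lambda>x. \<Sum>i=l..<n. x i) \<in> borel_measurable (PiM {l..<n} (\<lambda>_. borel :: 'b measure))"
        by (rule measurable_sum_component) simp
      show "Measurable.pred (PiM {l..<n} (\<lambda>_. borel)) (\<lambda>x::nat \<Rightarrow> 'b. norm (\<Sum>i=l..<n. x i) \<le> t)"
        by measurable
    qed (use l in \<open>auto simp: first_exceeds_restrict\<close>)
    moreover have "prob (?F l) = 1 - prob {\<omega> \<in> space M. norm (\<Sum>i=l..<n. X i \<omega>) > t}"
    proof -
      have "{\<omega> \<in> space M. norm (\<Sum>i=l..<n. X i \<omega>) > t} = space M - ?F l" by auto
      then show ?thesis using prob_compl[of "?F l"] by simp
    qed
    moreover have "(1 - a) * prob (?E l) \<le> (1 - prob {\<omega> \<in> space M. norm (\<Sum>i=l..<n. X i \<omega>) > t}) * prob (?E l)"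
      using a[of l] l by (intro mult_right_mono) auto
    ultimately show ?thesis by (simp add: mult.commute)
  qed
  have "(1 - a) * prob {\<omega> \<in> space M. \<exists>l\<in>{k..n}. norm (\<Sum>i=k..<l. X i \<omega>) > s + t} = (\<Sum>l\<in>{k..n}. (1 - a) * prob (?E l))"
    by (simp add: prob_first_exceeds[OF X \<open>k \<le> n\<close>] sum_distrib_left)
  also have "\<dots> \<le> (\<Sum>l\<in>{k..n}. prob (?EF l))" by (intro sum_mono step)
  also have "\<dots> = prob (\<Union>l\<in>{k..n}. ?EF l)"
  proof (rule finite_measure_finite_Union[symmetric])
    show "disjoint_family_on ?EF {k..n}"
      by (auto simp: disjoint_family_on_def dest: first_exceeds_unique)
    show "?EF ` {k..n} \<subseteq> events" unfolding EF using fe by auto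
  qed auto
  also have "\<dots> \<le> prob {\<omega> \<in> space M. norm (\<Sum>i=k..<n. X i \<omega>) > s}"
  proof (rule finite_measure_mono)
    show "(\<Union>l\<in>{k..n}. ?EF l) \<subseteq> {\<omega> \<in> space M. norm (\<Sum>i=k..<n. X i \<omega>) > s}"
    proof safe
      fix \<omega> l assume l: "l \<in> {k..n}" and "first_exceeds (s + t) k l (\<lambda>i. X i \<omega>)" "norm (\<Sum>i=l..<n. X i \<omega>) \<le> t"
      moreover have "(\<Sum>i=k..<n. X i \<omega>) = (\<Sum>i=k..<l. X i \<omega>) + (\<Sum>i=l..<n. X i \<omega>)"
        using l by (intro sum.atLeastLessThan_concat[symmetric]) auto
      ultimately show "norm (\<Sum>i=k..<n. X i \<omega>) > s"
        using norm_diff_ineq[of "\<Sum>i=k..<l. X i \<omega>" "\<Sum>i=l..<n. X i \<omega>"] by (auto simp: first_exceeds_def)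
    qed
  qed measurable
  finally show ?thesis .
qed

text \<open>There are p successive blocks after k, without overlap, whose sums exceed
  \<open>2 * r\<close>. The factor 2 is chosen because such a block forces some partial sum started
  at k beyond r.\<close>

primrec oscillates :: "real \<Rightarrow> nat \<Rightarrow> nat \<Rightarrow> (nat \<Rightarrow> 'b::real_normed_vector) \<Rightarrow> nat \<Rightarrow> bool" where
  "oscillates r n 0 x k \<longleftrightarrow> True"
| "oscillates r n (Suc p) x k \<longleftrightarrow>
    (\<exists>j\<in>{k..n}. \<exists>l\<in>{j..n}. norm (\<Sum>i=j..<l. x i) > 2 * r \<and> oscillates r n p x l)"

lemma oscillates_mono: "oscillates r n p x k \<Longrightarrow> k' \<le> k \<Longrightarrow> oscillates r n p x k'"
  by (cases p) (auto intro: order_trans)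

lemma oscillates_restrict: "{k..<n} \<subseteq> A \<Longrightarrow> oscillates r n p (restrict x A) k = oscillates r n p x k"
proof (induction p arbitrary: k)
  case (Suc p)
  have "(\<Sum>i=j..<l. restrict x A i) = (\<Sum>i=j..<l. x i)" if "k \<le> j" "l \<le> n" for j l
    using that Suc.prems by (intro sum.cong) (auto simp: subset_iff)
  moreover have "oscillates r n p (restrict x A) l = oscillates r n p x l" if "k \<le> l" for l
    using that Suc.prems by (intro Suc.IH) auto
  ultimately show ?case by (auto simp del: restrict_apply)
qed simp

lemma measurable_oscillates:
  assumes "{k..<n} \<subseteq> A"
  shows "Measurable.pred (PiM A (\<lambda>_. borel :: 'b::{second_countable_topology, real_normed_vector} measure)) (\<lambda>x. oscillates r n p x k)"
  using assms
proof (induction p arbitrary: k)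
  case (Suc p)
  show ?case unfolding oscillates.simps
  proof (intro pred_intros_finite finite_atLeastAtMost pred_intros_logic)
    fix j l assume jl: "j \<in> {k..n}" "l \<in> {j..n}"
    have [measurable]: "(\<lambda>x. \<Sum>i=j..<l. x i) \<in> borel_measurable (PiM A (\<lambda>_. borel :: 'b measure))"
      by (rule measurable_sum_component) (use Suc.prems jl in auto)
    show "Measurable.pred (PiM A (\<lambda>_. borel :: 'b measure)) (\<lambda>x. 2 * r < norm (\<Sum>i=j..<l. x i))"
      by measurable
    show "Measurable.pred (PiM A (\<lambda>_. borel :: 'b measure)) (\<lambda>x. oscillates r n p x l)"
      by (rule Suc.IH) (use Suc.prems jl in auto)
  qed
qed simp

text \<open>Trades an arbitrary first block for a first passage. The block sum is a difference of
  two partial sums from k, so one of them exceeds r. The passage happens no later than the end of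
  the block, so the other p blocks still lie after it.\<close>

lemma oscillates_Suc_imp:
  assumes "oscillates r n (Suc p) x k" and "0 \<le> r"
  obtains l where "l \<in> {k..n}" "first_exceeds r k l x" "oscillates r n p x l"
proof -
  obtain j l where jl: "k \<le> j" "j \<le> l" "l \<le> n" "norm (\<Sum>i=j..<l. x i) > 2 * r" "oscillates r n p x l"
    using assms by auto
  have "(\<Sum>i=k..<l. x i) = (\<Sum>i=k..<j. x i) + (\<Sum>i=j..<l. x i)"
    using jl by (intro sum.atLeastLessThan_concat[symmetric]) auto
  then have "(\<Sum>i=j..<l. x i) = (\<Sum>i=k..<l. x i) - (\<Sum>i=k..<j. x i)" by simp
  then have "norm (\<Sum>i=k..<l. x i) > r \<or> norm (\<Sum>i=k..<j. x i) > r"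
    using jl(4) norm_triangle_ineq4[of "\<Sum>i=k..<l. x i" "\<Sum>i=k..<j. x i"] by auto
  then obtain i where "k \<le> i" "i \<le> l" "norm (\<Sum>i=k..<i. x i) > r"
  proof (elim disjE)
    assume "norm (\<Sum>i=k..<l. x i) > r" then show thesis using that[of l] jl by simp
  next
    assume "norm (\<Sum>i=k..<j. x i) > r" then show thesis using that[of j] jl by simp
  qed
  obtain m where m: "k \<le> m" "m \<le> i" "first_exceeds r k m x"
    by (rule first_exceeds_exists[OF \<open>norm (\<Sum>i=k..<i. x i) > r\<close> \<open>k \<le> i\<close>])
  then have "m \<le> l" using \<open>i \<le> l\<close> by simp
  moreover have "m \<in> {k..n}" using m \<open>m \<le> l\<close> jl by simp
  ultimately show thesis using that[of m] m oscillates_mono[OF jl(5) \<open>m \<le> l\<close>] by simp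
qed

text \<open>Restart at the first passage through r: the passage has probability at most \<beta>, and
  the p oscillations after it depend on later terms only, which gives the factor
  \<open>\<beta> ^ p\<close> by induction.\<close>

lemma (in prob_space) prob_oscillates_le:
  fixes X :: "nat \<Rightarrow> 'a \<Rightarrow> 'b::{second_countable_topology, real_normed_vector}"
  assumes ind: "indep_vars (\<lambda>_. borel) X {..<n}" and "0 \<le> r" "0 \<le> \<beta>"
    and \<beta>: "\<And>k. k \<le> n \<Longrightarrow> prob {\<omega> \<in> space M. \<exists>l\<in>{k..n}. norm (\<Sum>i=k..<l. X i \<omega>) > r} \<le> \<beta>"
    and "k \<le> n"
  shows "prob {\<omega> \<in> space M. oscillates r n p (\<lambda>i. X i \<omega>) k} \<le> \<beta> ^ p"
  using \<open>k \<le> n\<close>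
proof (induction p arbitrary: k)
  case (Suc p)
  have X[measurable]: "\<And>i. i < n \<Longrightarrow> X i \<in> borel_measurable M" using ind by (auto simp: indep_vars_def)
  let ?E = "\<lambda>l. {\<omega> \<in> space M. first_exceeds r k l (\<lambda>i. X i \<omega>)}"
  let ?F = "\<lambda>l. {\<omega> \<in> space M. oscillates r n p (\<lambda>i. X i \<omega>) l}"
  let ?EF = "\<lambda>l. {\<omega> \<in> space M. first_exceeds r k l (\<lambda>i. X i \<omega>) \<and> oscillates r n p (\<lambda>i. X i \<omega>) l}"
  have osc_ev: "{\<omega> \<in> space M. oscillates r n q (\<lambda>i. X i \<omega>) l} \<in> events" for q l
    by (rule sets_pred_restrict[where A="{l..<n}" and N=borel and X=X and P="\<lambda>x. oscillates r n q x l"])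
       (use X in \<open>auto intro!: measurable_oscillates simp: oscillates_restrict\<close>)
  have fe_ev: "?E l \<in> events" if "l \<le> n" for l
    by (rule sets_pred_restrict[where A="{k..<l}" and N=borel and X=X and P="first_exceeds r k l"])
       (use that X in \<open>auto intro!: measurable_first_exceeds simp: first_exceeds_restrict\<close>)
  have EF: "?EF l = ?E l \<inter> ?F l" for l by auto
  have EF_ev: "?EF l \<in> events" if "l \<le> n" for l using EF osc_ev fe_ev[OF that] by simp
  have step: "prob (?EF l) \<le> prob (?E l) * \<beta> ^ p" if l: "l \<in> {k..n}" for l
  proof -
    have "prob (?EF l) = prob (?E l) * prob (?F l)"
      by (rule indep_vars_blocks[OF ind, of "{k..<l}" "{l..<n}"])
         (use l in \<open>auto intro!: measurable_first_exceeds measurable_oscillates simp: first_exceeds_restrict oscillates_restrict simp del: restrict_apply\<close>)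
    then show ?thesis using Suc.IH[of l] l by (simp add: mult_left_mono)
  qed
  have "prob {\<omega> \<in> space M. oscillates r n (Suc p) (\<lambda>i. X i \<omega>) k} \<le> prob (\<Union>l\<in>{k..n}. ?EF l)"
  proof (rule finite_measure_mono)
    show "{\<omega> \<in> space M. oscillates r n (Suc p) (\<lambda>i. X i \<omega>) k} \<subseteq> (\<Union>l\<in>{k..n}. ?EF l)"
      using \<open>0 \<le> r\<close> by (auto elim!: oscillates_Suc_imp simp del: oscillates.simps)
  qed (use EF_ev in auto)
  also have "\<dots> \<le> (\<Sum>l\<in>{k..n}. prob (?EF l))"
    using EF_ev by (intro finite_measure_subadditive_finite) auto
  also have "\<dots> \<le> (\<Sum>l\<in>{k..n}. prob (?E l) * \<beta> ^ p)" by (intro sum_mono step)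
  also have "\<dots> = prob {\<omega> \<in> space M. \<exists>l\<in>{k..n}. norm (\<Sum>i=k..<l. X i \<omega>) > r} * \<beta> ^ p"
    by (simp add: prob_first_exceeds[OF X Suc.prems] sum_distrib_right)
  also have "\<dots> \<le> \<beta> * \<beta> ^ p" using \<beta>[OF Suc.prems] \<open>0 \<le> \<beta>\<close> by (intro mult_right_mono) auto
  finally show ?case by simp
qed simp

section \<open>Logarithmic moments\<close>

text \<open>The discrete form of integrating a power: weights of order k - 1 accumulate to order k.
  It is used both for the weights of a single moment and for the gain of one order in
  \<open>log_moment_Suc_iff_tail\<close>.\<close>

lemma sum_power_bounds:
  assumes "k \<ge> 1"
  shows "(\<Sum>n<N. real (n + 1) ^ (k - 1)) \<le> real N ^ k" "real N ^ k \<le> real k * (\<Sum>n<N. real (n + 1) ^ (k - 1))"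
proof -
  have "(\<Sum>n<N. real (n + 1) ^ (k - 1)) \<le> (\<Sum>n<N. real N ^ (k - 1))"
    by (intro sum_mono power_mono) auto
  also have "\<dots> = real N ^ k" using assms by (cases k) auto
  finally show "(\<Sum>n<N. real (n + 1) ^ (k - 1)) \<le> real N ^ k" .
  have step: "real (Suc n) ^ j \<le> real n ^ j + real j * real (Suc n) ^ (j - 1)" for n j
  proof (induction j)
    case (Suc j)
    have "real (Suc n) ^ Suc j = real n * real (Suc n) ^ j + real (Suc n) ^ j" by (simp add: algebra_simps)
    also have "\<dots> \<le> real n * (real n ^ j + real j * real (Suc n) ^ (j - 1)) + real (Suc n) ^ j"
      by (intro add_right_mono mult_left_mono Suc.IH) auto
    also have "\<dots> = real n ^ Suc j + real j * (real n * real (Suc n) ^ (j - 1)) + real (Suc n) ^ j"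
      by (simp add: algebra_simps)
    also have "real j * (real n * real (Suc n) ^ (j - 1)) \<le> real j * real (Suc n) ^ j"
    proof (cases j)
      case (Suc i)
      have "real n * real (Suc n) ^ i \<le> real (Suc n) * real (Suc n) ^ i" by (intro mult_right_mono) auto
      then show ?thesis using Suc by (intro mult_left_mono) auto
    qed simp
    finally show ?case by (simp add: algebra_simps)
  qed simp
  show "real N ^ k \<le> real k * (\<Sum>n<N. real (n + 1) ^ (k - 1))"
  proof (induction N)
    case 0 then show ?case using assms by (simp add: power_0_left)
  next
    case (Suc N)
    then show ?case using step[of N k] by (simp add: distrib_left)
  qed
qed

text \<open>A layered substitute for \<open>log_plus r ^ k\<close>. The number N of levels
  \<open>a * b ^ n\<close> below r is about \<open>ln r / ln b\<close>, and the first N weights add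
  up to the order of \<open>N ^ k\<close>. Its integral is a series of tails.\<close>

definition log_weight :: "nat \<Rightarrow> real \<Rightarrow> real \<Rightarrow> real \<Rightarrow> ennreal" where
  "log_weight k a b r = (\<Sum>n. ennreal (real (n + 1) ^ (k - 1)) * indicator {a * b ^ n<..} r)"

lemma log_weight_eq:
  assumes "0 < a" "1 < b"
  obtains N where "log_weight k a b r = ennreal (\<Sum>n<N. real (n + 1) ^ (k - 1))"
    "r \<le> a * b ^ N" "N > 0 \<Longrightarrow> a * b ^ (N - 1) < r"
proof -
  obtain n where "r / a < b ^ n" using real_arch_pow[OF \<open>1 < b\<close>] by auto
  then have ex: "r \<le> a * b ^ n" using \<open>0 < a\<close> by (simp add: field_simps)
  define N where "N = (LEAST n. r \<le> a * b ^ n)"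
  have N: "r \<le> a * b ^ N" unfolding N_def by (rule LeastI[of _ n]) (rule ex)
  have lt: "a * b ^ n < r" if "n < N" for n using not_less_Least[OF that[unfolded N_def]] by simp
  have ge: "r \<le> a * b ^ n" if "N \<le> n" for n
  proof -
    have "a * b ^ N \<le> a * b ^ n" using that assms by (intro mult_left_mono power_increasing) auto
    with N show ?thesis by simp
  qed
  have "log_weight k a b r = (\<Sum>n<N. ennreal (real (n + 1) ^ (k - 1)) * indicator {a * b ^ n<..} r)"
    unfolding log_weight_def by (rule suminf_finite) (use ge in \<open>auto simp: indicator_def not_less\<close>)
  also have "\<dots> = (\<Sum>n<N. ennreal (real (n + 1) ^ (k - 1)))"
    by (intro sum.cong) (use lt in \<open>auto simp: indicator_def\<close>)
  also have "\<dots> = ennreal (\<Sum>n<N. real (n + 1) ^ (k - 1))" by (rule sum_ennreal) simp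
  finally show thesis using that[of N] N lt by simp
qed

lemma add_power_le:
  fixes x y :: real
  assumes "0 \<le> x" "0 \<le> y" shows "(x + y) ^ k \<le> 2 ^ k * x ^ k + 2 ^ k * y ^ k"
proof -
  have "(x + y) ^ k \<le> (2 * max x y) ^ k" using assms by (intro power_mono) auto
  also have "\<dots> = 2 ^ k * max x y ^ k" by (simp add: power_mult_distrib)
  also have "max x y ^ k \<le> x ^ k + y ^ k" using assms by (auto simp: max_def)
  finally show ?thesis by (simp add: distrib_left)
qed

lemma log_plus_nonneg[simp]: "0 \<le> log_plus r"
  by (simp add: log_plus_def)

text \<open>The number N of levels below r and \<open>log_plus r\<close> bound each other up to a
  factor and an additive constant. \<open>add_power_le\<close> separates the additive constant after
  raising to the power k.\<close>

lemma log_weight_log_plus: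
  assumes "0 < a" "1 < b" "k \<ge> 1"
  obtains C where "0 \<le> C" "\<And>r. 0 \<le> r \<Longrightarrow> log_weight k a b r \<le> ennreal C + ennreal C * ennreal (log_plus r ^ k)"
    "\<And>r. 0 \<le> r \<Longrightarrow> ennreal (log_plus r ^ k) \<le> ennreal C + ennreal C * log_weight k a b r"
proof -
  define A where "A = 1 + \<bar>ln a\<bar> / ln b"
  have lnb: "0 < ln b" using assms by simp
  define C1 where "C1 = max (2 ^ k * A ^ k) (2 ^ k * (1 / ln b) ^ k)"
  define C2 where "C2 = max (2 ^ k * \<bar>ln a\<bar> ^ k) (2 ^ k * (ln b) ^ k * k)"
  define C where "C = max C1 C2"
  have A: "0 \<le> A" using lnb by (simp add: A_def)
  have C: "0 \<le> C" using A lnb unfolding C_def C1_def by (simp add: le_max_iff_disj)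
  show thesis
  proof (rule that[OF C])
    fix r :: real assume r: "0 \<le> r"
    obtain N where N: "log_weight k a b r = ennreal (\<Sum>n<N. real (n + 1) ^ (k - 1))"
      "r \<le> a * b ^ N" "N > 0 \<Longrightarrow> a * b ^ (N - 1) < r" using log_weight_eq[OF assms(1,2)] by metis
    define L where "L = log_plus r"
    have L: "0 \<le> L" by (simp add: L_def)
    have NL: "real N \<le> A + (1 / ln b) * L"
    proof (cases N)
      case (Suc n)
      then have n: "a * b ^ n < r" using N by simp
      have pos: "0 < a * b ^ n" using assms by simp
      then have "ln (a * b ^ n) < ln r" using n by (subst ln_less_cancel_iff) auto
      then have "ln a + n * ln b < ln r" using assms by (simp add: ln_mult ln_realpow)
      moreover have "ln r \<le> L" using pos n by (auto simp: L_def log_plus_def)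
      ultimately have "real n * ln b \<le> \<bar>ln a\<bar> + L" by linarith
      then have "real n \<le> (\<bar>ln a\<bar> + L) / ln b" using lnb by (simp add: field_simps)
      then show ?thesis using Suc by (simp add: A_def add_divide_distrib)
    qed (use A L lnb in simp)
    have "real N ^ k \<le> (A + (1 / ln b) * L) ^ k" by (intro power_mono NL) auto
    also have "\<dots> \<le> 2 ^ k * A ^ k + 2 ^ k * ((1 / ln b) * L) ^ k"
      using A L lnb by (intro add_power_le) auto
    also have "\<dots> = 2 ^ k * A ^ k + 2 ^ k * (1 / ln b) ^ k * L ^ k" by (simp add: power_mult_distrib power_divide)
    also have "\<dots> \<le> C + C * L ^ k"
      using L by (intro add_mono mult_right_mono) (auto simp: C_def C1_def le_max_iff_disj)
    finally have "(\<Sum>n<N. real (n + 1) ^ (k - 1)) \<le> C + C * L ^ k"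
      using sum_power_bounds(1)[OF assms(3), of N] by linarith
    then show "log_weight k a b r \<le> ennreal C + ennreal C * ennreal (log_plus r ^ k)"
      using C L unfolding N(1) by (simp add: ennreal_mult[symmetric] ennreal_plus[symmetric] L_def del: ennreal_plus)
    have LN: "L \<le> \<bar>ln a\<bar> + real N * ln b"
    proof (cases "r = 0")
      case False
      then have "ln r \<le> ln (a * b ^ N)" using N(2) r assms by (subst ln_le_cancel_iff) auto
      then have "ln r \<le> ln a + real N * ln b" using assms by (simp add: ln_mult ln_realpow)
      moreover have "0 \<le> real N * ln b" using lnb by simp
      ultimately show ?thesis using False by (simp add: L_def log_plus_def)
    qed (use lnb in \<open>simp add: L_def log_plus_def\<close>)
    have "L ^ k \<le> (\<bar>ln a\<bar> + real N * ln b) ^ k" by (intro power_mono LN L)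
    also have "\<dots> \<le> 2 ^ k * \<bar>ln a\<bar> ^ k + 2 ^ k * (real N * ln b) ^ k" using lnb by (intro add_power_le) auto
    also have "\<dots> = 2 ^ k * \<bar>ln a\<bar> ^ k + 2 ^ k * (ln b) ^ k * real N ^ k" by (simp add: power_mult_distrib)
    also have "\<dots> \<le> 2 ^ k * \<bar>ln a\<bar> ^ k + 2 ^ k * (ln b) ^ k * (real k * (\<Sum>n<N. real (n + 1) ^ (k - 1)))"
      using lnb by (intro add_left_mono mult_left_mono sum_power_bounds assms) auto
    also have "\<dots> = 2 ^ k * \<bar>ln a\<bar> ^ k + 2 ^ k * (ln b) ^ k * k * (\<Sum>n<N. real (n + 1) ^ (k - 1))" by simp
    also have "\<dots> \<le> C + C * (\<Sum>n<N. real (n + 1) ^ (k - 1))"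
      by (intro add_mono mult_right_mono) (auto simp: C_def C2_def le_max_iff_disj sum_nonneg)
    finally show "ennreal (log_plus r ^ k) \<le> ennreal C + ennreal C * log_weight k a b r"
      using C unfolding N(1)
      by (simp add: ennreal_mult[symmetric] ennreal_plus[symmetric] L_def sum_nonneg del: ennreal_plus)
  qed
qed

section \<open>Logarithmic moments as weighted series of tails\<close>

definition log_moment :: "nat \<Rightarrow> (real ^ 'n) measure \<Rightarrow> bool" where
  "log_moment k \<mu> \<longleftrightarrow> (\<integral>\<^sup>+x. ennreal (log_plus (norm x) ^ k) \<partial>\<mu>) < \<infinity>"

lemma I_log_iff: "\<mu> \<in> I_log k \<longleftrightarrow> \<mu> \<in> inf_divisible \<and> log_moment k \<mu>"
  by (simp add: I_log_def log_moment_def)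

lemma measurable_log_plus[measurable]: "log_plus \<in> borel_measurable borel"
  unfolding log_plus_def[abs_def] by measurable

text \<open>On a probability space the two affine bounds of \<open>log_weight_log_plus\<close> make
  both integrals finite together. The criterion holds for every a and b, which can therefore be
  fitted to whatever tail estimate is at hand.\<close>

lemma log_moment_iff_tail:
  fixes \<mu> :: "(real ^ 'n) measure"
  assumes \<mu>: "\<mu> \<in> distributions" and "0 < a" "1 < b" "k \<ge> 1"
  shows "log_moment k \<mu> \<longleftrightarrow>
    (\<Sum>n. ennreal (real (n + 1) ^ (k - 1)) * emeasure \<mu> {x. norm x > a * b ^ n}) < \<infinity>"
proof -
  interpret prob_space \<mu> by (rule distributionsD[OF \<mu>])
  have [measurable_cong]: "sets \<mu> = sets borel" by (rule distributionsD[OF \<mu>])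
  have sp: "space \<mu> = UNIV" by (rule distributionsD[OF \<mu>])
  obtain C where C: "0 \<le> C" "\<And>r. 0 \<le> r \<Longrightarrow> log_weight k a b r \<le> ennreal C + ennreal C * ennreal (log_plus r ^ k)"
    "\<And>r. 0 \<le> r \<Longrightarrow> ennreal (log_plus r ^ k) \<le> ennreal C + ennreal C * log_weight k a b r"
    using log_weight_log_plus[OF assms(2-4)] by blast
  have [measurable]: "log_weight k a b \<in> borel_measurable borel"
    unfolding log_weight_def[abs_def] by measurable
  have "(\<integral>\<^sup>+x. log_weight k a b (norm x) \<partial>\<mu>) =
      (\<Sum>n. \<integral>\<^sup>+x. ennreal (real (n + 1) ^ (k - 1)) * indicator {a * b ^ n<..} (norm x) \<partial>\<mu>)"
    unfolding log_weight_def by (rule nn_integral_suminf) measurable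
  also have "\<dots> = (\<Sum>n. ennreal (real (n + 1) ^ (k - 1)) * emeasure \<mu> {x. norm x > a * b ^ n})"
  proof (intro suminf_cong)
    fix n
    have "(\<integral>\<^sup>+x. ennreal (real (n + 1) ^ (k - 1)) * indicator {a * b ^ n<..} (norm x) \<partial>\<mu>) =
      (\<integral>\<^sup>+x. ennreal (real (n + 1) ^ (k - 1)) * indicator {x. norm x > a * b ^ n} x \<partial>\<mu>)"
      by (intro nn_integral_cong) (auto simp: indicator_def)
    also have "\<dots> = ennreal (real (n + 1) ^ (k - 1)) * emeasure \<mu> {x. norm x > a * b ^ n}"
      by (rule nn_integral_cmult_indicator) measurable
    finally show "(\<integral>\<^sup>+x. ennreal (real (n + 1) ^ (k - 1)) * indicator {a * b ^ n<..} (norm x) \<partial>\<mu>) =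
      ennreal (real (n + 1) ^ (k - 1)) * emeasure \<mu> {x. norm x > a * b ^ n}" .
  qed
  finally have eq: "(\<integral>\<^sup>+x. log_weight k a b (norm x) \<partial>\<mu>) =
    (\<Sum>n. ennreal (real (n + 1) ^ (k - 1)) * emeasure \<mu> {x. norm x > a * b ^ n})" .
  have fin: "(\<integral>\<^sup>+x. g x \<partial>\<mu>) < \<infinity>" if "(\<integral>\<^sup>+x. f x \<partial>\<mu>) < \<infinity>" "\<And>x. g x \<le> ennreal C + ennreal C * f x"
    "f \<in> borel_measurable \<mu>" for f g
  proof -
    have "(\<integral>\<^sup>+x. g x \<partial>\<mu>) \<le> (\<integral>\<^sup>+x. ennreal C + ennreal C * f x \<partial>\<mu>)" by (intro nn_integral_mono that)
    also have "\<dots> = ennreal C + ennreal C * (\<integral>\<^sup>+x. f x \<partial>\<mu>)"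
      using that(3) by (simp add: nn_integral_add nn_integral_cmult emeasure_space_1)
    also have "\<dots> < \<infinity>" using that(1) by (auto simp: ennreal_mult_less_top)
    finally show ?thesis .
  qed
  show ?thesis unfolding eq[symmetric] log_moment_def
    using fin[of "\<lambda>x. ennreal (log_plus (norm x) ^ k)" "\<lambda>x. log_weight k a b (norm x)"]
      fin[of "\<lambda>x. log_weight k a b (norm x)" "\<lambda>x. ennreal (log_plus (norm x) ^ k)"] C by auto
qed

lemma ennreal_suminf_diagonal:
  fixes f :: "nat \<Rightarrow> ennreal"
  shows "(\<Sum>i. \<Sum>j. c i * f (i + j)) = (\<Sum>n. (\<Sum>i\<le>n. c i) * f n)"
proof -
  have "(\<Sum>j. c i * f (i + j)) = (\<Sum>n. (if i \<le> n then c i * f n else 0))" for i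
  proof -
    let ?g = "\<lambda>n. if i \<le> n then c i * f n else 0"
    have "suminf ?g = (\<Sum>n. ?g (n + i)) + sum ?g {..<i}" by (rule suminf_offset) simp
    also have "sum ?g {..<i} = 0" by (intro sum.neutral) auto
    finally show ?thesis by (simp add: add.commute)
  qed
  then have "(\<Sum>i. \<Sum>j. c i * f (i + j)) = (\<Sum>i. \<Sum>n. (if i \<le> n then c i * f n else 0))" by simp
  also have "\<dots> = (\<integral>\<^sup>+i. (\<Sum>n. (if i \<le> n then c i * f n else 0)) \<partial>count_space UNIV)"
    by (simp add: nn_integral_count_space_nat)
  also have "\<dots> = (\<Sum>n. \<integral>\<^sup>+i. (if i \<le> n then c i * f n else 0) \<partial>count_space UNIV)"
    by (rule nn_integral_suminf) simp
  also have "\<dots> = (\<Sum>n. (\<Sum>i\<le>n. c i) * f n)"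
  proof (intro suminf_cong)
    fix n
    have "(\<integral>\<^sup>+i. (if i \<le> n then c i * f n else 0) \<partial>count_space UNIV) = (\<Sum>i. if i \<le> n then c i * f n else 0)"
      by (simp add: nn_integral_count_space_nat)
    also have "\<dots> = (\<Sum>i\<le>n. if i \<le> n then c i * f n else 0)" by (rule suminf_finite) auto
    also have "\<dots> = (\<Sum>i\<le>n. c i) * f n" by (simp add: sum_distrib_right)
    finally show "(\<integral>\<^sup>+i. (if i \<le> n then c i * f n else 0) \<partial>count_space UNIV) = (\<Sum>i\<le>n. c i) * f n" .
  qed
  finally show ?thesis .
qed

text \<open>The source of the shift by one order. When the double series is collected along n = i +
  j, the tail at \<open>a * b ^ n\<close> receives the sum of all weights up to n, which is of order
  \<open>(n + 1) ^ k\<close> instead of \<open>(n + 1) ^ (k - 1)\<close>.\<close>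

lemma log_moment_Suc_iff_tail:
  fixes \<mu> :: "(real ^ 'n) measure"
  assumes \<mu>: "\<mu> \<in> distributions" and "0 < a" "1 < b" "k \<ge> 1"
  shows "log_moment (Suc k) \<mu> \<longleftrightarrow>
    (\<Sum>i. ennreal (real (i + 1) ^ (k - 1)) * (\<Sum>j. emeasure \<mu> {x. norm x > a * b ^ (i + j)})) < \<infinity>"
proof -
  define f where "f n = emeasure \<mu> {x. norm x > a * b ^ n}" for n
  define c where "c n = ennreal (\<Sum>i<Suc n. real (i + 1) ^ (k - 1))" for n
  have "(\<Sum>i. ennreal (real (i + 1) ^ (k - 1)) * (\<Sum>j. f (i + j))) = (\<Sum>n. c n * f n)"
    using ennreal_suminf_diagonal[of "\<lambda>i. ennreal (real (i + 1) ^ (k - 1))" f]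
    by (simp add: c_def lessThan_Suc_atMost sum_ennreal)
  moreover have "(\<Sum>n. c n * f n) < \<infinity> \<longleftrightarrow> (\<Sum>n. ennreal (real (n + 1) ^ k) * f n) < \<infinity>"
  proof
    assume fin: "(\<Sum>n. c n * f n) < \<infinity>"
    have "(\<Sum>n. ennreal (real (n + 1) ^ k) * f n) \<le> (\<Sum>n. ennreal k * (c n * f n))"
    proof (intro suminf_le summableI)
      fix n
      have "ennreal (real (n + 1) ^ k) \<le> ennreal k * c n"
        using sum_power_bounds(2)[OF assms(4), of "Suc n"]
        unfolding c_def by (subst ennreal_mult[symmetric]) (auto simp del: sum.lessThan_Suc intro!: sum_nonneg ennreal_leI)
      then show "ennreal (real (n + 1) ^ k) * f n \<le> ennreal k * (c n * f n)"
        unfolding mult.assoc[symmetric] by (intro mult_right_mono) auto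
    qed
    also have "\<dots> < \<infinity>" using fin by (simp add: ennreal_mult_less_top)
    finally show "(\<Sum>n. ennreal (real (n + 1) ^ k) * f n) < \<infinity>" .
  next
    assume fin: "(\<Sum>n. ennreal (real (n + 1) ^ k) * f n) < \<infinity>"
    have "(\<Sum>n. c n * f n) \<le> (\<Sum>n. ennreal (real (n + 1) ^ k) * f n)"
    proof (intro suminf_le summableI mult_right_mono)
      fix n
      show "c n \<le> ennreal (real (n + 1) ^ k)"
        unfolding c_def using sum_power_bounds(1)[OF assms(4), of "Suc n"] by (intro ennreal_leI) simp
    qed simp
    also note fin
    finally show "(\<Sum>n. c n * f n) < \<infinity>" .
  qed
  ultimately show ?thesis using log_moment_iff_tail[OF assms(1-3), of "Suc k"] by (simp add: f_def)
qed

lemma log_moment_mono: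
  assumes \<mu>: "\<mu> \<in> distributions" and "log_moment k \<mu>" "j \<le> k"
  shows "log_moment j \<mu>"
proof -
  interpret prob_space \<mu> by (rule distributionsD[OF \<mu>])
  have [measurable_cong]: "sets \<mu> = sets borel" by (rule distributionsD[OF \<mu>])
  have "(\<integral>\<^sup>+x. ennreal (log_plus (norm x) ^ j) \<partial>\<mu>) \<le> (\<integral>\<^sup>+x. 1 + ennreal (log_plus (norm x) ^ k) \<partial>\<mu>)"
  proof (rule nn_integral_mono)
    fix x
    have "log_plus (norm x) ^ j \<le> 1 + log_plus (norm x) ^ k"
    proof (cases "log_plus (norm x) \<le> 1")
      case True
      then have "log_plus (norm x) ^ j \<le> 1" by (simp add: power_le_one)
      then show ?thesis by (simp add: add_increasing2)
    next
      case False
      then have "log_plus (norm x) ^ j \<le> log_plus (norm x) ^ k" using \<open>j \<le> k\<close> by (intro power_increasing) auto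
      then show ?thesis by simp
    qed
    then show "ennreal (log_plus (norm x) ^ j) \<le> 1 + ennreal (log_plus (norm x) ^ k)"
      by (simp add: ennreal_plus[symmetric] ennreal_1[symmetric] del: ennreal_plus ennreal_1)
  qed
  also have "\<dots> = 1 + (\<integral>\<^sup>+x. ennreal (log_plus (norm x) ^ k) \<partial>\<mu>)"
    by (subst nn_integral_add) (auto simp: emeasure_space_1)
  also have "\<dots> < \<infinity>" using assms(2) by (simp add: log_moment_def)
  finally show ?thesis by (simp add: log_moment_def)
qed

section \<open>Random series with geometric weights\<close>

lemma indep_sequence_exists:
  fixes \<mu> :: "nat \<Rightarrow> (real ^ 'n) measure"
  assumes "\<And>i. \<mu> i \<in> distributions"
  obtains M :: "(nat \<Rightarrow> real ^ 'n) measure" and X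
  where "prob_space M" "prob_space.indep_vars M (\<lambda>_. borel) X UNIV" "\<And>i. distr M borel (X i) = \<mu> i"
proof -
  define M where "M = PiM UNIV \<mu>"
  interpret P: product_prob_space \<mu> UNIV
    by (intro product_prob_spaceI distributionsD assms)
  have prob: "prob_space M" unfolding M_def by (rule prob_space_PiM) (rule distributionsD[OF assms])
  interpret prob_space M by (rule prob)
  have s: "sets (\<mu> i) = sets borel" for i by (rule distributionsD[OF assms])
  have sM: "sets M = sets (PiM UNIV (\<lambda>_. borel))"
    unfolding M_def by (rule sets_PiM_cong) (simp_all add: s)
  have X: "(\<lambda>\<omega>. \<omega> i) \<in> borel_measurable M" for i
    by (subst measurable_cong_sets[OF sM refl]) (rule measurable_component_singleton, simp)
  have d: "distr M borel (\<lambda>\<omega>. \<omega> i) = \<mu> i" for i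
  proof -
    have "distr M borel (\<lambda>\<omega>. \<omega> i) = distr M (\<mu> i) (\<lambda>\<omega>. \<omega> i)" by (rule distr_cong) (simp_all add: s)
    also have "\<dots> = \<mu> i" unfolding M_def by (rule P.PiM_component) simp
    finally show ?thesis .
  qed
  have "indep_vars (\<lambda>_. borel) (\<lambda>i \<omega>. \<omega> i) (UNIV :: nat set)"
  proof (subst indep_vars_iff_distr_eq_PiM')
    have "distr M (PiM UNIV (\<lambda>_. borel)) (\<lambda>x. \<lambda>i\<in>UNIV. x i) = distr M M (\<lambda>x. x)"
      by (rule distr_cong) (simp_all add: sM restrict_UNIV)
    also have "\<dots> = M" by simp
    also have "\<dots> = PiM UNIV (\<lambda>i. distr M borel (\<lambda>x. x i))" by (simp add: d M_def[symmetric])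
    finally show "distr M (PiM UNIV (\<lambda>_. borel)) (\<lambda>x. \<lambda>i\<in>UNIV. x i) = PiM UNIV (\<lambda>i. distr M borel (\<lambda>x. x i))" .
  qed (use X in auto)
  then show thesis using that prob d by blast
qed

corollary iid_sequence_exists:
  fixes \<mu> :: "(real ^ 'n) measure"
  assumes "\<mu> \<in> distributions"
  shows "\<exists>(M :: (nat \<Rightarrow> real ^ 'n) measure) X. prob_space M \<and>
    prob_space.indep_vars M (\<lambda>_. borel) X UNIV \<and> (\<forall>i::nat. distr M borel (X i) = \<mu>)"
proof -
  define \<kappa> :: "nat \<Rightarrow> (real ^ 'n) measure" where "\<kappa> = (\<lambda>_. \<mu>)"
  have \<kappa>: "\<kappa> i \<in> distributions" for i using assms by (simp add: \<kappa>_def)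
  obtain M :: "(nat \<Rightarrow> real ^ 'n) measure" and X
    where "prob_space M" "prob_space.indep_vars M (\<lambda>_. borel) X UNIV" "\<And>i. distr M borel (X i) = \<kappa> i"
    by (rule indep_sequence_exists[of \<kappa>, OF \<kappa>]) (rule that)
  then show ?thesis by (auto simp: \<kappa>_def)
qed

section \<open>Scaling and the functional equation\<close>

lemma measure_distr_scaleR_tail:
  fixes \<nu> :: "(real ^ 'n) measure"
  assumes "\<nu> \<in> distributions" "0 < c"
  shows "measure (distr \<nu> borel (\<lambda>x. c *\<^sub>R x)) {x. norm x > t} = measure \<nu> {x. norm x > t / c}"
proof -
  have [measurable_cong]: "sets \<nu> = sets borel" by (rule distributionsD[OF assms(1)])
  have "{x. t < norm (c *\<^sub>R x)} = {x :: real^'n. norm x > t / c}" using assms by (auto simp: field_simps)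
  then show ?thesis
    by (subst measure_distr) (auto simp: distributionsD[OF assms(1)] vimage_def)
qed

lemma distr_scaleR_in_distributions:
  assumes "\<nu> \<in> distributions" shows "distr \<nu> borel (\<lambda>x. c *\<^sub>R x) \<in> distributions"
proof -
  interpret prob_space \<nu> by (rule distributionsD[OF assms(1)])
  have [measurable_cong]: "sets \<nu> = sets borel" by (rule distributionsD[OF assms(1)])
  show ?thesis by (rule distr_in_distributions) measurable
qed

lemma char_fun_distr_scaleR:
  assumes "\<nu> \<in> distributions" shows "char_fun (distr \<nu> borel (\<lambda>x. c *\<^sub>R x)) z = char_fun \<nu> (c *\<^sub>R z)"
proof -
  have [measurable_cong]: "sets \<nu> = sets borel" by (rule distributionsD[OF assms(1)])
  have "char_fun (distr \<nu> borel (\<lambda>x. c *\<^sub>R x)) z = char_fun (distr \<nu> borel (\<lambda>x. x)) (c *\<^sub>R z)"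
    by (rule char_fun_scaleR) measurable
  then show ?thesis by (simp add: distr_id_distributions[OF assms])
qed

text \<open>The equation shared by the classes \<open>L\<close> and the values of
  \<open>Phi\<close>. Infinite divisibility is kept out of it, so that it also applies to
  roots.\<close>

definition semi_decomp :: "real \<Rightarrow> (real ^ 'n) measure \<Rightarrow> (real ^ 'n) measure \<Rightarrow> bool" where
  "semi_decomp b \<nu> \<rho> \<longleftrightarrow> (\<forall>z. char_fun \<nu> z = char_fun \<nu> ((1 / b) *\<^sub>R z) * char_fun \<rho> z)"

text \<open>A general l is kept for the sake of remainders: the terms from l to n - 1 of the series,
  together with a copy of \<nu> scaled by \<open>(1 / b) ^ n\<close>, make up a copy of \<nu> scaled
  by \<open>(1 / b) ^ l\<close>.\<close>

lemma semi_decomp_iterate: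
  assumes "semi_decomp b \<nu> \<rho>" "l \<le> n"
  shows "char_fun \<nu> ((1 / b) ^ l *\<^sub>R z) =
    (\<Prod>i=l..<n. char_fun \<rho> ((1 / b) ^ i *\<^sub>R z)) * char_fun \<nu> ((1 / b) ^ n *\<^sub>R z)"
  using assms(2)
proof (induction rule: dec_induct)
  case (step n)
  have "char_fun \<nu> ((1 / b) ^ n *\<^sub>R z) = char_fun \<nu> ((1 / b) ^ Suc n *\<^sub>R z) * char_fun \<rho> ((1 / b) ^ n *\<^sub>R z)"
    using assms(1)[unfolded semi_decomp_def, rule_format, of "(1 / b) ^ n *\<^sub>R z"] by simp
  then show ?case using step by (simp add: mult_ac)
qed simp

text \<open>Division by the value of \<open>char_fun \<nu>\<close> at
  \<open>(1 / b) ^ n *\<^sub>R z\<close> is possible for large n, because this value tends to 1 by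
  continuity at 0.\<close>

lemma semi_decomp_limit:
  fixes \<nu> \<rho> :: "(real ^ 'n) measure"
  assumes "semi_decomp b \<nu> \<rho>" "\<nu> \<in> distributions" "1 < b"
  shows "(\<lambda>n. \<Prod>i<n. char_fun \<rho> ((1 / b) ^ i *\<^sub>R z)) \<longlonglongrightarrow> char_fun \<nu> z"
proof -
  have "(\<lambda>n. (1 / b) ^ n *\<^sub>R z) \<longlonglongrightarrow> 0 *\<^sub>R z"
    using assms by (intro tendsto_scaleR LIMSEQ_power_zero) auto
  then have "(\<lambda>n. char_fun \<nu> ((1 / b) ^ n *\<^sub>R z)) \<longlonglongrightarrow> char_fun \<nu> 0"
    using continuous_on_tendsto_compose[OF continuous_on_char_fun[OF assms(2), of UNIV]] by auto
  then have 1: "(\<lambda>n. char_fun \<nu> ((1 / b) ^ n *\<^sub>R z)) \<longlonglongrightarrow> 1" by (simp add: char_fun_0[OF assms(2)])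
  then have "(\<lambda>n. char_fun \<nu> z / char_fun \<nu> ((1 / b) ^ n *\<^sub>R z)) \<longlonglongrightarrow> char_fun \<nu> z / 1"
    by (intro tendsto_intros) auto
  moreover have "\<forall>\<^sub>F n in sequentially. char_fun \<nu> z / char_fun \<nu> ((1 / b) ^ n *\<^sub>R z) = (\<Prod>i<n. char_fun \<rho> ((1 / b) ^ i *\<^sub>R z))"
    using tendsto_imp_eventually_ne[OF 1, of 0]
  proof (rule eventually_mono)
    fix n assume "char_fun \<nu> ((1 / b) ^ n *\<^sub>R z) \<noteq> 0"
    then show "char_fun \<nu> z / char_fun \<nu> ((1 / b) ^ n *\<^sub>R z) = (\<Prod>i<n. char_fun \<rho> ((1 / b) ^ i *\<^sub>R z))"
      using semi_decomp_iterate[OF assms(1), of 0 n z] by (simp add: atLeast0LessThan)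
  qed simp
  ultimately show ?thesis by (simp add: Lim_transform_eventually)
qed

lemma semi_decomp_if_limit:
  fixes \<nu> \<rho> :: "(real ^ 'n) measure"
  assumes "\<And>z. (\<lambda>n. \<Prod>i<n. char_fun \<rho> ((1 / b) ^ i *\<^sub>R z)) \<longlonglongrightarrow> char_fun \<nu> z"
  shows "semi_decomp b \<nu> \<rho>"
  unfolding semi_decomp_def
proof
  fix z
  have "(\<lambda>n. char_fun \<rho> z * (\<Prod>i<n. char_fun \<rho> ((1 / b) ^ i *\<^sub>R ((1 / b) *\<^sub>R z)))) \<longlonglongrightarrow> char_fun \<rho> z * char_fun \<nu> ((1 / b) *\<^sub>R z)"
    by (intro tendsto_mult tendsto_const assms)
  moreover have "(\<lambda>n. \<Prod>i<Suc n. char_fun \<rho> ((1 / b) ^ i *\<^sub>R z)) \<longlonglongrightarrow> char_fun \<nu> z"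
    by (rule LIMSEQ_Suc[OF assms])
  moreover have "(\<Prod>i<Suc n. char_fun \<rho> ((1 / b) ^ i *\<^sub>R z)) = char_fun \<rho> z * (\<Prod>i<n. char_fun \<rho> ((1 / b) ^ i *\<^sub>R ((1 / b) *\<^sub>R z)))" for n
    by (subst prod.lessThan_Suc_shift) (simp add: mult.commute)
  ultimately show "char_fun \<nu> z = char_fun \<nu> ((1 / b) *\<^sub>R z) * char_fun \<rho> z"
    using LIMSEQ_unique by (simp add: mult.commute)
qed

lemma semi_decomp_unique:
  assumes "semi_decomp b \<nu> \<rho>" "semi_decomp b \<nu>' \<rho>" "\<nu> \<in> distributions" "\<nu>' \<in> distributions" "1 < b"
  shows "\<nu> = \<nu>'"
  using semi_decomp_limit[OF assms(1,3,5)] semi_decomp_limit[OF assms(2,4,5)] assms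
  by (intro char_fun_unique) (auto intro: LIMSEQ_unique)

text \<open>The remainders of the series \<open>\<Sum>\<^sub>j b\<^sup>-\<^sup>j \<xi>\<^sub>j\<close> with \<open>\<xi>\<^sub>j\<close> distributed according to \<open>\<rho>\<close> are copies
  of \<open>\<nu>\<close> scaled down, so Ottaviani's inequality bounds the largest term by the tail of \<open>\<nu>\<close>.\<close>

lemma semi_decomp_tail:
  fixes \<nu> \<rho> :: "(real ^ 'n) measure"
  assumes dec: "semi_decomp b \<nu> \<rho>" and \<nu>: "\<nu> \<in> distributions" and \<rho>: "\<rho> \<in> distributions" and b: "1 < b"
    and t: "0 \<le> t" "measure \<nu> {x. norm x > t} \<le> 1 / 4"
  shows "(\<Sum>j<n. measure \<rho> {x. norm x > 4 * t * b ^ j}) \<le> 2 * measure \<nu> {x. norm x > t}"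
proof (cases "n = 0")
  case False
  \<comment> \<open>The term with index n is a scaled copy of \<nu> that stands for the whole
    remainder of the series. Every sum from l to n then has exactly the law of \<nu> scaled by
    \<open>(1 / b) ^ l\<close>, and a finite number of variables suffices.\<close>
  define \<mu> where "\<mu> i = (if i < n then distr \<rho> borel (\<lambda>x. (1 / b) ^ i *\<^sub>R x) else distr \<nu> borel (\<lambda>x. (1 / b) ^ n *\<^sub>R x))" for i
  have \<mu>: "\<mu> i \<in> distributions" for i unfolding \<mu>_def by (simp add: distr_scaleR_in_distributions \<nu> \<rho>)
  obtain M :: "(nat \<Rightarrow> real ^ 'n) measure" and X
    where M: "prob_space M" "prob_space.indep_vars M (\<lambda>_. borel) X UNIV" "\<And>i. distr M borel (X i) = \<mu> i"
    by (rule indep_sequence_exists[of \<mu>, OF \<mu>]) (rule that)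
  interpret prob_space M by (rule M)
  have X[measurable]: "X i \<in> borel_measurable M" for i using M(2) by (auto simp: indep_vars_def)
  interpret N: prob_space \<nu> by (rule distributionsD[OF \<nu>])
  have [measurable_cong]: "sets \<nu> = sets borel" by (rule distributionsD[OF \<nu>])
  define q where "q = measure \<nu> {x. norm x > t}"
  define p where "p j = measure \<rho> {x. norm x > 4 * t * b ^ j}" for j
  have tail: "prob {\<omega> \<in> space M. norm (\<Sum>i=l..<Suc n. X i \<omega>) > t} \<le> q" if "l \<le> Suc n" for l
  proof (cases "l = Suc n")
    case False
    then have l: "l \<le> n" using that by simp
    have "distr M borel (\<lambda>\<omega>. \<Sum>i=l..<Suc n. X i \<omega>) = distr \<nu> borel (\<lambda>x. (1 / b) ^ l *\<^sub>R x)"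
    proof (rule char_fun_unique)
      fix z
      have "char_fun (distr M borel (\<lambda>\<omega>. \<Sum>i=l..<Suc n. X i \<omega>)) z = (\<Prod>i=l..<Suc n. char_fun (\<mu> i) z)"
        unfolding M(3)[symmetric] by (rule char_fun_indep_sum) (auto intro: indep_vars_subset[OF M(2)])
      also have "\<dots> = (\<Prod>i=l..<n. char_fun (\<mu> i) z) * char_fun (\<mu> n) z" using l by simp
      also have "(\<Prod>i=l..<n. char_fun (\<mu> i) z) = (\<Prod>i=l..<n. char_fun \<rho> ((1 / b) ^ i *\<^sub>R z))"
        by (intro prod.cong) (auto simp: \<mu>_def char_fun_distr_scaleR \<rho>)
      also have "char_fun (\<mu> n) z = char_fun \<nu> ((1 / b) ^ n *\<^sub>R z)" by (simp add: \<mu>_def char_fun_distr_scaleR \<nu>)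
      also have "(\<Prod>i=l..<n. char_fun \<rho> ((1 / b) ^ i *\<^sub>R z)) * \<dots> = char_fun \<nu> ((1 / b) ^ l *\<^sub>R z)"
        by (rule semi_decomp_iterate[OF dec l, symmetric])
      finally show "char_fun (distr M borel (\<lambda>\<omega>. \<Sum>i=l..<Suc n. X i \<omega>)) z = char_fun (distr \<nu> borel (\<lambda>x. (1 / b) ^ l *\<^sub>R x)) z"
        by (simp add: char_fun_distr_scaleR \<nu>)
    qed (auto intro!: distr_in_distributions distr_scaleR_in_distributions \<nu>)
    then have "measure (distr M borel (\<lambda>\<omega>. \<Sum>i=l..<Suc n. X i \<omega>)) {x. norm x > t} = measure \<nu> {x. norm x > t / (1 / b) ^ l}"
      using b by (simp add: measure_distr_scaleR_tail \<nu>)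
    also have "\<dots> \<le> q" unfolding q_def
    proof (rule N.finite_measure_mono)
      have "t * 1 \<le> t * b ^ l" using t b by (intro mult_left_mono one_le_power) auto
      then show "{x. norm x > t / (1 / b) ^ l} \<subseteq> {x::real^'n. norm x > t}" by (auto simp: power_one_over)
    qed measurable
    finally show ?thesis by (subst (asm) measure_distr_norm_greater) auto
  qed (use t in \<open>simp add: q_def not_less\<close>)
  have "(1 - q) * prob {\<omega> \<in> space M. \<exists>l\<in>{0..Suc n}. norm (\<Sum>i=0..<l. X i \<omega>) > t + t}
      \<le> prob {\<omega> \<in> space M. norm (\<Sum>i=0..<Suc n. X i \<omega>) > t}"
    by (rule ottaviani[OF indep_vars_subset[OF M(2)]]) (use tail in auto)
  also have "\<dots> \<le> q" by (rule tail) simp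
  finally have ott: "(1 - q) * prob {\<omega> \<in> space M. \<exists>l\<in>{0..Suc n}. norm (\<Sum>i=0..<l. X i \<omega>) > t + t} \<le> q" .
  \<comment> \<open>A term is the difference of two consecutive partial sums, so a term above
    \<open>4 * t\<close> requires a partial sum above \<open>t + t\<close>.\<close>
  define r where "r = prob {\<omega> \<in> space M. \<exists>j<n. norm (X j \<omega>) > 4 * t}"
  have "r \<le> prob {\<omega> \<in> space M. \<exists>l\<in>{0..Suc n}. norm (\<Sum>i=0..<l. X i \<omega>) > t + t}"
    unfolding r_def
  proof (rule finite_measure_mono)
    show "{\<omega> \<in> space M. \<exists>j<n. norm (X j \<omega>) > 4 * t} \<subseteq> {\<omega> \<in> space M. \<exists>l\<in>{0..Suc n}. norm (\<Sum>i=0..<l. X i \<omega>) > t + t}"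
    proof safe
      fix \<omega> j assume j: "j < n" "norm (X j \<omega>) > 4 * t"
      have "X j \<omega> = (\<Sum>i=0..<Suc j. X i \<omega>) - (\<Sum>i=0..<j. X i \<omega>)" by simp
      then have "norm (X j \<omega>) \<le> norm (\<Sum>i=0..<Suc j. X i \<omega>) + norm (\<Sum>i=0..<j. X i \<omega>)" using norm_triangle_ineq4 by metis
      then have "norm (\<Sum>i=0..<Suc j. X i \<omega>) > t + t \<or> norm (\<Sum>i=0..<j. X i \<omega>) > t + t" using j by linarith
      moreover have "Suc j \<in> {0..Suc n}" "j \<in> {0..Suc n}" using j by auto
      ultimately show "\<exists>l\<in>{0..Suc n}. norm (\<Sum>i=0..<l. X i \<omega>) > t + t" by blast
    qed
  qed measurable
  moreover have "0 \<le> 1 - q" using t by (simp add: q_def)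
  ultimately have "(1 - q) * r \<le> q" using ott mult_left_mono order_trans by blast
  moreover have q: "0 \<le> q" "q \<le> 1 / 4" using t by (auto simp: q_def)
  moreover have "3 / 4 * r \<le> (1 - q) * r" using q by (intro mult_right_mono) (auto simp: r_def)
  ultimately have rq: "3 / 4 * r \<le> q" by linarith
  have pj: "prob {\<omega> \<in> space M. norm (X j \<omega>) > 4 * t} = p j" if "j < n" for j
  proof -
    have "prob {\<omega> \<in> space M. norm (X j \<omega>) > 4 * t} = measure (distr M borel (X j)) {x. norm x > 4 * t}"
      by (simp add: measure_distr_norm_greater)
    also have "\<dots> = p j"
      using that b by (simp add: M(3) \<mu>_def measure_distr_scaleR_tail \<rho> p_def power_one_over)
    finally show ?thesis .
  qed
  have p: "0 \<le> p j" for j by (simp add: p_def)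
  \<comment> \<open>From the maximum to the sum: by independence \<open>1 - r\<close> is the product
    of the \<open>1 - p j\<close>, hence at most \<open>1 / (1 + \<Sum>j<n. p j)\<close>. As r is at
    most 1/3, the sum is at most 3/2 r, and r is at most 4/3 q.\<close>
  have "1 - r = prob (\<Inter>j\<in>{..<n}. X j -` {x. norm x \<le> 4 * t} \<inter> space M)"
  proof -
    have "(\<Inter>j\<in>{..<n}. X j -` {x. norm x \<le> 4 * t} \<inter> space M) = space M - {\<omega> \<in> space M. \<exists>j<n. norm (X j \<omega>) > 4 * t}"
    proof (rule set_eqI)
      fix \<omega>
      have "\<omega> \<in> (\<Inter>j\<in>{..<n}. X j -` {x. norm x \<le> 4 * t} \<inter> space M) \<longleftrightarrow> (\<forall>j<n. norm (X j \<omega>) \<le> 4 * t \<and> \<omega> \<in> space M)"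
        by auto
      also have "\<dots> \<longleftrightarrow> \<omega> \<in> space M \<and> \<not> (\<exists>j<n. \<not> norm (X j \<omega>) \<le> 4 * t)" using False by blast
      finally show "\<omega> \<in> (\<Inter>j\<in>{..<n}. X j -` {x. norm x \<le> 4 * t} \<inter> space M) \<longleftrightarrow> \<omega> \<in> space M - {\<omega> \<in> space M. \<exists>j<n. norm (X j \<omega>) > 4 * t}"
        by (auto simp: not_le)
    qed
    then show ?thesis unfolding r_def by (simp add: prob_compl)
  qed
  also have "\<dots> = (\<Prod>j<n. prob (X j -` {x. norm x \<le> 4 * t} \<inter> space M))"
    by (rule indep_varsD[OF M(2)]) (use False in auto)
  also have "\<dots> = (\<Prod>j<n. 1 - p j)"
  proof (intro prod.cong refl)
    fix j assume "j \<in> {..<n}"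
    have "X j -` {x. norm x \<le> 4 * t} \<inter> space M = space M - {\<omega> \<in> space M. norm (X j \<omega>) > 4 * t}" by (auto simp: not_less)
    then show "prob (X j -` {x. norm x \<le> 4 * t} \<inter> space M) = 1 - p j"
      using pj[of j] \<open>j \<in> {..<n}\<close> by (simp add: prob_compl)
  qed
  also have "\<dots> \<le> (\<Prod>j<n. exp (- p j))"
  proof (intro prod_mono conjI)
    fix j assume "j \<in> {..<n}"
    then show "0 \<le> 1 - p j" using pj[of j, symmetric] by simp
    show "1 - p j \<le> exp (- p j)" using exp_ge_add_one_self[of "- p j"] by simp
  qed
  also have "\<dots> = exp (- (\<Sum>j<n. p j))" by (simp add: exp_sum[symmetric] sum_negf)
  also have "\<dots> \<le> 1 / (1 + (\<Sum>j<n. p j))"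
    using exp_ge_add_one_self[of "\<Sum>j<n. p j"] p unfolding exp_minus inverse_eq_divide
    by (intro divide_left_mono mult_pos_pos add_pos_nonneg sum_nonneg) auto
  finally have "(1 - r) * (1 + (\<Sum>j<n. p j)) \<le> 1"
    using p by (subst (asm) pos_le_divide_eq) (auto intro!: add_pos_nonneg sum_nonneg)
  moreover have "r \<le> 1 / 3" using rq q by linarith
  then have "2 / 3 * (\<Sum>j<n. p j) \<le> (1 - r) * (\<Sum>j<n. p j)" using p by (intro mult_right_mono sum_nonneg) auto
  ultimately have "2 / 3 * (\<Sum>j<n. p j) \<le> r" by (simp add: distrib_left)
  then have "(\<Sum>j<n. p j) \<le> 2 * q" using rq by linarith
  then show ?thesis by (simp add: p_def q_def)
qed simp

text \<open>With t so large that \<nu> has mass below 1/4 beyond it, \<open>semi_decomp_tail\<close>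
  applies at every level \<open>t * b ^ i\<close>. The resulting double series of tails of \<rho> is
  worth one order more than the series of tails of \<nu>.\<close>

lemma semi_decomp_log_moment:
  fixes \<nu> \<rho> :: "(real ^ 'n) measure"
  assumes dec: "semi_decomp b \<nu> \<rho>" and \<nu>: "\<nu> \<in> distributions" and \<rho>: "\<rho> \<in> distributions" and b: "1 < b"
    and k: "log_moment k \<nu>"
  shows "log_moment (Suc k) \<rho>"
proof -
  interpret N: prob_space \<nu> by (rule distributionsD[OF \<nu>])
  have [measurable_cong]: "sets \<nu> = sets borel" by (rule distributionsD[OF \<nu>])
  interpret R: prob_space \<rho> by (rule distributionsD[OF \<rho>])
  have "\<forall>\<^sub>F t in at_top. measure \<nu> {x. norm x > t} < 1 / 4"
    by (rule order_tendstoD[OF tail_tendsto_0[OF \<nu>]]) simp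
  from eventually_conj[OF this eventually_gt_at_top[of 0]]
  obtain t where t: "0 < t" "measure \<nu> {x. norm x > t} < 1 / 4"
    using eventually_happens' trivial_limit_at_top_linorder by blast
  have tail: "(\<Sum>j. emeasure \<rho> {x. norm x > 4 * t * b ^ (i + j)}) \<le> 2 * emeasure \<nu> {x. norm x > t * b ^ i}" for i
  proof (rule suminf_le_const)
    fix n
    have tb: "t * 1 \<le> t * b ^ i" using t b by (intro mult_left_mono one_le_power) auto
    have "measure \<nu> {x. norm x > t * b ^ i} \<le> measure \<nu> {x. norm x > t}"
      by (rule N.finite_measure_mono) (use tb in auto)
    then have "(\<Sum>j<n. measure \<rho> {x. norm x > 4 * (t * b ^ i) * b ^ j}) \<le> 2 * measure \<nu> {x. norm x > t * b ^ i}"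
      using t tb by (intro semi_decomp_tail[OF dec \<nu> \<rho> b]) auto
    then have "ennreal (\<Sum>j<n. measure \<rho> {x. norm x > 4 * t * b ^ (i + j)}) \<le> ennreal (2 * measure \<nu> {x. norm x > t * b ^ i})"
      by (intro ennreal_leI) (simp add: power_add mult.assoc)
    then show "(\<Sum>j<n. emeasure \<rho> {x. norm x > 4 * t * b ^ (i + j)}) \<le> 2 * emeasure \<nu> {x. norm x > t * b ^ i}"
      by (simp add: R.emeasure_eq_measure N.emeasure_eq_measure ennreal_mult)
  qed simp
  show ?thesis
  proof (cases "k = 0")
    case True
    have "(\<Sum>j. emeasure \<rho> {x. norm x > 4 * t * b ^ (0 + j)}) \<le> 2 * emeasure \<nu> {x. norm x > t * b ^ 0}" by (rule tail)
    also have "\<dots> < \<infinity>" by (simp add: N.emeasure_eq_measure ennreal_mult_less_top)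
    finally show ?thesis using True t b log_moment_iff_tail[OF \<rho>, of "4 * t" b 1] by simp
  next
    case False
    then have k1: "k \<ge> 1" by simp
    have "(\<Sum>i. ennreal (real (i + 1) ^ (k - 1)) * (\<Sum>j. emeasure \<rho> {x. norm x > 4 * t * b ^ (i + j)}))
      \<le> (\<Sum>i. ennreal (real (i + 1) ^ (k - 1)) * (2 * emeasure \<nu> {x. norm x > t * b ^ i}))"
      by (intro suminf_le summableI mult_left_mono tail) auto
    also have "\<dots> = 2 * (\<Sum>i. ennreal (real (i + 1) ^ (k - 1)) * emeasure \<nu> {x. norm x > t * b ^ i})"
      by (subst ennreal_suminf_cmult[symmetric]) (simp add: mult_ac)
    also have "\<dots> < \<infinity>" using log_moment_iff_tail[OF \<nu> t(1) b k1] k by (simp add: ennreal_mult_less_top)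
    finally show ?thesis using t b k1 log_moment_Suc_iff_tail[OF \<rho>, of "4 * t" b k] by simp
  qed
qed

text \<open>Borel-Cantelli at the levels \<open>sqrt b ^ j\<close>, whose tails are summable by the
  moment of order 1. The square root splits the decay: one half absorbs the growth of
  \<open>X j\<close>, the other half is left as a convergent geometric series.\<close>

lemma (in prob_space) AE_summable_geometric:
  fixes \<mu> :: "(real ^ 'n) measure"
  assumes \<mu>: "\<mu> \<in> distributions" "log_moment 1 \<mu>" and b: "1 < b"
    and X[measurable]: "\<And>j. X j \<in> borel_measurable M" and d: "\<And>j. distr M borel (X j) = \<mu>"
  shows "AE \<omega> in M. summable (\<lambda>j. (1 / b) ^ j *\<^sub>R X j \<omega>)"
proof -
  define \<beta> where "\<beta> = sqrt b"
  have \<beta>: "1 < \<beta>" "\<beta> * \<beta> = b" using b by (auto simp: \<beta>_def)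
  let ?A = "\<lambda>j. {\<omega> \<in> space M. norm (X j \<omega>) > \<beta> ^ j}"
  have e: "emeasure M (?A j) = emeasure \<mu> {x. norm x > 1 * \<beta> ^ j}" for j
    unfolding d[of j, symmetric] by (simp add: emeasure_distr_norm_greater)
  have "(\<Sum>j. emeasure M (?A j)) < \<infinity>"
    unfolding e using log_moment_iff_tail[OF \<mu>(1), of 1 \<beta> 1] \<beta> \<mu>(2) by simp
  then have "summable (\<lambda>j. prob (?A j))"
    unfolding emeasure_eq_measure by (intro summable_suminf_not_top) auto
  then have "AE \<omega> in M. \<forall>\<^sub>F j in sequentially. \<omega> \<in> space M - ?A j"
    by (intro borel_cantelli_AE1) (auto simp: emeasure_eq_measure)
  then show ?thesis
  proof eventually_elim
    case (elim \<omega>)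
    show ?case
    proof (rule summable_comparison_test_ev)
      show "summable (\<lambda>j. (1 / \<beta>) ^ j)" using \<beta> by (intro summable_geometric) auto
      show "\<forall>\<^sub>F j in sequentially. norm ((1 / b) ^ j *\<^sub>R X j \<omega>) \<le> (1 / \<beta>) ^ j"
        using elim
      proof eventually_elim
        case (elim j)
        then have "norm ((1 / b) ^ j *\<^sub>R X j \<omega>) \<le> (1 / b) ^ j * \<beta> ^ j" using b by (simp add: mult_left_mono not_less)
        also have "\<dots> = (1 / \<beta>) ^ j" using \<beta> by (simp add: power_mult_distrib[symmetric] \<beta>(2)[symmetric])
        finally show ?case .
      qed
    qed
  qed
qed

text \<open>The equation is inherited from the partial sums. For the moments, if every
  \<open>X j\<close> is at most \<open>\<beta> ^ (i + j)\<close> in norm, then the sum is at most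
  \<open>C * b ^ i\<close>. A union bound therefore controls the tail of \<nu> by a sum of tails of
  \<mu>, and \<open>log_moment_Suc_iff_tail\<close> counts the orders.\<close>

lemma geometric_series_law:
  fixes \<mu> :: "(real ^ 'n) measure"
  assumes \<mu>: "\<mu> \<in> distributions" "log_moment 1 \<mu>" and b: "1 < b"
  obtains \<nu> where "\<nu> \<in> distributions" "semi_decomp b \<nu> \<mu>"
    "\<And>k. log_moment (Suc k) \<mu> \<Longrightarrow> log_moment k \<nu>"
proof -
  from iid_sequence_exists[OF \<mu>(1)] obtain M :: "(nat \<Rightarrow> real ^ 'n) measure" and X where
    "prob_space M \<and> prob_space.indep_vars M (\<lambda>_. borel) X UNIV \<and> (\<forall>i::nat. distr M borel (X i) = \<mu>)" by (elim exE)
  then have M: "prob_space M" "prob_space.indep_vars M (\<lambda>_. borel) X UNIV" "\<And>i. distr M borel (X i) = \<mu>" by simp_all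
  interpret prob_space M by (rule M)
  have X[measurable]: "X i \<in> borel_measurable M" for i using M(2) by (auto simp: indep_vars_def)
  define S where "S n \<omega> = (\<Sum>j<n. (1 / b) ^ j *\<^sub>R X j \<omega>)" for n \<omega>
  have [measurable]: "S n \<in> borel_measurable M" for n unfolding S_def[abs_def] by measurable
  define Y where "Y \<omega> = lim (\<lambda>n. S n \<omega>)" for \<omega>
  have [measurable]: "Y \<in> borel_measurable M" unfolding Y_def[abs_def] by measurable
  have Y: "Y \<omega> = (\<Sum>j. (1 / b) ^ j *\<^sub>R X j \<omega>)" for \<omega> by (simp add: Y_def S_def suminf_eq_lim)
  have "AE \<omega> in M. (\<lambda>n. S n \<omega>) \<longlonglongrightarrow> Y \<omega>"
    using AE_summable_geometric[of \<mu> b X, OF \<mu> b X M(3)] by eventually_elim (auto simp: Y S_def summable_LIMSEQ)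
  then have lim: "(\<lambda>n. char_fun (distr M borel (S n)) z) \<longlonglongrightarrow> char_fun (distr M borel Y) z" for z
    by (intro tendsto_char_fun_AE) auto
  have S: "char_fun (distr M borel (S n)) z = (\<Prod>j<n. char_fun \<mu> ((1 / b) ^ j *\<^sub>R z))" for n z
  proof -
    have "indep_vars (\<lambda>_. borel) (\<lambda>j \<omega>. (1 / b) ^ j *\<^sub>R X j \<omega>) {..<n}"
      by (rule indep_vars_compose2[OF indep_vars_subset[OF M(2)]]) auto
    then show ?thesis
      unfolding S_def[abs_def] by (subst char_fun_indep_sum) (auto simp: char_fun_scaleR M(3))
  qed
  show thesis
  proof (rule that)
    show \<nu>: "distr M borel Y \<in> distributions" by (rule distr_in_distributions) measurable
    show "semi_decomp b (distr M borel Y) \<mu>" by (rule semi_decomp_if_limit) (use lim S in simp)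
    fix k assume k: "log_moment (Suc k) \<mu>"
    show "log_moment k (distr M borel Y)"
    proof (cases "k = 0")
      case True
      interpret N: prob_space "distr M borel Y" by (rule distributionsD[OF \<nu>])
      show ?thesis using True by (simp add: log_moment_def N.emeasure_space_1[simplified])
    next
      case False
      then have k1: "k \<ge> 1" by simp
      define \<beta> where "\<beta> = sqrt b"
      have \<beta>: "1 < \<beta>" "\<beta> * \<beta> = b" using b by (auto simp: \<beta>_def)
      have sg: "summable (\<lambda>j. (1 / \<beta>) ^ j)" using \<beta> by (intro summable_geometric) auto
      define C where "C = (\<Sum>j. (1 / \<beta>) ^ j)"
      have C: "0 < C" unfolding C_def using sg \<beta> by (intro suminf_pos) auto
      \<comment> \<open>The levels grow with base b on the left and \<beta> on the right. This does
        no harm, as the tail criteria hold for every base above 1.\<close>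
      have tail: "emeasure (distr M borel Y) {x. norm x > C * b ^ i} \<le> (\<Sum>j. emeasure \<mu> {x. norm x > 1 * \<beta> ^ (i + j)})" for i
      proof -
        have "{\<omega> \<in> space M. norm (Y \<omega>) > C * b ^ i} \<subseteq> (\<Union>j. {\<omega> \<in> space M. norm (X j \<omega>) > \<beta> ^ (i + j)})"
        proof (rule ccontr)
          assume "\<not> ?thesis"
          then obtain \<omega> where \<omega>: "norm (Y \<omega>) > C * b ^ i" "\<And>j. norm (X j \<omega>) \<le> \<beta> ^ (i + j)" by (force simp: not_less[symmetric])
          have "norm (Y \<omega>) \<le> (\<Sum>j. b ^ i * (1 / \<beta>) ^ j)"
            unfolding Y
          proof (rule norm_suminf_le)
            fix j
            have "norm ((1 / b) ^ j *\<^sub>R X j \<omega>) \<le> (1 / b) ^ j * \<beta> ^ (i + j)"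
              using \<omega>(2)[of j] b by (simp add: mult_left_mono)
            also have "\<dots> = \<beta> ^ i * ((1 / b) ^ j * \<beta> ^ j)" by (simp add: power_add)
            also have "(1 / b) ^ j * \<beta> ^ j = (1 / \<beta>) ^ j" using \<beta> by (simp add: power_mult_distrib[symmetric] \<beta>(2)[symmetric])
            also have "\<beta> ^ i * (1 / \<beta>) ^ j \<le> b ^ i * (1 / \<beta>) ^ j"
            proof (intro mult_right_mono power_mono)
              have "\<beta> * 1 \<le> \<beta> * \<beta>" using \<beta>(1) by (intro mult_left_mono) auto
              then show "\<beta> \<le> b" using \<beta>(2) by simp
            qed (use \<beta> in auto)
            finally show "norm ((1 / b) ^ j *\<^sub>R X j \<omega>) \<le> b ^ i * (1 / \<beta>) ^ j" .
          qed (use sg in auto)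
          also have "\<dots> = C * b ^ i" unfolding C_def using sg by (subst suminf_mult) (auto simp: mult.commute)
          finally show False using \<omega>(1) by simp
        qed
        then have "emeasure M {\<omega> \<in> space M. norm (Y \<omega>) > C * b ^ i} \<le> emeasure M (\<Union>j. {\<omega> \<in> space M. norm (X j \<omega>) > \<beta> ^ (i + j)})"
          by (intro emeasure_mono) auto
        also have "\<dots> \<le> (\<Sum>j. emeasure M {\<omega> \<in> space M. norm (X j \<omega>) > \<beta> ^ (i + j)})"
          by (intro emeasure_subadditive_countably) auto
        also have "\<dots> = (\<Sum>j. emeasure \<mu> {x. norm x > 1 * \<beta> ^ (i + j)})"
        proof (intro suminf_cong)
          fix j
          show "emeasure M {\<omega> \<in> space M. norm (X j \<omega>) > \<beta> ^ (i + j)} = emeasure \<mu> {x. norm x > 1 * \<beta> ^ (i + j)}"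
            using emeasure_distr_norm_greater[OF X[of j], of "\<beta> ^ (i + j)"] by (simp add: M(3))
        qed
        finally show ?thesis
          by (simp add: emeasure_distr_norm_greater)
      qed
      have "(\<Sum>i. ennreal (real (i + 1) ^ (k - 1)) * emeasure (distr M borel Y) {x. norm x > C * b ^ i})
        \<le> (\<Sum>i. ennreal (real (i + 1) ^ (k - 1)) * (\<Sum>j. emeasure \<mu> {x. norm x > 1 * \<beta> ^ (i + j)}))"
        by (intro suminf_le summableI mult_left_mono tail) auto
      also have "\<dots> < \<infinity>" using log_moment_Suc_iff_tail[OF \<mu>(1), of 1 \<beta> k] \<beta>(1) k1 k by simp
      finally show ?thesis using log_moment_iff_tail[OF \<nu> C b k1] by simp
    qed
  qed
qed

text \<open>A sum of n independent copies of \<eta> has law \<mu>, and a single copy is its first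
  partial sum. Once t is so large that every remainder exceeds t with probability below 1/2,
  Ottaviani's inequality bounds the tail of \<eta> at \<open>2 * t\<close> by twice the tail of
  \<mu> at t.\<close>

lemma log_moment_root:
  fixes \<mu> \<eta> :: "(real ^ 'n) measure"
  assumes \<mu>: "\<mu> \<in> distributions" "log_moment 1 \<mu>" and \<eta>: "\<eta> \<in> distributions"
    and root: "\<And>z. char_fun \<eta> z ^ n = char_fun \<mu> z" and n: "n \<ge> 1"
  shows "log_moment 1 \<eta>"
proof -
  from iid_sequence_exists[OF \<eta>] obtain M :: "(nat \<Rightarrow> real ^ 'n) measure" and X where
    "prob_space M \<and> prob_space.indep_vars M (\<lambda>_. borel) X UNIV \<and> (\<forall>i::nat. distr M borel (X i) = \<eta>)" by (elim exE)
  then have M: "prob_space M" "prob_space.indep_vars M (\<lambda>_. borel) X UNIV" "\<And>i. distr M borel (X i) = \<eta>" by simp_all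
  interpret prob_space M by (rule M)
  have X[measurable]: "X i \<in> borel_measurable M" for i using M(2) by (auto simp: indep_vars_def)
  have "\<forall>\<^sub>F t in at_top. prob {\<omega> \<in> space M. norm (\<Sum>i=l..<n. X i \<omega>) > t} < 1 / 2" for l
    by (subst measure_distr_norm_greater[symmetric], measurable, rule order_tendstoD[OF tail_tendsto_0]) (auto intro!: distr_in_distributions)
  then have "\<forall>\<^sub>F t in at_top. \<forall>l\<in>{0..n}. prob {\<omega> \<in> space M. norm (\<Sum>i=l..<n. X i \<omega>) > t} < 1 / 2"
    by (intro eventually_ball_finite) auto
  then obtain T where T: "\<And>t. T \<le> t \<Longrightarrow> \<forall>l\<in>{0..n}. prob {\<omega> \<in> space M. norm (\<Sum>i=l..<n. X i \<omega>) > t} < 1 / 2"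
    unfolding eventually_at_top_linorder by blast
  define t0 where "t0 = max T 1"
  have sum_law: "distr M borel (\<lambda>\<omega>. \<Sum>i=0..<n. X i \<omega>) = \<mu>"
  proof (rule char_fun_unique)
    fix z
    have "char_fun (distr M borel (\<lambda>\<omega>. \<Sum>i=0..<n. X i \<omega>)) z = (\<Prod>i=0..<n. char_fun (distr M borel (X i)) z)"
      by (rule char_fun_indep_sum) (auto intro: indep_vars_subset[OF M(2)])
    then show "char_fun (distr M borel (\<lambda>\<omega>. \<Sum>i=0..<n. X i \<omega>)) z = char_fun \<mu> z" by (simp add: M(3) root)
  qed (auto intro!: distr_in_distributions \<mu>)
  interpret E: prob_space \<eta> by (rule distributionsD[OF \<eta>])
  interpret U: prob_space \<mu> by (rule distributionsD[OF \<mu>(1)])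
  have bound: "emeasure \<eta> {x. norm x > 2 * t} \<le> 2 * emeasure \<mu> {x. norm x > t}" if t: "t0 \<le> t" for t
  proof -
    have "measure \<eta> {x. norm x > 2 * t} = prob {\<omega> \<in> space M. norm (X 0 \<omega>) > 2 * t}"
      by (subst measure_distr_norm_greater[symmetric]) (simp_all add: M(3))
    also have "\<dots> \<le> prob {\<omega> \<in> space M. \<exists>l\<in>{0..n}. norm (\<Sum>i=0..<l. X i \<omega>) > t + t}"
      by (rule finite_measure_mono) (use n in \<open>auto intro!: bexI[of _ 1]\<close>)
    finally have 1: "measure \<eta> {x. norm x > 2 * t} \<le> prob {\<omega> \<in> space M. \<exists>l\<in>{0..n}. norm (\<Sum>i=0..<l. X i \<omega>) > t + t}" .
    have "(1 - 1/2) * prob {\<omega> \<in> space M. \<exists>l\<in>{0..n}. norm (\<Sum>i=0..<l. X i \<omega>) > t + t}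
      \<le> prob {\<omega> \<in> space M. norm (\<Sum>i=0..<n. X i \<omega>) > t}"
      using T[of t] t by (intro ottaviani[OF indep_vars_subset[OF M(2)]]) (auto simp: t0_def less_imp_le)
    also have "\<dots> = measure \<mu> {x. norm x > t}" by (subst measure_distr_norm_greater[symmetric]) (simp_all only: sum_law, measurable)
    finally have 2: "(1 - 1/2) * prob {\<omega> \<in> space M. \<exists>l\<in>{0..n}. norm (\<Sum>i=0..<l. X i \<omega>) > t + t} \<le> measure \<mu> {x. norm x > t}" .
    have "p \<le> 2 * m" if "p \<le> q" "(1 - 1/2) * q \<le> m" for p q m :: real using that by simp
    from this[OF 1 2] have "measure \<eta> {x. norm x > 2 * t} \<le> 2 * measure \<mu> {x. norm x > t}" .
    then have "ennreal (measure \<eta> {x. norm x > 2 * t}) \<le> ennreal (2 * measure \<mu> {x. norm x > t})" by (rule ennreal_leI)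
    then show ?thesis by (simp add: E.emeasure_eq_measure U.emeasure_eq_measure ennreal_mult)
  qed
  have "(\<Sum>n. emeasure \<eta> {x. norm x > 2 * t0 * 2 ^ n}) \<le> (\<Sum>n. 2 * emeasure \<mu> {x. norm x > t0 * 2 ^ n})"
  proof (intro suminf_le summableI)
    fix n
    have "t0 * 1 \<le> t0 * 2 ^ n" by (intro mult_left_mono one_le_power) (auto simp: t0_def)
    then show "emeasure \<eta> {x. norm x > 2 * t0 * 2 ^ n} \<le> 2 * emeasure \<mu> {x. norm x > t0 * 2 ^ n}"
      using bound[of "t0 * 2 ^ n"] by (simp add: mult.assoc)
  qed
  also have "\<dots> = 2 * (\<Sum>n. emeasure \<mu> {x. norm x > t0 * 2 ^ n})" by simp
  also have "\<dots> < \<infinity>" using log_moment_iff_tail[OF \<mu>(1), of t0 2 1] \<mu>(2) by (simp add: ennreal_mult_less_top t0_def)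
  finally show ?thesis using log_moment_iff_tail[OF \<eta>, of "2 * t0" 2 1] by (simp add: t0_def)
qed

text \<open>An n-th root of \<nu> is the law of the same series formed with an n-th root of \<mu>:
  the power can be taken inside the infinite product. \<open>log_moment_root\<close> makes this
  second series converge.\<close>

lemma geometric_series_inf_divisible:
  fixes \<mu> :: "(real ^ 'n) measure"
  assumes \<mu>: "\<mu> \<in> inf_divisible" "log_moment 1 \<mu>" and b: "1 < b"
  obtains \<nu> where "\<nu> \<in> inf_divisible" "semi_decomp b \<nu> \<mu>"
    "\<And>k. log_moment (Suc k) \<mu> \<Longrightarrow> log_moment k \<nu>"
proof -
  have \<mu>d: "\<mu> \<in> distributions" using \<mu>(1) by (rule inf_divisible_imp_distributions)
  obtain \<nu> where \<nu>: "\<nu> \<in> distributions" "semi_decomp b \<nu> \<mu>" "\<And>k. log_moment (Suc k) \<mu> \<Longrightarrow> log_moment k \<nu>"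
    using geometric_series_law[OF \<mu>d \<mu>(2) b] by blast
  have "\<exists>\<theta>\<in>distributions. \<forall>z. char_fun \<theta> z ^ n = char_fun \<nu> z" if n: "n \<ge> 1" for n
  proof -
    obtain \<eta> where \<eta>: "\<eta> \<in> distributions" "\<And>z. char_fun \<eta> z ^ n = char_fun \<mu> z"
      using \<mu>(1) n by (auto simp: inf_divisible_iff)
    obtain \<theta> where \<theta>: "\<theta> \<in> distributions" "semi_decomp b \<theta> \<eta>"
      using geometric_series_law[OF \<eta>(1) log_moment_root[OF \<mu>d \<mu>(2) \<eta> n] b] by blast
    have "(\<lambda>m. (\<Prod>i<m. char_fun \<eta> ((1 / b) ^ i *\<^sub>R z)) ^ n) \<longlonglongrightarrow> char_fun \<theta> z ^ n" for z
      by (intro tendsto_power semi_decomp_limit \<theta> b)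
    then have "(\<lambda>m. (\<Prod>i<m. char_fun \<mu> ((1 / b) ^ i *\<^sub>R z))) \<longlonglongrightarrow> char_fun \<theta> z ^ n" for z
      by (simp add: prod_power_distrib \<eta>(2))
    then have "char_fun \<theta> z ^ n = char_fun \<nu> z" for z
      using semi_decomp_limit[OF \<nu>(2,1) b] LIMSEQ_unique by blast
    then show ?thesis using \<theta>(1) by blast
  qed
  then have "\<nu> \<in> inf_divisible" using \<nu>(1) by (simp add: inf_divisible_iff)
  then show thesis using that \<nu> by blast
qed

section \<open>A process with prescribed increments on the dyadic numbers\<close>

text \<open>Serves the consistency of the dyadic laws: both joint laws are the same product measure,
  so a function of either family has the same law.\<close>

lemma indep_vars_distr_eq:
  fixes X :: "nat \<Rightarrow> 'a \<Rightarrow> 'b::topological_space" and X' :: "nat \<Rightarrow> 'c \<Rightarrow> 'b"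
  assumes "prob_space M" "prob_space M'"
    and ind: "prob_space.indep_vars M (\<lambda>_. borel) X {..<K}" "prob_space.indep_vars M' (\<lambda>_. borel) X' {..<K}"
    and eq: "\<And>i. i < K \<Longrightarrow> distr M borel (X i) = distr M' borel (X' i)" and "K > 0"
    and g: "g \<in> measurable (PiM {..<K} (\<lambda>_. borel)) N"
  shows "distr M N (\<lambda>\<omega>. g (\<lambda>i\<in>{..<K}. X i \<omega>)) = distr M' N (\<lambda>\<omega>. g (\<lambda>i\<in>{..<K}. X' i \<omega>))"
proof -
  interpret M: prob_space M by fact
  interpret M': prob_space M' by fact
  have X: "i < K \<Longrightarrow> X i \<in> borel_measurable M" for i using ind(1) by (auto simp: M.indep_vars_def)
  have X': "i < K \<Longrightarrow> X' i \<in> borel_measurable M'" for i using ind(2) by (auto simp: M'.indep_vars_def)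
  have ne: "{..<K} \<noteq> {}" using \<open>K > 0\<close> by auto
  have "distr M (PiM {..<K} (\<lambda>_. borel)) (\<lambda>\<omega>. \<lambda>i\<in>{..<K}. X i \<omega>) = PiM {..<K} (\<lambda>i. distr M borel (X i))"
    by (rule iffD1[OF M.indep_vars_iff_distr_eq_PiM'[OF ne] ind(1)]) (use X in auto)
  also have "\<dots> = PiM {..<K} (\<lambda>i. distr M' borel (X' i))" by (rule PiM_cong) (auto simp: eq)
  also have "\<dots> = distr M' (PiM {..<K} (\<lambda>_. borel)) (\<lambda>\<omega>. \<lambda>i\<in>{..<K}. X' i \<omega>)"
    by (rule iffD1[OF M'.indep_vars_iff_distr_eq_PiM'[OF ne] ind(2), symmetric]) (use X' in auto)
  finally have *: "distr M (PiM {..<K} (\<lambda>_. borel)) (\<lambda>\<omega>. \<lambda>i\<in>{..<K}. X i \<omega>) =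
    distr M' (PiM {..<K} (\<lambda>_. borel)) (\<lambda>\<omega>. \<lambda>i\<in>{..<K}. X' i \<omega>)" .
  have m: "(\<lambda>\<omega>. \<lambda>i\<in>{..<K}. X i \<omega>) \<in> measurable M (PiM {..<K} (\<lambda>_. borel))"
    "(\<lambda>\<omega>. \<lambda>i\<in>{..<K}. X' i \<omega>) \<in> measurable M' (PiM {..<K} (\<lambda>_. borel))"
    by (rule measurable_restrict, use X in auto, rule measurable_restrict, use X' in auto)
  show ?thesis
    using arg_cong[OF *, of "\<lambda>L. distr L N g"] g m by (simp add: distr_distr comp_def)
qed

definition dyadic :: "nat \<Rightarrow> nat \<Rightarrow> real" where
  "dyadic N k = real k / 2 ^ N"

definition dyadic_index :: "nat \<Rightarrow> real \<Rightarrow> nat" where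
  "dyadic_index N t = nat \<lfloor>t * 2 ^ N\<rfloor>"

lemma dyadic_index_dyadic [simp]: "dyadic_index N (dyadic N k) = k"
  by (simp add: dyadic_index_def dyadic_def)

lemma dyadic_raise: "dyadic N k = dyadic (N + j) (k * 2 ^ j)"
  by (simp add: dyadic_def power_add)

lemma range_dyadic_mono: "N \<le> N' \<Longrightarrow> range (dyadic N) \<subseteq> range (dyadic N')"
  using dyadic_raise[of N _ "N' - N"] by auto

lemma finite_subset_range_dyadic:
  "finite J \<Longrightarrow> J \<subseteq> (\<Union>N. range (dyadic N)) \<Longrightarrow> \<exists>N. J \<subseteq> range (dyadic N)"
proof (induction rule: finite_induct)
  case (insert t J)
  then obtain N N' where "J \<subseteq> range (dyadic N)" "t \<in> range (dyadic N')" by auto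
  then show ?case
    using range_dyadic_mono[of N "max N N'"] range_dyadic_mono[of N' "max N N'"]
    by (intro exI[of _ "max N N'"]) auto
qed simp

lemma sum_double: "(\<Sum>i<2 * k. f i) = (\<Sum>i<k. f (2 * i) + f (2 * i + 1))" for f :: "nat \<Rightarrow> 'b::comm_monoid_add"
  by (induction k) (auto simp: add_ac)

text \<open>On the grid of mesh \<open>1 / 2 ^ N\<close> take partial sums of independent copies of
  \<open>\<nu> N\<close>. By \<open>sq\<close>, adding the terms of level N + 1 in pairs reproduces
  level N, so the finite-dimensional laws do not depend on the level. The projective limit lives on
  functions of a real variable, which is the sample type that \<open>Phi_law\<close> asks
  for.\<close>

lemma dyadic_process_exists:
  fixes \<nu> :: "nat \<Rightarrow> (real ^ 'n) measure"
  assumes \<nu>: "\<And>N. \<nu> N \<in> distributions" and sq: "\<And>N z. char_fun (\<nu> N) z = char_fun (\<nu> (Suc N)) z ^ 2"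
  obtains M :: "(real \<Rightarrow> real ^ 'n) measure" and Z where "prob_space M"
    "\<And>N k. Z (dyadic N k) \<in> borel_measurable M"
    "\<And>N n. prob_space.indep_vars M (\<lambda>_. borel) (\<lambda>i \<omega>. Z (dyadic N (Suc i)) \<omega> - Z (dyadic N i) \<omega>) {..<n}"
    "\<And>N i. distr M borel (\<lambda>\<omega>. Z (dyadic N (Suc i)) \<omega> - Z (dyadic N i) \<omega>) = \<nu> N"
proof -
  have "\<forall>N. \<exists>(M :: (nat \<Rightarrow> real ^ 'n) measure) X. prob_space M \<and> prob_space.indep_vars M (\<lambda>_. borel) X UNIV \<and>
      (\<forall>i::nat. distr M borel (X i) = \<nu> N)" by (intro allI iid_sequence_exists \<nu>)
  from choice[OF this] obtain M :: "nat \<Rightarrow> (nat \<Rightarrow> real ^ 'n) measure" where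
    "\<forall>N. \<exists>X. prob_space (M N) \<and> prob_space.indep_vars (M N) (\<lambda>_. borel) X UNIV \<and> (\<forall>i::nat. distr (M N) borel (X i) = \<nu> N)" ..
  from choice[OF this] obtain X
    where "\<forall>N. prob_space (M N) \<and> prob_space.indep_vars (M N) (\<lambda>_. borel) (X N) UNIV \<and> (\<forall>i::nat. distr (M N) borel (X N i) = \<nu> N)" ..
  then have M: "\<And>N. prob_space (M N)" and ind: "\<And>N. prob_space.indep_vars (M N) (\<lambda>_. borel) (X N) UNIV"
      and law: "\<And>N i. distr (M N) borel (X N i) = \<nu> N" by blast+
  interpret M: prob_space "M N" for N by (rule M)
  have X: "X N i \<in> borel_measurable (M N)" for N i using ind by (auto simp: M.indep_vars_def)
  define Q where "Q N J = distr (M N) (PiM J (\<lambda>_. borel)) (\<lambda>\<omega>. \<lambda>t\<in>J. \<Sum>i<dyadic_index N t. X N i \<omega>)" for N J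
  have mQ: "(\<lambda>\<omega>. \<lambda>t\<in>J. \<Sum>i<dyadic_index N t. X N i \<omega>) \<in> measurable (M N) (PiM J (\<lambda>_. borel))" for N J
    by (intro measurable_restrict borel_measurable_sum X)
  have Q_step: "Q (Suc N) J = Q N J" if J: "finite J" "J \<subseteq> range (dyadic N)" for N J
  proof -
    \<comment> \<open>A bound for all grid indices of J. Inserting 0 keeps \<open>Max\<close>
      defined when J is empty, and the successor keeps K positive.\<close>
    define K where "K = Suc (Max (insert 0 (dyadic_index N ` J)))"
    have K: "dyadic_index N t < K" if "t \<in> J" for t
      unfolding K_def using that J by (intro le_imp_less_Suc Max_ge) auto
    have K': "i < K" if "t \<in> J" "i < dyadic_index N t" for i t using K[OF that(1)] that(2) by simp
    define g :: "(nat \<Rightarrow> real ^ 'n) \<Rightarrow> real \<Rightarrow> real ^ 'n" where "g x = (\<lambda>t\<in>J. \<Sum>i<dyadic_index N t. x i)" for x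
    have g: "g \<in> measurable (PiM {..<K} (\<lambda>_. borel)) (PiM J (\<lambda>_. borel))"
      unfolding g_def[abs_def]
      by (intro measurable_restrict borel_measurable_sum measurable_component_singleton) (auto simp: K')
    define Y where "Y i \<omega> = X (Suc N) (2 * i) \<omega> + X (Suc N) (2 * i + 1) \<omega>" for i \<omega>
    have 1: "Q N J = distr (M N) (PiM J (\<lambda>_. borel)) (\<lambda>\<omega>. g (\<lambda>i\<in>{..<K}. X N i \<omega>))"
      unfolding Q_def g_def by (intro distr_cong refl restrict_ext sum.cong) (auto simp: K')
    have dbl: "dyadic_index (Suc N) t = 2 * dyadic_index N t" if "t \<in> J" for t
    proof -
      obtain k where k: "t = dyadic N k" using J(2) \<open>t \<in> J\<close> by blast
      show ?thesis unfolding k dyadic_index_dyadic using dyadic_index_dyadic[of "Suc N" "2 * k"] by (simp add: dyadic_def)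
    qed
    have 2: "Q (Suc N) J = distr (M (Suc N)) (PiM J (\<lambda>_. borel)) (\<lambda>\<omega>. g (\<lambda>i\<in>{..<K}. Y i \<omega>))"
      unfolding Q_def g_def
      by (intro distr_cong refl restrict_ext) (auto simp: dbl sum_double Y_def K' intro!: sum.cong)
    have dj: "disjoint_family_on (\<lambda>j::nat. {2 * j, 2 * j + 1}) {..<K}"
      unfolding disjoint_family_on_def by (auto; presburger)
    have "M.indep_vars (Suc N) (\<lambda>j. PiM {2 * j, 2 * j + 1} (\<lambda>_. borel)) (\<lambda>j \<omega>. restrict (\<lambda>i. X (Suc N) i \<omega>) {2 * j, 2 * j + 1}) {..<K}"
      by (rule M.indep_vars_restrict[OF ind _ dj]) simp
    then have "M.indep_vars (Suc N) (\<lambda>_. borel) (\<lambda>j \<omega>. (\<lambda>x. x (2 * j) + x (2 * j + 1)) (restrict (\<lambda>i. X (Suc N) i \<omega>) {2 * j, 2 * j + 1})) {..<K}"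
      by (rule M.indep_vars_compose2) (intro borel_measurable_add measurable_component_singleton, auto)
    then have indY: "M.indep_vars (Suc N) (\<lambda>_. borel) Y {..<K}" by (simp add: Y_def[abs_def])
    have lawY: "distr (M (Suc N)) borel (Y i) = \<nu> N" for i
    proof (rule char_fun_unique)
      fix z
      have "char_fun (distr (M (Suc N)) borel (\<lambda>\<omega>. \<Sum>j\<in>{2 * i, 2 * i + 1}. X (Suc N) j \<omega>)) z = (\<Prod>j\<in>{2 * i, 2 * i + 1}. char_fun (distr (M (Suc N)) borel (X (Suc N) j)) z)"
        by (rule M.char_fun_indep_sum) (auto intro: M.indep_vars_subset[OF ind])
      then show "char_fun (distr (M (Suc N)) borel (Y i)) z = char_fun (\<nu> N) z"
        by (simp add: Y_def[abs_def] law sq[of N] power2_eq_square)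
    qed (use X in \<open>auto intro!: M.distr_in_distributions \<nu> borel_measurable_add simp: Y_def[abs_def]\<close>)
    show ?thesis unfolding 1 2
      by (rule indep_vars_distr_eq[OF M M indY M.indep_vars_subset[OF ind] _ _ g]) (auto simp: lawY law K_def)
  qed
  have Q_mono: "Q N' J = Q N J" if "N \<le> N'" "finite J" "J \<subseteq> range (dyadic N)" for N N' J
    using that(1)
  proof (induction rule: dec_induct)
    case (step n)
    then show ?case using Q_step[of J n] that range_dyadic_mono[of N n] by auto
  qed simp
  define D where "D = (\<Union>N. range (dyadic N))"
  \<comment> \<open>Every grid that contains J gives the same law. The least one is only a canonical
    choice, and \<open>P_eq\<close> exchanges it for any other.\<close>
  define P where "P J = Q (LEAST N. J \<subseteq> range (dyadic N)) J" for J
  have P_eq: "P J = Q N J" if "finite J" "J \<subseteq> range (dyadic N)" for J N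
    unfolding P_def by (rule Q_mono[symmetric]) (use that in \<open>auto intro: Least_le LeastI2\<close>)
  have proj: "polish_projective D P"
  proof (unfold polish_projective_def, rule projective_family.intro)
    fix J H assume JH: "J \<subseteq> H" "finite H" "H \<subseteq> D"
    obtain N where N: "H \<subseteq> range (dyadic N)" using finite_subset_range_dyadic[of H] JH by (auto simp: D_def)
    have "distr (P H) (PiM J (\<lambda>_. borel)) (\<lambda>f. restrict f J) = distr (Q N H) (PiM J (\<lambda>_. borel)) (\<lambda>f. restrict f J)"
      using P_eq[OF JH(2) N] by simp
    also have "\<dots> = distr (M N) (PiM J (\<lambda>_. borel)) (\<lambda>\<omega>. restrict (\<lambda>t\<in>H. \<Sum>i<dyadic_index N t. X N i \<omega>) J)"
      unfolding Q_def by (subst distr_distr[OF measurable_restrict_subset[OF JH(1)] mQ]) (simp add: comp_def)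
    also have "\<dots> = Q N J" unfolding Q_def using JH(1) by (intro distr_cong refl) (auto simp: restrict_def fun_eq_iff subset_iff)
    also have "\<dots> = P J" using JH N by (intro P_eq[symmetric]) (auto intro: finite_subset)
    finally show "P J = distr (P H) (PiM J (\<lambda>_. borel)) (\<lambda>f. restrict f J)" ..
  next
    fix J assume "finite J" "J \<subseteq> D"
    show "prob_space (P J)" unfolding P_def Q_def by (rule M.prob_space_distr) (rule mQ)
  qed
  interpret polish_projective D P by (rule proj)
  define Z where "Z t \<omega> = \<omega> t" for t :: real and \<omega> :: "real \<Rightarrow> real ^ 'n"
  have sl: "sets lim = sets (PiM D (\<lambda>_. borel))" by (rule sets_lim)
  have Z: "Z t \<in> borel_measurable lim" if "t \<in> D" for t
    unfolding Z_def[abs_def] by (subst measurable_cong_sets[OF sl refl]) (rule measurable_component_singleton[OF that])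
  have lim_restrict: "distr lim (PiM J (\<lambda>_. borel)) (\<lambda>\<omega>. restrict \<omega> J) = P J" if J: "finite J" "J \<subseteq> D" for J
  proof (rule measure_eqI)
    have r: "(\<lambda>\<omega>. restrict \<omega> J) \<in> measurable lim (PiM J (\<lambda>_. borel))"
      by (subst measurable_cong_sets[OF sl refl]) (rule measurable_restrict_subset[OF J(2)])
    fix A assume "A \<in> sets (distr lim (PiM J (\<lambda>_. borel)) (\<lambda>\<omega>. restrict \<omega> J))"
    then have A: "A \<in> sets (PiM J (\<lambda>_. borel))" by simp
    have "emeasure (distr lim (PiM J (\<lambda>_. borel)) (\<lambda>\<omega>. restrict \<omega> J)) A = emeasure lim (emb D J A)"
      by (subst emeasure_distr[OF r A]) (simp add: prod_emb_def space_PiM)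
    also have "\<dots> = P J A" by (rule emeasure_lim_emb[OF J(2,1) A])
    finally show "emeasure (distr lim (PiM J (\<lambda>_. borel)) (\<lambda>\<omega>. restrict \<omega> J)) A = P J A" .
  qed (use sets_P[OF J] in simp)
  have inD: "dyadic N k \<in> D" for N k by (auto simp: D_def)
  have incr: "distr lim (PiM {..<n} (\<lambda>_. borel)) (\<lambda>\<omega>. \<lambda>i\<in>{..<n}. Z (dyadic N (Suc i)) \<omega> - Z (dyadic N i) \<omega>) =
      distr (M N) (PiM {..<n} (\<lambda>_. borel)) (\<lambda>\<omega>. \<lambda>i\<in>{..<n}. X N i \<omega>)" for N n
  proof -
    define J where "J = dyadic N ` {..n}"
    have J: "finite J" "J \<subseteq> D" "J \<subseteq> range (dyadic N)" using inD by (auto simp: J_def)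
    have JI: "dyadic N i \<in> J" if "i \<le> n" for i using that by (simp add: J_def)
    define h :: "(real \<Rightarrow> real ^ 'n) \<Rightarrow> nat \<Rightarrow> real ^ 'n" where "h x = (\<lambda>i\<in>{..<n}. x (dyadic N (Suc i)) - x (dyadic N i))" for x
    have h: "h \<in> measurable (PiM J (\<lambda>_. borel)) (PiM {..<n} (\<lambda>_. borel))"
      unfolding h_def[abs_def] by (intro measurable_restrict borel_measurable_diff measurable_component_singleton JI) auto
    have r: "(\<lambda>\<omega>. restrict \<omega> J) \<in> measurable lim (PiM J (\<lambda>_. borel))"
      by (subst measurable_cong_sets[OF sl refl]) (rule measurable_restrict_subset[OF J(2)])
    have "distr lim (PiM {..<n} (\<lambda>_. borel)) (\<lambda>\<omega>. \<lambda>i\<in>{..<n}. Z (dyadic N (Suc i)) \<omega> - Z (dyadic N i) \<omega>)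
      = distr lim (PiM {..<n} (\<lambda>_. borel)) (\<lambda>\<omega>. h (restrict \<omega> J))"
      unfolding h_def Z_def by (intro distr_cong refl restrict_ext) (auto simp: JI)
    also have "\<dots> = distr (P J) (PiM {..<n} (\<lambda>_. borel)) h"
      unfolding lim_restrict[OF J(1,2), symmetric] by (subst distr_distr[OF h r]) (simp add: comp_def)
    also have "\<dots> = distr (Q N J) (PiM {..<n} (\<lambda>_. borel)) h" by (simp add: P_eq[OF J(1,3)])
    also have "\<dots> = distr (M N) (PiM {..<n} (\<lambda>_. borel)) (\<lambda>\<omega>. h (\<lambda>t\<in>J. \<Sum>i<dyadic_index N t. X N i \<omega>))"
      unfolding Q_def by (subst distr_distr[OF h mQ]) (simp add: comp_def)
    also have "\<dots> = distr (M N) (PiM {..<n} (\<lambda>_. borel)) (\<lambda>\<omega>. \<lambda>i\<in>{..<n}. X N i \<omega>)"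
      unfolding h_def by (intro distr_cong refl restrict_ext) (auto simp: JI)
    finally show ?thesis .
  qed
  have mincr: "(\<lambda>\<omega>. Z (dyadic N (Suc i)) \<omega> - Z (dyadic N i) \<omega>) \<in> borel_measurable lim" for N i
    by (intro borel_measurable_diff Z inD)
  have law_incr: "distr lim borel (\<lambda>\<omega>. Z (dyadic N (Suc i)) \<omega> - Z (dyadic N i) \<omega>) = \<nu> N" for N i
  proof -
    have c: "(\<lambda>x. x i) \<in> measurable (PiM {..<Suc i} (\<lambda>_. borel :: (real ^ 'n) measure)) borel"
      by (rule measurable_component_singleton) simp
    have m: "(\<lambda>\<omega>. \<lambda>j\<in>{..<Suc i}. Z (dyadic N (Suc j)) \<omega> - Z (dyadic N j) \<omega>) \<in> measurable lim (PiM {..<Suc i} (\<lambda>_. borel))"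
      by (intro measurable_restrict mincr)
    have m': "(\<lambda>\<omega>. \<lambda>j\<in>{..<Suc i}. X N j \<omega>) \<in> measurable (M N) (PiM {..<Suc i} (\<lambda>_. borel))"
      by (intro measurable_restrict X)
    show ?thesis
      using arg_cong[OF incr[of "Suc i" N], of "\<lambda>L. distr L borel (\<lambda>x. x i)"] law[of N i]
      by (simp add: distr_distr[OF c m] distr_distr[OF c m'] comp_def)
  qed
  have "P.indep_vars (\<lambda>_. borel) (\<lambda>i \<omega>. Z (dyadic N (Suc i)) \<omega> - Z (dyadic N i) \<omega>) {..<n}" for N n
  proof (cases "n = 0")
    case True then show ?thesis by (simp add: P.indep_vars_def P.indep_sets_def)
  next
    case False
    then have ne: "{..<n} \<noteq> {}" by auto
    show ?thesis
    proof (rule iffD2[OF P.indep_vars_iff_distr_eq_PiM'[OF ne mincr]])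
      have "distr (M N) (PiM {..<n} (\<lambda>_. borel)) (\<lambda>\<omega>. \<lambda>i\<in>{..<n}. X N i \<omega>) = PiM {..<n} (\<lambda>i. distr (M N) borel (X N i))"
        by (rule iffD1[OF M.indep_vars_iff_distr_eq_PiM'[OF ne X] M.indep_vars_subset[OF ind]]) simp
      then show "distr lim (PiM {..<n} (\<lambda>_. borel)) (\<lambda>\<omega>. \<lambda>i\<in>{..<n}. Z (dyadic N (Suc i)) \<omega> - Z (dyadic N i) \<omega>) =
        PiM {..<n} (\<lambda>i. distr lim borel (\<lambda>\<omega>. Z (dyadic N (Suc i)) \<omega> - Z (dyadic N i) \<omega>))"
        by (simp add: incr law law_incr)
    qed
  qed
  then show thesis using that[OF P.prob_space_axioms, of Z] Z inD law_incr by blast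
qed

section \<open>Regularization of paths on the dyadic numbers\<close>

definition dyadics :: "real set" where
  "dyadics = (\<Union>N. range (dyadic N))"

lemma dyadic_in_dyadics [simp]: "dyadic N k \<in> dyadics"
  by (auto simp: dyadics_def)

text \<open>The counterpart of \<open>oscillates\<close> over all dyadic times between s and e, with
  no common grid prescribed.\<close>

primrec time_oscillates :: "real \<Rightarrow> (real \<Rightarrow> 'b::real_normed_vector) \<Rightarrow> real \<Rightarrow> nat \<Rightarrow> real \<Rightarrow> bool" where
  "time_oscillates r z e 0 s \<longleftrightarrow> True"
| "time_oscillates r z e (Suc p) s \<longleftrightarrow> (\<exists>q\<in>dyadics. \<exists>q'\<in>dyadics. s \<le> q \<and> q \<le> q' \<and> q' \<le> e \<and>
    norm (z q' - z q) > 2 * r \<and> time_oscillates r z e p q')"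

lemma time_oscillates_mono: "time_oscillates r z e p s \<Longrightarrow> s' \<le> s \<Longrightarrow> time_oscillates r z e p s'"
  by (cases p) (auto intro: order_trans)

lemma dyadics_in_grid:
  assumes "s \<in> dyadics"
  obtains N where "\<And>N'. N \<le> N' \<Longrightarrow> \<exists>k. s = dyadic N' k"
proof -
  obtain N k where "s = dyadic N k" using assms by (auto simp: dyadics_def)
  then have "\<exists>k. s = dyadic N' k" if "N \<le> N'" for N' using range_dyadic_mono[OF that] by blast
  then show thesis using that by blast
qed

lemma dyadic_le_iff [simp]: "dyadic N k \<le> dyadic N l \<longleftrightarrow> k \<le> l"
  by (simp add: dyadic_def divide_le_cancel)

text \<open>Finitely many dyadic times lie on a common grid and on all finer ones. The conclusion
  covers all fine grids rather than one: the induction has to pass to a maximum of levels, and later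
  the event has to lie in a limit inferior of grid events.\<close>

lemma time_oscillates_imp_oscillates:
  assumes "time_oscillates r z (dyadic m (Suc j)) p s" "s \<in> dyadics" "dyadic m j \<le> s"
  shows "\<exists>N0\<ge>m. \<forall>N\<ge>N0. \<forall>k. dyadic N (j * 2 ^ (N - m) + k) = s \<longrightarrow>
    oscillates r (2 ^ (N - m)) p (\<lambda>i. z (dyadic N (Suc (j * 2 ^ (N - m) + i))) - z (dyadic N (j * 2 ^ (N - m) + i))) k"
  using assms
proof (induction p arbitrary: s)
  case (Suc p)
  obtain q q' where q: "q \<in> dyadics" "q' \<in> dyadics" "s \<le> q" "q \<le> q'" "q' \<le> dyadic m (Suc j)"
    "norm (z q' - z q) > 2 * r" "time_oscillates r z (dyadic m (Suc j)) p q'" using Suc.prems(1) by auto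
  have cq: "dyadic m j \<le> q" "dyadic m j \<le> q'" using q Suc.prems(3) by linarith+
  obtain N0 where N0: "m \<le> N0" "\<And>N k. N0 \<le> N \<Longrightarrow> dyadic N (j * 2 ^ (N - m) + k) = q' \<Longrightarrow>
    oscillates r (2 ^ (N - m)) p (\<lambda>i. z (dyadic N (Suc (j * 2 ^ (N - m) + i))) - z (dyadic N (j * 2 ^ (N - m) + i))) k"
    using Suc.IH[OF q(7,2) cq(2)] by auto
  obtain N1 where N1: "\<And>N. N1 \<le> N \<Longrightarrow> \<exists>k. q = dyadic N k" by (rule dyadics_in_grid[OF q(1)]) (rule that)
  obtain N2 where N2: "\<And>N. N2 \<le> N \<Longrightarrow> \<exists>k. q' = dyadic N k" by (rule dyadics_in_grid[OF q(2)]) (rule that)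
  show ?case
  proof (intro exI[of _ "max N0 (max N1 N2)"] conjI allI impI)
    show "m \<le> max N0 (max N1 N2)" using N0(1) by simp
    fix N k assume N: "max N0 (max N1 N2) \<le> N" and k: "dyadic N (j * 2 ^ (N - m) + k) = s"
    define off where "off = j * 2 ^ (N - m)"
    have mN: "m \<le> N" using N N0(1) by simp
    have e: "dyadic m (Suc j) = dyadic N (off + 2 ^ (N - m))" "dyadic m j = dyadic N off"
      using dyadic_raise[of m "Suc j" "N - m"] dyadic_raise[of m j "N - m"] mN by (simp_all add: off_def add.commute)
    obtain a where a: "q = dyadic N a" using N1[of N] N by auto
    obtain b where b: "q' = dyadic N b" using N2[of N] N by auto
    have ab: "off + k \<le> a" "a \<le> b" "b \<le> off + 2 ^ (N - m)"
      using q(3-5) unfolding a b e k[symmetric] off_def[symmetric] by simp_all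
    define x where "x = (\<lambda>i. z (dyadic N (Suc (off + i))) - z (dyadic N (off + i)))"
    have "(\<Sum>i=a - off..<b - off. x i) = z (dyadic N (off + (b - off))) - z (dyadic N (off + (a - off)))"
      unfolding x_def using ab by (subst sum_Suc_diff'[of _ _ "\<lambda>i. z (dyadic N (off + i))", simplified]) auto
    also have "\<dots> = z q' - z q" using ab by (simp add: a b)
    finally have "norm (\<Sum>i=a - off..<b - off. x i) > 2 * r" using q(6) by simp
    moreover have "oscillates r (2 ^ (N - m)) p x (b - off)"
      unfolding x_def off_def by (rule N0(2)) (use N ab in \<open>auto simp: b off_def\<close>)
    moreover have "a - off \<in> {k..2 ^ (N - m)}" "b - off \<in> {a - off..2 ^ (N - m)}" using ab by auto
    ultimately have "oscillates r (2 ^ (N - m)) (Suc p) x k" unfolding oscillates.simps by blast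
    then show "oscillates r (2 ^ (N - m)) (Suc p) (\<lambda>i. z (dyadic N (Suc (j * 2 ^ (N - m) + i))) - z (dyadic N (j * 2 ^ (N - m) + i))) k"
      by (simp only: x_def off_def)
  qed
qed auto

text \<open>Rules out a failure of one-sided limits, since near such a point the oscillations would
  exceed every p. For each r, the condition concerns countably many intervals, so it is enough to
  have it almost surely on each.\<close>

definition regular :: "(real \<Rightarrow> 'b::real_normed_vector) \<Rightarrow> bool" where
  "regular z \<longleftrightarrow> (\<forall>r>0. \<exists>m. \<forall>j. \<exists>p. \<not> time_oscillates r z (dyadic m (Suc j)) p (dyadic m j))"

text \<open>If the Cauchy property fails at t, there is a bad pair of times between t and any later
  s. Pairs are collected from right to left, each strictly before the previous ones, until their
  number exceeds any p in the interval that contains t.\<close>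

lemma regular_right_Cauchy:
  assumes z: "regular z" and "0 \<le> t" "0 < \<epsilon>"
  shows "\<exists>\<delta>>0. \<forall>q\<in>dyadics \<inter> {t<..<t + \<delta>}. \<forall>q'\<in>dyadics \<inter> {t<..<t + \<delta>}. norm (z q - z q') \<le> \<epsilon>"
proof (rule ccontr)
  assume "\<not> ?thesis"
  then have bad: "\<exists>q\<in>dyadics \<inter> {t<..<t + \<delta>}. \<exists>q'\<in>dyadics \<inter> {t<..<t + \<delta>}. norm (z q - z q') > \<epsilon>" if "0 < \<delta>" for \<delta>
    using that by (meson not_le)
  obtain m where m: "\<And>j. \<exists>p. \<not> time_oscillates (\<epsilon> / 2) z (dyadic m (Suc j)) p (dyadic m j)"
    using z \<open>0 < \<epsilon>\<close> unfolding regular_def by (metis half_gt_zero)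
  define j where "j = nat \<lfloor>t * 2 ^ m\<rfloor>"
  have j: "dyadic m j \<le> t" "t < dyadic m (Suc j)"
  proof -
    have "0 \<le> t * 2 ^ m" using \<open>0 \<le> t\<close> by simp
    then have "real j \<le> t * 2 ^ m" "t * 2 ^ m < real (Suc j)" unfolding j_def by linarith+
    then show "dyadic m j \<le> t" "t < dyadic m (Suc j)" by (simp_all add: dyadic_def field_simps)
  qed
  have "\<exists>s>t. s \<le> dyadic m (Suc j) \<and> time_oscillates (\<epsilon> / 2) z (dyadic m (Suc j)) p s" for p
  proof (induction p)
    case 0 then show ?case using j by auto
  next
    case (Suc p)
    then obtain s where s: "t < s" "s \<le> dyadic m (Suc j)" "time_oscillates (\<epsilon> / 2) z (dyadic m (Suc j)) p s" by auto
    obtain q q' where q: "q \<in> dyadics" "q' \<in> dyadics" "t < q" "q \<le> q'" "q' < s" "norm (z q' - z q) > \<epsilon>"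
    proof -
      obtain u v where uv: "u \<in> dyadics" "v \<in> dyadics" "t < u" "u < s" "t < v" "v < s" "norm (z u - z v) > \<epsilon>"
        using bad[of "s - t"] s(1) by auto
      show thesis
      proof (cases "u \<le> v")
        case True then show ?thesis using that[of u v] uv by (simp add: norm_minus_commute)
      next
        case False then show ?thesis using that[of v u] uv by simp
      qed
    qed
    have "time_oscillates (\<epsilon> / 2) z (dyadic m (Suc j)) p q'" using time_oscillates_mono[OF s(3)] q(5) by simp
    then have "time_oscillates (\<epsilon> / 2) z (dyadic m (Suc j)) (Suc p) q"
      unfolding time_oscillates.simps by (intro bexI[OF _ q(1)] bexI[OF _ q(2)]) (use q s(2) in auto)
    then show ?case using q s(2) by (intro exI[of _ q]) auto
  qed
  then have "time_oscillates (\<epsilon> / 2) z (dyadic m (Suc j)) p (dyadic m j)" for p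
    using time_oscillates_mono j(1) by (meson less_imp_le order_trans)
  then show False using m[of j] by blast
qed

text \<open>Here the bad pairs accumulate at t from the left. The count can start afresh at any s <
  t, so the induction runs over all such s.\<close>

lemma regular_left_Cauchy:
  assumes z: "regular z" and "0 < t" "0 < \<epsilon>"
  shows "\<exists>\<delta>>0. \<forall>q\<in>dyadics \<inter> {t - \<delta><..<t}. \<forall>q'\<in>dyadics \<inter> {t - \<delta><..<t}. norm (z q - z q') \<le> \<epsilon>"
proof (rule ccontr)
  assume "\<not> ?thesis"
  then have bad: "\<exists>q\<in>dyadics \<inter> {t - \<delta><..<t}. \<exists>q'\<in>dyadics \<inter> {t - \<delta><..<t}. norm (z q - z q') > \<epsilon>" if "0 < \<delta>" for \<delta>
    using that by (meson not_le)
  obtain m where m: "\<And>j. \<exists>p. \<not> time_oscillates (\<epsilon> / 2) z (dyadic m (Suc j)) p (dyadic m j)"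
    using z \<open>0 < \<epsilon>\<close> unfolding regular_def by (metis half_gt_zero)
  \<comment> \<open>The ceiling keeps t strictly to the right of the left endpoint even if t is a
    grid point, so that times shortly before t belong to the interval.\<close>
  define j where "j = nat (\<lceil>t * 2 ^ m\<rceil> - 1)"
  have j: "dyadic m j < t" "t \<le> dyadic m (Suc j)"
  proof -
    have "0 < t * 2 ^ m" using \<open>0 < t\<close> by simp
    then have "real j < t * 2 ^ m" "t * 2 ^ m \<le> real (Suc j)" unfolding j_def by linarith+
    then show "dyadic m j < t" "t \<le> dyadic m (Suc j)" by (simp_all add: dyadic_def field_simps)
  qed
  have "time_oscillates (\<epsilon> / 2) z (dyadic m (Suc j)) p s" if "s < t" for p s
    using that
  proof (induction p arbitrary: s)
    case (Suc p)
    obtain q q' where q: "q \<in> dyadics" "q' \<in> dyadics" "s < q" "q \<le> q'" "q' < t" "norm (z q' - z q) > \<epsilon>"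
    proof -
      obtain u v where uv: "u \<in> dyadics" "v \<in> dyadics" "s < u" "u < t" "s < v" "v < t" "norm (z u - z v) > \<epsilon>"
        using bad[of "t - s"] Suc.prems by auto
      show thesis
      proof (cases "u \<le> v")
        case True then show ?thesis using that[of u v] uv by (simp add: norm_minus_commute)
      next
        case False then show ?thesis using that[of v u] uv by simp
      qed
    qed
    then show ?case
      unfolding time_oscillates.simps by (intro bexI[OF _ q(1)] bexI[OF _ q(2)]) (use Suc.IH[of q'] j(2) in auto)
  qed simp
  then show False using m[of j] j(1) by blast
qed

text \<open>The grid time is strictly after t even when t is dyadic. The approximation is therefore
  a genuine right limit, unaffected by the value at t.\<close>

definition next_dyadic :: "nat \<Rightarrow> real \<Rightarrow> nat" where
  "next_dyadic k t = nat \<lfloor>t * 2 ^ k\<rfloor> + 1"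

lemma next_dyadic_bounds:
  assumes "0 \<le> t" shows "t < dyadic k (next_dyadic k t)" "dyadic k (next_dyadic k t) \<le> t + 1 / 2 ^ k"
proof -
  have "0 \<le> t * 2 ^ k" using assms by simp
  then have "t * 2 ^ k < real (next_dyadic k t)" "real (next_dyadic k t) \<le> t * 2 ^ k + 1"
    unfolding next_dyadic_def by linarith+
  then show "t < dyadic k (next_dyadic k t)" "dyadic k (next_dyadic k t) \<le> t + 1 / 2 ^ k"
    by (simp_all add: dyadic_def field_simps)
qed

lemma next_dyadic_mono: "s \<le> t \<Longrightarrow> next_dyadic k s \<le> next_dyadic k t"
  unfolding next_dyadic_def by (intro add_right_mono nat_mono floor_mono mult_right_mono) auto

lemma next_dyadic_tendsto:
  assumes "0 \<le> t" shows "(\<lambda>k. dyadic k (next_dyadic k t)) \<longlonglongrightarrow> t"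
proof (rule tendsto_sandwich[of "\<lambda>_. t" _ _ "\<lambda>k. t + 1 / 2 ^ k"])
  have "(\<lambda>k. t + (1 / 2) ^ k) \<longlonglongrightarrow> t + 0" by (intro tendsto_intros LIMSEQ_power_zero) auto
  then show "(\<lambda>k. t + 1 / 2 ^ k) \<longlonglongrightarrow> t" by (simp add: power_one_over)
qed (use next_dyadic_bounds[OF assms] in \<open>auto intro!: always_eventually less_imp_le\<close>)

lemma next_dyadic_eventually:
  assumes "0 \<le> t" "t < u"
  shows "\<forall>\<^sub>F k in sequentially. dyadic k (next_dyadic k t) \<in> dyadics \<inter> {t<..<u}"
  using order_tendstoD(2)[OF next_dyadic_tendsto[OF assms(1)] assms(2)]
  by eventually_elim (use next_dyadic_bounds(1)[OF assms(1)] in auto)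

text \<open>One fixed sequence of times is used so that the result is a measurable function of the
  path values. For regular paths it is the limit along all dyadic times decreasing to t.\<close>

definition regularize :: "(real \<Rightarrow> 'b::banach) \<Rightarrow> real \<Rightarrow> 'b" where
  "regularize z t = lim (\<lambda>k. z (dyadic k (next_dyadic k t)))"

lemma regularize_tendsto:
  fixes z :: "real \<Rightarrow> 'b::banach"
  assumes z: "regular z" and t: "0 \<le> t"
  shows "(\<lambda>k. z (dyadic k (next_dyadic k t))) \<longlonglongrightarrow> regularize z t"
proof -
  have "Cauchy (\<lambda>k. z (dyadic k (next_dyadic k t)))"
  proof (rule metric_CauchyI)
    fix e :: real assume "0 < e"
    then obtain \<delta> where \<delta>: "\<delta> > 0" "\<And>q q'. q \<in> dyadics \<inter> {t<..<t + \<delta>} \<Longrightarrow> q' \<in> dyadics \<inter> {t<..<t + \<delta>} \<Longrightarrow> norm (z q - z q') \<le> e / 2"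
      using regular_right_Cauchy[OF z t, of "e / 2"] by auto
    obtain K where "\<And>k. K \<le> k \<Longrightarrow> dyadic k (next_dyadic k t) \<in> dyadics \<inter> {t<..<t + \<delta>}"
      using next_dyadic_eventually[OF t, of "t + \<delta>"] \<delta>(1) by (auto simp: eventually_sequentially)
    then have "dist (z (dyadic k (next_dyadic k t))) (z (dyadic l (next_dyadic l t))) < e" if "K \<le> k" "K \<le> l" for k l
      using that \<delta>(2)[of "dyadic k (next_dyadic k t)" "dyadic l (next_dyadic l t)"] \<open>0 < e\<close> by (force simp: dist_norm)
    then show "\<exists>K. \<forall>k\<ge>K. \<forall>l\<ge>K. dist (z (dyadic k (next_dyadic k t))) (z (dyadic l (next_dyadic l t))) < e" by blast
  qed
  then show ?thesis unfolding regularize_def by (simp add: Cauchy_convergent_iff convergent_LIMSEQ_iff)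
qed

text \<open>Carries estimates from dyadic times shortly after t over to the right limit at t;
  applied once or twice, it yields estimates between regularized values.\<close>

lemma regularize_close:
  fixes z :: "real \<Rightarrow> 'b::banach"
  assumes z: "regular z" and t: "0 \<le> t" "t < u" and w: "\<And>q. q \<in> dyadics \<inter> {t<..<u} \<Longrightarrow> norm (z q - w) \<le> \<epsilon>"
  shows "norm (regularize z t - w) \<le> \<epsilon>"
proof (rule tendsto_upperbound)
  show "(\<lambda>k. norm (z (dyadic k (next_dyadic k t)) - w)) \<longlonglongrightarrow> norm (regularize z t - w)"
    by (intro tendsto_intros regularize_tendsto z t)
  show "\<forall>\<^sub>F k in sequentially. norm (z (dyadic k (next_dyadic k t)) - w) \<le> \<epsilon>"
    using next_dyadic_eventually[OF t] by eventually_elim (rule w)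
qed simp

lemma regularize_right_continuous:
  fixes z :: "real \<Rightarrow> 'b::banach"
  assumes z: "regular z" and t: "0 \<le> t"
  shows "continuous (at_right t) (regularize z)"
  unfolding continuous_within
proof (rule tendstoI)
  fix e :: real assume "0 < e"
  then obtain \<delta> where \<delta>: "\<delta> > 0" "\<And>q q'. q \<in> dyadics \<inter> {t<..<t + \<delta>} \<Longrightarrow> q' \<in> dyadics \<inter> {t<..<t + \<delta>} \<Longrightarrow> norm (z q - z q') \<le> e / 2"
    using regular_right_Cauchy[OF z t, of "e / 2"] by auto
  have 1: "norm (z q - regularize z t) \<le> e / 2" if q: "q \<in> dyadics \<inter> {t<..<t + \<delta>}" for q
    using regularize_close[OF z t, of "t + \<delta>" "z q" "e / 2"] \<delta> q by (simp add: norm_minus_commute)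
  have "dist (regularize z s) (regularize z t) < e" if "t < s" "s < t + \<delta>" for s
  proof -
    have "norm (regularize z s - regularize z t) \<le> e / 2"
      by (rule regularize_close[OF z, of s "t + \<delta>"]) (use that t 1 in auto)
    then show ?thesis using \<open>0 < e\<close> by (simp add: dist_norm)
  qed
  then show "\<forall>\<^sub>F s in at_right t. dist (regularize z s) (regularize z t) < e"
    unfolding eventually_at_right_field using \<delta>(1) by (intro exI[of _ "t + \<delta>"]) auto
qed

lemma regularize_left_limit:
  fixes z :: "real \<Rightarrow> 'b::banach"
  assumes z: "regular z" and t: "0 < t"
  shows "\<exists>l. (regularize z \<longlongrightarrow> l) (at_left t)"
proof -
  \<comment> \<open>The bound \<open>\<delta> \<le> t\<close> keeps all times nonnegative, where
    right limits are under control.\<close>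
  have close: "\<exists>\<delta>>0. \<delta> \<le> t \<and> (\<forall>s s'. t - \<delta> < s \<longrightarrow> s < t \<longrightarrow> t - \<delta> < s' \<longrightarrow> s' < t \<longrightarrow> norm (regularize z s - regularize z s') \<le> e)" if "0 < e" for e
  proof -
    obtain \<delta> where \<delta>: "\<delta> > 0" "\<And>q q'. q \<in> dyadics \<inter> {t - \<delta><..<t} \<Longrightarrow> q' \<in> dyadics \<inter> {t - \<delta><..<t} \<Longrightarrow> norm (z q - z q') \<le> e"
      using regular_left_Cauchy[OF z t \<open>0 < e\<close>] by auto
    have "norm (regularize z s - regularize z s') \<le> e"
      if s: "t - min \<delta> t < s" "s < t" "t - min \<delta> t < s'" "s' < t" for s s'
    proof -
      have 1: "norm (regularize z s' - z q) \<le> e" if "q \<in> dyadics \<inter> {t - \<delta><..<t}" for q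
        by (rule regularize_close[OF z, of s' t]) (use that s \<delta>(2) in auto)
      show ?thesis
        by (rule regularize_close[OF z, of s t]) (use s 1 in \<open>auto simp: norm_minus_commute\<close>)
    qed
    then show ?thesis using \<delta>(1) t by (intro exI[of _ "min \<delta> t"]) auto
  qed
  define x where "x n = regularize z (t - t / real (n + 2))" for n
  have "(\<lambda>n. t - t * inverse (real (Suc (Suc n)))) \<longlonglongrightarrow> t - t * 0"
    by (intro tendsto_intros LIMSEQ_Suc[OF LIMSEQ_inverse_real_of_nat])
  then have lim: "(\<lambda>n. t - t / real (n + 2)) \<longlonglongrightarrow> t" by (simp add: field_simps)
  have ev: "\<forall>\<^sub>F n in sequentially. t - \<delta> < t - t / real (n + 2) \<and> t - t / real (n + 2) < t" if "0 < \<delta>" for \<delta>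
    using order_tendstoD(1)[OF lim, of "t - \<delta>"] that t by (auto elim!: eventually_mono)
  have "Cauchy x"
  proof (rule metric_CauchyI)
    fix e :: real assume "0 < e"
    then obtain \<delta> where \<delta>: "\<delta> > 0" "\<And>s s'. t - \<delta> < s \<Longrightarrow> s < t \<Longrightarrow> t - \<delta> < s' \<Longrightarrow> s' < t \<Longrightarrow> norm (regularize z s - regularize z s') \<le> e / 2"
      using close[of "e / 2"] by auto
    obtain K where K: "\<And>n. K \<le> n \<Longrightarrow> t - \<delta> < t - t / real (n + 2) \<and> t - t / real (n + 2) < t"
      using ev[OF \<delta>(1)] by (auto simp: eventually_sequentially)
    have "dist (x k) (x l) < e" if "K \<le> k" "K \<le> l" for k l
      using K[OF that(1)] K[OF that(2)] \<delta>(2)[of "t - t / real (k + 2)" "t - t / real (l + 2)"] \<open>0 < e\<close>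
      unfolding dist_norm x_def by linarith
    then show "\<exists>K. \<forall>k\<ge>K. \<forall>l\<ge>K. dist (x k) (x l) < e" by blast
  qed
  then obtain l where l: "x \<longlonglongrightarrow> l" by (auto simp: Cauchy_convergent_iff convergent_def)
  have "(regularize z \<longlongrightarrow> l) (at_left t)"
  proof (rule tendstoI)
    fix e :: real assume "0 < e"
    then obtain \<delta> where \<delta>: "\<delta> > 0" "\<And>s s'. t - \<delta> < s \<Longrightarrow> s < t \<Longrightarrow> t - \<delta> < s' \<Longrightarrow> s' < t \<Longrightarrow> norm (regularize z s - regularize z s') \<le> e / 2"
      using close[of "e / 2"] by auto
    have "dist (regularize z s) l < e" if s: "t - \<delta> < s" "s < t" for s
    proof -
      have "norm (regularize z s - l) \<le> e / 2"
      proof (rule tendsto_upperbound)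
        show "(\<lambda>n. norm (regularize z s - x n)) \<longlonglongrightarrow> norm (regularize z s - l)" by (intro tendsto_intros l)
        show "\<forall>\<^sub>F n in sequentially. norm (regularize z s - x n) \<le> e / 2"
          using ev[OF \<delta>(1)] by eventually_elim (use \<delta>(2) s in \<open>auto simp: x_def\<close>)
      qed simp
      then show ?thesis using \<open>0 < e\<close> by (simp add: dist_norm)
    qed
    then show "\<forall>\<^sub>F s in at_left t. dist (regularize z s) l < e"
      unfolding eventually_at_left_field using \<delta>(1) by (intro exI[of _ "t - \<delta>"]) auto
  qed
  then show ?thesis by blast
qed

section \<open>Construction of a Levy process\<close>

text \<open>For continuous functions with values in [0, 1] the product formula survives the limit by
  dominated convergence. Indicators of closed sets are limits of such functions, and the closed sets
  are a generator stable under intersection.\<close>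

lemma (in prob_space) indep_vars_limit:
  fixes X :: "'i \<Rightarrow> 'a \<Rightarrow> 'b::{metric_space, second_countable_topology}"
  assumes "finite I" and ind: "\<And>k. indep_vars (\<lambda>_. borel) (Y k) I"
    and X: "\<And>i. i \<in> I \<Longrightarrow> X i \<in> borel_measurable M"
    and lim: "\<And>i. i \<in> I \<Longrightarrow> AE \<omega> in M. (\<lambda>k. Y k i \<omega>) \<longlonglongrightarrow> X i \<omega>"
  shows "indep_vars (\<lambda>_. borel) X I"
proof (cases "I = {}")
  case True
  then show ?thesis by (simp add: indep_vars_def indep_sets_def)
next
  case False
  have Y: "i \<in> I \<Longrightarrow> Y k i \<in> borel_measurable M" for i k using ind[of k] by (auto simp: indep_vars_def)
  have cont: "(LINT \<omega>|M. (\<Prod>i\<in>I. f i (X i \<omega>))) = (\<Prod>i\<in>I. LINT \<omega>|M. f i (X i \<omega>))"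
    if f: "\<And>i. continuous_on UNIV (f i)" "\<And>i x. f i x \<in> {0..1::real}" for f :: "'i \<Rightarrow> 'b \<Rightarrow> real"
  proof -
    have fm[measurable]: "f i \<in> borel_measurable borel" for i by (intro borel_measurable_continuous_onI f)
    have fX: "(\<lambda>\<omega>. f i (X i \<omega>)) \<in> borel_measurable M" if "i \<in> I" for i by (rule measurable_compose[OF X[OF that] fm])
    have fY: "(\<lambda>\<omega>. f i (Y k i \<omega>)) \<in> borel_measurable M" if "i \<in> I" for i k by (rule measurable_compose[OF Y[OF that] fm])
    have flim: "AE \<omega> in M. (\<lambda>k. f i (Y k i \<omega>)) \<longlonglongrightarrow> f i (X i \<omega>)" if "i \<in> I" for i
      using lim[OF that] by eventually_elim (rule continuous_on_tendsto_compose[OF f(1)], auto)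
    have b: "norm (f i x) \<le> 1" for i x using f(2)[of i x] by simp
    have "(\<lambda>k. LINT \<omega>|M. f i (Y k i \<omega>)) \<longlonglongrightarrow> (LINT \<omega>|M. f i (X i \<omega>))" if "i \<in> I" for i
      by (rule integral_dominated_convergence[where w="\<lambda>_. 1"]) (use that fX fY flim b in auto)
    then have 1: "(\<lambda>k. \<Prod>i\<in>I. LINT \<omega>|M. f i (Y k i \<omega>)) \<longlonglongrightarrow> (\<Prod>i\<in>I. LINT \<omega>|M. f i (X i \<omega>))"
      by (rule tendsto_prod)
    have 2: "(\<lambda>k. LINT \<omega>|M. (\<Prod>i\<in>I. f i (Y k i \<omega>))) \<longlonglongrightarrow> (LINT \<omega>|M. (\<Prod>i\<in>I. f i (X i \<omega>)))"
    proof (rule integral_dominated_convergence[where w="\<lambda>_. 1"])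
      have "AE \<omega> in M. \<forall>i\<in>I. (\<lambda>k. f i (Y k i \<omega>)) \<longlonglongrightarrow> f i (X i \<omega>)"
        using \<open>finite I\<close> flim by (simp add: AE_ball_countable[OF countable_finite])
      then show "AE \<omega> in M. (\<lambda>k. \<Prod>i\<in>I. f i (Y k i \<omega>)) \<longlonglongrightarrow> (\<Prod>i\<in>I. f i (X i \<omega>))"
        by eventually_elim (intro tendsto_prod, auto)
      show "AE \<omega> in M. norm (\<Prod>i\<in>I. f i (Y k i \<omega>)) \<le> 1" for k
        using f(2) by (intro AE_I2) (auto simp: abs_prod intro!: prod_le_1)
    qed (use fX fY in \<open>auto intro!: borel_measurable_prod\<close>)
    have "(LINT \<omega>|M. (\<Prod>i\<in>I. f i (Y k i \<omega>))) = (\<Prod>i\<in>I. LINT \<omega>|M. f i (Y k i \<omega>))" for k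
    proof (rule indep_vars_lebesgue_integral[OF \<open>finite I\<close>])
      show "indep_vars (\<lambda>_. borel) (\<lambda>i \<omega>. f i (Y k i \<omega>)) I"
        by (rule indep_vars_compose2[OF ind]) simp
      show "integrable M (\<lambda>\<omega>. f i (Y k i \<omega>))" if "i \<in> I" for i
        by (rule integrable_const_bound[of _ 1]) (use fY[OF that] b in auto)
    qed
    with 1 2 show ?thesis using LIMSEQ_unique by simp
  qed
  show ?thesis
  proof (rule iffD2[OF indep_vars_finite[OF False \<open>finite I\<close>, where E="\<lambda>_. Collect closed"]])
    show "\<forall>A\<in>(\<Pi> i\<in>I. Collect closed). prob (\<Inter>j\<in>I. X j -` A j \<inter> space M) = (\<Prod>j\<in>I. prob (X j -` A j \<inter> space M))"
    proof
      fix A :: "'i \<Rightarrow> 'b set" assume "A \<in> (\<Pi> i\<in>I. Collect closed)"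
      then have A: "closed (A i)" if "i \<in> I" for i using that by auto
      show "prob (\<Inter>j\<in>I. X j -` A j \<inter> space M) = (\<Prod>j\<in>I. prob (X j -` A j \<inter> space M))"
      proof (cases "\<exists>i\<in>I. A i = {}")
        case True
        then obtain i where i: "i \<in> I" "A i = {}" by auto
        then have "(\<Inter>j\<in>I. X j -` A j \<inter> space M) = {}" by auto
        moreover have "(\<Prod>j\<in>I. prob (X j -` A j \<inter> space M)) = 0" using i \<open>finite I\<close> by (intro prod_zero bexI[of _ i]) auto
        ultimately show ?thesis by simp
      next
        case ne: False
        define f where "f m i x = max 0 (1 - real m * infdist x (A i))" for m i x
        have f: "continuous_on UNIV (f m i)" "f m i x \<in> {0..1}" for m i x
          unfolding f_def by (intro continuous_intros) (auto simp: infdist_nonneg)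
        have f_lim: "(\<lambda>m. f m i x) \<longlonglongrightarrow> indicator (A i) x" if "i \<in> I" for i x
          unfolding f_def using closed_indicator_limit[OF A[OF that]] ne that by auto
        have fX: "(\<lambda>\<omega>. f m i (X i \<omega>)) \<in> borel_measurable M" if "i \<in> I" for m i
          by (rule measurable_compose[OF X[OF that] borel_measurable_continuous_onI[OF f(1)]])
        have Ai: "A i \<in> sets borel" if "i \<in> I" for i using A[OF that] by simp
        have XA: "X i -` A i \<inter> space M \<in> events" if "i \<in> I" for i using X[OF that] Ai[OF that] by (rule measurable_sets)
        have iX: "(\<lambda>\<omega>. indicat_real (A i) (X i \<omega>) :: real) \<in> borel_measurable M" if "i \<in> I" for i
          using measurable_compose[OF X[OF that] borel_measurable_indicator[OF Ai[OF that]]] .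
        have 1: "(\<lambda>m. LINT \<omega>|M. (\<Prod>i\<in>I. f m i (X i \<omega>))) \<longlonglongrightarrow> (LINT \<omega>|M. (\<Prod>i\<in>I. indicat_real (A i) (X i \<omega>)))"
        proof (rule integral_dominated_convergence[where w="\<lambda>_. 1"])
          show "AE \<omega> in M. (\<lambda>m. \<Prod>i\<in>I. f m i (X i \<omega>)) \<longlonglongrightarrow> (\<Prod>i\<in>I. indicat_real (A i) (X i \<omega>))"
            by (intro AE_I2 tendsto_prod f_lim)
          show "AE \<omega> in M. norm (\<Prod>i\<in>I. f m i (X i \<omega>)) \<le> 1" for m
            using f(2) by (intro AE_I2) (auto simp: abs_prod intro!: prod_le_1)
        qed (use fX iX in \<open>auto intro!: borel_measurable_prod\<close>)
        have 2: "(\<lambda>m. LINT \<omega>|M. f m i (X i \<omega>)) \<longlonglongrightarrow> (LINT \<omega>|M. indicat_real (A i) (X i \<omega>))" if "i \<in> I" for i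
        proof (rule integral_dominated_convergence[where w="\<lambda>_. 1"])
          show "AE \<omega> in M. norm (f m i (X i \<omega>)) \<le> 1" for m using f(2) by (intro AE_I2) auto
        qed (use fX[OF that] iX[OF that] f_lim[OF that] in auto)
        have "(LINT \<omega>|M. (\<Prod>i\<in>I. indicat_real (A i) (X i \<omega>))) = (\<Prod>i\<in>I. LINT \<omega>|M. indicat_real (A i) (X i \<omega>))"
        proof (rule LIMSEQ_unique[OF 1])
          show "(\<lambda>m. LINT \<omega>|M. (\<Prod>i\<in>I. f m i (X i \<omega>))) \<longlonglongrightarrow> (\<Prod>i\<in>I. LINT \<omega>|M. indicat_real (A i) (X i \<omega>))"
            unfolding cont[OF f] by (intro tendsto_prod 2)
        qed
        moreover have "(LINT \<omega>|M. indicat_real (A i) (X i \<omega>)) = prob (X i -` A i \<inter> space M)" if "i \<in> I" for i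
        proof -
          have "(LINT \<omega>|M. indicat_real (A i) (X i \<omega>)) = (LINT \<omega>|M. indicat_real (X i -` A i \<inter> space M) \<omega>)"
            by (intro Bochner_Integration.integral_cong) (auto simp: indicator_def)
          then show ?thesis using XA[OF that] by (simp add: Int_absorb2 sets.sets_into_space)
        qed
        moreover have "(LINT \<omega>|M. (\<Prod>i\<in>I. indicat_real (A i) (X i \<omega>))) = prob (\<Inter>j\<in>I. X j -` A j \<inter> space M)"
        proof -
          have ev: "(\<Inter>j\<in>I. X j -` A j \<inter> space M) \<in> events"
            using \<open>finite I\<close> False XA by (intro sets.finite_INT) auto
          have "(LINT \<omega>|M. (\<Prod>i\<in>I. indicat_real (A i) (X i \<omega>) :: real)) = (LINT \<omega>|M. indicator (\<Inter>j\<in>I. X j -` A j \<inter> space M) \<omega>)"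
          proof (intro Bochner_Integration.integral_cong refl)
            fix \<omega> assume "\<omega> \<in> space M"
            then show "(\<Prod>i\<in>I. indicat_real (A i) (X i \<omega>) :: real) = indicator (\<Inter>j\<in>I. X j -` A j \<inter> space M) \<omega>"
              using \<open>finite I\<close> by (auto simp: indicator_def prod_zero_iff split: if_splits)
          qed
          also have "\<dots> = prob (\<Inter>j\<in>I. X j -` A j \<inter> space M)"
            using ev by (simp add: Int_absorb2 sets.sets_into_space)
          finally show ?thesis .
        qed
        ultimately show ?thesis by simp
      qed
    qed
  qed (use X in \<open>auto simp: Int_stable_def borel_eq_closed\<close>)
qed

text \<open>Only the values of Z at dyadic times are constrained. The single exponent \<psi> ties
  the increments of all grids together.\<close>

locale dyadic_process = prob_space M for M :: "'w measure" +
  fixes Z :: "real \<Rightarrow> 'w \<Rightarrow> real ^ 'n" and \<psi> :: "real ^ 'n \<Rightarrow> complex"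
  assumes Z_measurable: "\<And>N k. Z (dyadic N k) \<in> borel_measurable M"
    and Z_0: "\<And>\<omega>. Z 0 \<omega> = 0"
    and indep_increments: "\<And>N n. indep_vars (\<lambda>_. borel) (\<lambda>i \<omega>. Z (dyadic N (Suc i)) \<omega> - Z (dyadic N i) \<omega>) {..<n}"
    and char_fun_increment: "\<And>N i z. char_fun (distr M borel (\<lambda>\<omega>. Z (dyadic N (Suc i)) \<omega> - Z (dyadic N i) \<omega>)) z = exp (\<psi> z / 2 ^ N)"
begin

lemma Z_diff: "i \<le> j \<Longrightarrow> (\<Sum>l=i..<j. Z (dyadic N (Suc l)) \<omega> - Z (dyadic N l) \<omega>) = Z (dyadic N j) \<omega> - Z (dyadic N i) \<omega>"
  by (rule sum_Suc_diff')

lemma char_fun_Z_diff: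
  assumes "i \<le> j"
  shows "char_fun (distr M borel (\<lambda>\<omega>. Z (dyadic N j) \<omega> - Z (dyadic N i) \<omega>)) z =
    exp (of_real (dyadic N j - dyadic N i) * \<psi> z)"
proof -
  have "char_fun (distr M borel (\<lambda>\<omega>. \<Sum>l=i..<j. Z (dyadic N (Suc l)) \<omega> - Z (dyadic N l) \<omega>)) z = (\<Prod>l=i..<j. exp (\<psi> z / 2 ^ N))"
    by (subst char_fun_indep_sum[OF indep_vars_subset[OF indep_increments[where n=j and N=N]]]) (auto simp: char_fun_increment)
  also have "\<dots> = exp (of_nat (j - i) * (\<psi> z / 2 ^ N))" by (simp only: prod_constant card_atLeastLessThan exp_of_nat_mult)
  also have "of_nat (j - i) * (\<psi> z / 2 ^ N) = of_real (dyadic N j - dyadic N i) * \<psi> z"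
    using assms by (simp add: dyadic_def of_nat_diff field_simps)
  finally show ?thesis using assms by (simp add: Z_diff)
qed

text \<open>These increments are sums of elementary increments over disjoint blocks of
  indices.\<close>

lemma indep_Z_diff:
  assumes m: "\<And>i. i < n \<Longrightarrow> m i \<le> m (Suc i)"
  shows "indep_vars (\<lambda>_. borel) (\<lambda>i \<omega>. Z (dyadic N (m (Suc i))) \<omega> - Z (dyadic N (m i)) \<omega>) {..<n}"
proof -
  have mono: "m i \<le> m j" if "i \<le> j" "j \<le> n" for i j
    using that
  proof (induction rule: dec_induct)
    case (step k)
    then show ?case using m[of k] by simp
  qed simp
  let ?K = "\<lambda>j. {m j..<m (Suc j)}"
  have dj: "disjoint_family_on ?K {..<n}"
    unfolding disjoint_family_on_def
  proof (intro ballI impI)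
    fix i j assume ij: "i \<in> {..<n}" "j \<in> {..<n}" "i \<noteq> j"
    then consider "Suc i \<le> j" | "Suc j \<le> i" by linarith
    then show "?K i \<inter> ?K j = {}"
    proof cases
      case 1 then show ?thesis using mono[of "Suc i" j] ij by auto
    next
      case 2 then show ?thesis using mono[of "Suc j" i] ij by auto
    qed
  qed
  have sub: "?K j \<subseteq> {..<m n}" if "j \<in> {..<n}" for j using mono[of "Suc j" n] that by auto
  have "indep_vars (\<lambda>j. PiM (?K j) (\<lambda>_. borel)) (\<lambda>j \<omega>. restrict (\<lambda>i. Z (dyadic N (Suc i)) \<omega> - Z (dyadic N i) \<omega>) (?K j)) {..<n}"
    by (rule indep_vars_restrict[OF indep_increments sub dj])
  then have "indep_vars (\<lambda>_. borel) (\<lambda>j \<omega>. (\<lambda>x. \<Sum>i\<in>?K j. x i) (restrict (\<lambda>i. Z (dyadic N (Suc i)) \<omega> - Z (dyadic N i) \<omega>) (?K j))) {..<n}"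
    by (rule indep_vars_compose2) (rule measurable_sum_component, simp)
  then show ?thesis
    by (rule iffD1[OF indep_vars_cong, rotated 3]) (use m in \<open>auto simp: Z_diff fun_eq_iff\<close>)
qed

text \<open>Uniform over all positions and all grids. Otherwise there are bad increments over
  lengths h of at most \<open>(1 / 2) ^ m\<close> for every m; their characteristic functions
  \<open>exp (h \<psi>(z))\<close> tend to 1, so they tend to 0 in probability.\<close>

lemma Z_small_increments:
  assumes "0 < \<epsilon>"
  shows "\<exists>m. \<forall>N\<ge>m. \<forall>i j. i \<le> j \<longrightarrow> j \<le> i + 2 ^ (N - m) \<longrightarrow>
    prob {\<omega> \<in> space M. norm (Z (dyadic N j) \<omega> - Z (dyadic N i) \<omega>) > \<epsilon>} \<le> 1 / 4"
proof (rule ccontr)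
  assume "\<not> ?thesis"
  then have "\<exists>N\<ge>m. \<exists>i j. i \<le> j \<and> j \<le> i + 2 ^ (N - m) \<and>
    \<not> prob {\<omega> \<in> space M. norm (Z (dyadic N j) \<omega> - Z (dyadic N i) \<omega>) > \<epsilon>} \<le> 1 / 4" for m by simp
  then have "\<forall>m. \<exists>N i j. m \<le> N \<and> i \<le> j \<and> j \<le> i + 2 ^ (N - m) \<and>
    prob {\<omega> \<in> space M. norm (Z (dyadic N j) \<omega> - Z (dyadic N i) \<omega>) > \<epsilon>} > 1 / 4" unfolding not_le by blast
  from choice[OF this] obtain N where "\<forall>m. \<exists>i j. m \<le> N m \<and> i \<le> j \<and> j \<le> i + 2 ^ (N m - m) \<and>
    prob {\<omega> \<in> space M. norm (Z (dyadic (N m) j) \<omega> - Z (dyadic (N m) i) \<omega>) > \<epsilon>} > 1 / 4" ..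
  from choice[OF this] obtain i where "\<forall>m. \<exists>j. m \<le> N m \<and> i m \<le> j \<and> j \<le> i m + 2 ^ (N m - m) \<and>
    prob {\<omega> \<in> space M. norm (Z (dyadic (N m) j) \<omega> - Z (dyadic (N m) (i m)) \<omega>) > \<epsilon>} > 1 / 4" ..
  from choice[OF this] obtain j where "\<forall>m. m \<le> N m \<and> i m \<le> j m \<and> j m \<le> i m + 2 ^ (N m - m) \<and>
    prob {\<omega> \<in> space M. norm (Z (dyadic (N m) (j m)) \<omega> - Z (dyadic (N m) (i m)) \<omega>) > \<epsilon>} > 1 / 4" ..
  then have Nij: "m \<le> N m" "i m \<le> j m" "j m \<le> i m + 2 ^ (N m - m)"
    "prob {\<omega> \<in> space M. norm (Z (dyadic (N m) (j m)) \<omega> - Z (dyadic (N m) (i m)) \<omega>) > \<epsilon>} > 1 / 4" for m by simp_all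
  define W where "W m \<omega> = Z (dyadic (N m) (j m)) \<omega> - Z (dyadic (N m) (i m)) \<omega>" for m \<omega>
  have W[measurable]: "W m \<in> borel_measurable M" for m unfolding W_def[abs_def] by (intro borel_measurable_diff Z_measurable)
  define h where "h m = dyadic (N m) (j m) - dyadic (N m) (i m)" for m
  have h: "0 \<le> h m" "h m \<le> (1 / 2) ^ m" for m
  proof -
    have "real (j m) \<le> real (i m + 2 ^ (N m - m))" using Nij(3)[of m] by (subst of_nat_le_iff)
    then have "h m \<le> 2 ^ (N m - m) / 2 ^ N m" 
      unfolding h_def dyadic_def diff_divide_distrib[symmetric] by (intro divide_right_mono) auto
    also have "\<dots> = (1 / 2) ^ m" using Nij(1)[of m] by (simp add: power_diff power_one_over)
    finally show "h m \<le> (1 / 2) ^ m" .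
  qed (use Nij(2)[of m] in \<open>simp add: h_def\<close>)
  have h0: "h \<longlonglongrightarrow> 0"
    by (rule tendsto_sandwich[of "\<lambda>_. 0" _ _ "\<lambda>m. (1 / 2) ^ m"]) (use h in \<open>auto intro!: LIMSEQ_power_zero\<close>)
  have "(\<lambda>m. char_fun (distr M borel (W m)) z) \<longlonglongrightarrow> 1" for z
  proof -
    have "(\<lambda>m. exp (of_real (h m) * \<psi> z)) \<longlonglongrightarrow> exp (of_real 0 * \<psi> z)" by (intro tendsto_intros h0)
    then show ?thesis using Nij(2) by (simp add: W_def[abs_def] char_fun_Z_diff h_def)
  qed
  then have "(\<lambda>m. prob {\<omega> \<in> space M. norm (W m \<omega>) > \<epsilon>}) \<longlonglongrightarrow> 0"
    by (intro tendsto_prob_0_of_char_fun assms W)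
  then have "\<forall>\<^sub>F m in sequentially. prob {\<omega> \<in> space M. norm (W m \<omega>) > \<epsilon>} < 1 / 4" by (rule order_tendstoD) simp
  then obtain m where "prob {\<omega> \<in> space M. norm (W m \<omega>) > \<epsilon>} < 1 / 4" by (auto simp: eventually_sequentially)
  then show False using Nij(4)[of m] by (simp add: W_def)
qed

text \<open>On an interval of mesh \<open>1 / 2 ^ m\<close> every increment exceeds
  \<open>r / 2\<close> with probability at most 1/4. Ottaviani's inequality then bounds a passage
  beyond r by (1/4) / (1 - 1/4) = 1/3, and p oscillations by \<open>(1 / 3) ^ p\<close>, whatever
  the grid.\<close>

lemma AE_not_time_oscillates:
  assumes "0 < r"
  shows "\<exists>m. \<forall>j. AE \<omega> in M. \<exists>p. \<not> time_oscillates r (\<lambda>t. Z t \<omega>) (dyadic m (Suc j)) p (dyadic m j)"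
proof -
  obtain m where m: "\<And>N i j. m \<le> N \<Longrightarrow> i \<le> j \<Longrightarrow> j \<le> i + 2 ^ (N - m) \<Longrightarrow>
    prob {\<omega> \<in> space M. norm (Z (dyadic N j) \<omega> - Z (dyadic N i) \<omega>) > r / 2} \<le> 1 / 4"
    using Z_small_increments[of "r / 2"] assms by auto
  have "AE \<omega> in M. \<exists>p. \<not> time_oscillates r (\<lambda>t. Z t \<omega>) (dyadic m (Suc j)) p (dyadic m j)" for j
  proof -
    define off where "off N = j * 2 ^ (N - m)" for N
    define x where "x N i \<omega> = Z (dyadic N (Suc (off N + i))) \<omega> - Z (dyadic N (off N + i)) \<omega>" for N i \<omega>
    have x_meas: "x N i \<in> borel_measurable M" for N i unfolding x_def[abs_def] by (intro borel_measurable_diff Z_measurable)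
    have x_sum: "(\<Sum>i=k..<l. x N i \<omega>) = Z (dyadic N (off N + l)) \<omega> - Z (dyadic N (off N + k)) \<omega>" if "k \<le> l" for k l N \<omega>
      using sum_Suc_diff'[OF that, of "\<lambda>i. Z (dyadic N (off N + i)) \<omega>"] by (simp add: x_def)
    have ind: "indep_vars (\<lambda>_. borel) (x N) {..<n}" for N n
      using indep_Z_diff[of n "\<lambda>i. off N + i" N] by (simp add: x_def[abs_def])
    define E where "E p N = {\<omega> \<in> space M. oscillates r (2 ^ (N - m)) p (\<lambda>i. x N i \<omega>) 0}" for p N
    have E_ev: "E p N \<in> events" for p N unfolding E_def
      by (rule sets_pred_restrict[where A="{0..<2 ^ (N - m)}" and N=borel and X="x N" and P="\<lambda>y. oscillates r (2 ^ (N - m)) p y 0"])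
         (use x_meas in \<open>auto intro!: measurable_oscillates simp: oscillates_restrict simp del: restrict_apply\<close>)
    have E_prob: "prob (E p N) \<le> (1 / 3) ^ p" if "m \<le> N" for p N
      unfolding E_def
    proof (rule prob_oscillates_le[OF ind])
      fix k :: nat assume k: "k \<le> 2 ^ (N - m)"
      have tail: "prob {\<omega> \<in> space M. norm (\<Sum>i=l..<2 ^ (N - m). x N i \<omega>) > r / 2} \<le> 1 / 4" if "l \<le> 2 ^ (N - m)" for l
        using m[OF \<open>m \<le> N\<close>, of "off N + l" "off N + 2 ^ (N - m)"] that by (simp add: x_sum)
      have "(1 - 1 / 4) * prob {\<omega> \<in> space M. \<exists>l\<in>{k..2 ^ (N - m)}. norm (\<Sum>i=k..<l. x N i \<omega>) > r / 2 + r / 2}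
        \<le> prob {\<omega> \<in> space M. norm (\<Sum>i=k..<2 ^ (N - m). x N i \<omega>) > r / 2}"
        by (rule ottaviani[OF ind k]) (rule tail)
      also have "\<dots> \<le> 1 / 4" by (rule tail[OF k])
      finally show "prob {\<omega> \<in> space M. \<exists>l\<in>{k..2 ^ (N - m)}. norm (\<Sum>i=k..<l. x N i \<omega>) > r} \<le> 1 / 3" by simp
    qed (use assms in auto)
    \<comment> \<open>The limit inferior of the grid events. It contains every outcome with p
      oscillations in dyadic time, and continuity from below passes the uniform bound on to
      it.\<close>
    define T where "T p = (\<Union>N0. \<Inter>N\<in>{max m N0..}. E p N)" for p
    have T_ev: "T p \<in> events" for p unfolding T_def using E_ev by (intro sets.countable_UN sets.countable_INT') auto
    have T_prob: "prob (T p) \<le> (1 / 3) ^ p" for p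
    proof -
      have ev: "(\<Inter>N\<in>{max m N0..}. E p N) \<in> events" for N0 using E_ev by (intro sets.countable_INT') auto
      have "(\<lambda>N0. prob (\<Inter>N\<in>{max m N0..}. E p N)) \<longlonglongrightarrow> prob (T p)"
        unfolding T_def using ev by (intro finite_Lim_measure_incseq) (auto simp: incseq_def)
      moreover have "prob (\<Inter>N\<in>{max m N0..}. E p N) \<le> (1 / 3) ^ p" for N0
        by (rule order_trans[OF finite_measure_mono E_prob[of "max m N0"]]) (auto intro: E_ev)
      ultimately show ?thesis by (intro LIMSEQ_le_const2) auto
    qed
    have "(\<Inter>p. T p) \<in> events" using T_ev by (intro sets.countable_INT') auto
    have "prob (\<Inter>p. T p) \<le> (1 / 3) ^ p" for p
      by (rule order_trans[OF finite_measure_mono T_prob[of p]]) (auto intro: T_ev)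
    moreover have "(\<lambda>p. (1 / 3 :: real) ^ p) \<longlonglongrightarrow> 0" by (intro LIMSEQ_power_zero) simp
    ultimately have "prob (\<Inter>p. T p) \<le> 0" by (intro LIMSEQ_le_const) auto
    then have "prob (\<Inter>p. T p) = 0" by (rule antisym) (rule measure_nonneg)
    then have "(\<Inter>p. T p) \<in> null_sets M"
      using \<open>(\<Inter>p. T p) \<in> events\<close> by (simp add: null_sets_def emeasure_eq_measure)
    then have "AE \<omega> in M. \<omega> \<notin> (\<Inter>p. T p)" by (rule AE_not_in)
    then show ?thesis
      using AE_space
    proof eventually_elim
      case (elim \<omega>)
      then obtain p where p: "\<omega> \<notin> T p" by auto
      have "\<not> time_oscillates r (\<lambda>t. Z t \<omega>) (dyadic m (Suc j)) p (dyadic m j)"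
      proof
        assume "time_oscillates r (\<lambda>t. Z t \<omega>) (dyadic m (Suc j)) p (dyadic m j)"
        from time_oscillates_imp_oscillates[OF this]
        obtain N0 where N0: "m \<le> N0" "\<And>N k. N0 \<le> N \<Longrightarrow> dyadic N (off N + k) = dyadic m j \<Longrightarrow>
          oscillates r (2 ^ (N - m)) p (\<lambda>i. x N i \<omega>) k" by (auto simp: x_def off_def)
        have "\<omega> \<in> E p N" if "max m N0 \<le> N" for N
          using N0(2)[of N 0] that elim dyadic_raise[of m j "N - m"] by (simp add: E_def off_def)
        then have "\<omega> \<in> (\<Inter>N\<in>{max m N0..}. E p N)" by blast
        then show False using p unfolding T_def by blast
      qed
      then show ?case ..
    qed
  qed
  then show ?thesis by blast
qed

end

lemma time_oscillates_antimono:
  "time_oscillates r z e p s \<Longrightarrow> r' \<le> r \<Longrightarrow> time_oscillates r' z e p s"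
proof (induction p arbitrary: s)
  case (Suc p)
  then obtain q q' where q: "q \<in> dyadics" "q' \<in> dyadics" "s \<le> q" "q \<le> q'" "q' \<le> e"
    "norm (z q' - z q) > 2 * r" "time_oscillates r z e p q'" by auto
  show ?case unfolding time_oscillates.simps
    by (intro bexI[OF _ q(1)] bexI[OF _ q(2)]) (use q Suc in auto)
qed simp

section \<open>The process of right limits\<close>

context dyadic_process begin

text \<open>The thresholds \<open>1 / (k + 1)\<close> suffice by monotonicity in r, which leaves
  countably many almost sure statements.\<close>

lemma AE_regular: "AE \<omega> in M. regular (\<lambda>t. Z t \<omega>)"
proof -
  have "\<forall>k. \<exists>m. \<forall>j. AE \<omega> in M. \<exists>p. \<not> time_oscillates (1 / real (Suc k)) (\<lambda>t. Z t \<omega>) (dyadic m (Suc j)) p (dyadic m j)"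
    by (intro allI AE_not_time_oscillates) simp
  then obtain m where "\<And>k j. AE \<omega> in M. \<exists>p. \<not> time_oscillates (1 / real (Suc k)) (\<lambda>t. Z t \<omega>) (dyadic (m k) (Suc j)) p (dyadic (m k) j)"
    by metis
  then have "AE \<omega> in M. \<forall>k j. \<exists>p. \<not> time_oscillates (1 / real (Suc k)) (\<lambda>t. Z t \<omega>) (dyadic (m k) (Suc j)) p (dyadic (m k) j)"
    by (simp add: AE_all_countable)
  then show ?thesis
  proof eventually_elim
    case (elim \<omega>)
    show ?case unfolding regular_def
    proof (intro allI impI)
      fix r :: real assume "0 < r"
      then obtain k where k: "1 / real (Suc k) \<le> r" using nat_approx_posE less_imp_le by metis
      show "\<exists>m. \<forall>j. \<exists>p. \<not> time_oscillates r (\<lambda>t. Z t \<omega>) (dyadic m (Suc j)) p (dyadic m j)"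
        using elim time_oscillates_antimono[OF _ k] by blast
    qed
  qed
qed

definition X :: "real \<Rightarrow> 'w \<Rightarrow> real ^ 'n" where
  "X t \<omega> = regularize (\<lambda>t. Z t \<omega>) t"

lemma X_measurable [measurable]: "X t \<in> borel_measurable M"
  unfolding X_def[abs_def] regularize_def by (intro borel_measurable_lim_metric Z_measurable)

text \<open>One null set serves all t, because regularity of a path yields all its right limits at
  once.\<close>

lemma AE_X_lim: "AE \<omega> in M. \<forall>t\<ge>0. (\<lambda>k. Z (dyadic k (next_dyadic k t)) \<omega>) \<longlonglongrightarrow> X t \<omega>"
  using AE_regular by eventually_elim (auto simp: X_def intro: regularize_tendsto)

lemma char_fun_X_diff:
  assumes "0 \<le> s" "s \<le> t"
  shows "char_fun (distr M borel (\<lambda>\<omega>. X t \<omega> - X s \<omega>)) z = exp (of_real (t - s) * \<psi> z)"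
proof -
  let ?W = "\<lambda>k \<omega>. Z (dyadic k (next_dyadic k t)) \<omega> - Z (dyadic k (next_dyadic k s)) \<omega>"
  have "(\<lambda>k. char_fun (distr M borel (?W k)) z) \<longlonglongrightarrow> char_fun (distr M borel (\<lambda>\<omega>. X t \<omega> - X s \<omega>)) z"
  proof (rule tendsto_char_fun_AE)
    show "AE \<omega> in M. (\<lambda>k. ?W k \<omega>) \<longlonglongrightarrow> X t \<omega> - X s \<omega>"
      using AE_X_lim by eventually_elim (use assms in \<open>auto intro!: tendsto_diff\<close>)
  qed (auto intro!: borel_measurable_diff Z_measurable)
  moreover have "char_fun (distr M borel (?W k)) z = exp (of_real (dyadic k (next_dyadic k t) - dyadic k (next_dyadic k s)) * \<psi> z)" for k
    by (rule char_fun_Z_diff) (rule next_dyadic_mono[OF assms(2)])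
  moreover have "(\<lambda>k. exp (of_real (dyadic k (next_dyadic k t) - dyadic k (next_dyadic k s)) * \<psi> z)) \<longlonglongrightarrow> exp (of_real (t - s) * \<psi> z)"
    using assms by (intro tendsto_intros next_dyadic_tendsto) auto
  ultimately show ?thesis using LIMSEQ_unique by simp
qed

lemma char_fun_X:
  assumes "0 \<le> t"
  shows "char_fun (distr M borel (X t)) z = exp (of_real t * \<psi> z)"
proof -
  let ?W = "\<lambda>k \<omega>. Z (dyadic k (next_dyadic k t)) \<omega>"
  have 0: "dyadic k 0 = 0" for k by (simp add: dyadic_def)
  have "(\<lambda>k. char_fun (distr M borel (?W k)) z) \<longlonglongrightarrow> char_fun (distr M borel (X t)) z"
  proof (rule tendsto_char_fun_AE)
    show "AE \<omega> in M. (\<lambda>k. ?W k \<omega>) \<longlonglongrightarrow> X t \<omega>"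
      using AE_X_lim by eventually_elim (use assms in auto)
  qed (auto intro!: Z_measurable)
  moreover have "char_fun (distr M borel (?W k)) z = exp (of_real (dyadic k (next_dyadic k t)) * \<psi> z)" for k
    using char_fun_Z_diff[of 0 "next_dyadic k t" k z] by (simp add: 0 Z_0)
  moreover have "(\<lambda>k. exp (of_real (dyadic k (next_dyadic k t)) * \<psi> z)) \<longlonglongrightarrow> exp (of_real t * \<psi> z)"
    using assms by (intro tendsto_intros next_dyadic_tendsto)
  ultimately show ?thesis using LIMSEQ_unique by simp
qed

lemma X_continuous_in_prob:
  assumes "0 \<le> t" "0 < \<epsilon>"
  shows "((\<lambda>s. prob {\<omega> \<in> space M. norm (X s \<omega> - X t \<omega>) > \<epsilon>}) \<longlongrightarrow> 0) (at t within {0..})"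
  unfolding tendsto_at_iff_sequentially comp_def
proof (intro allI impI)
  fix s :: "nat \<Rightarrow> real" assume "\<forall>i. s i \<in> {0..} - {t}" and s: "s \<longlonglongrightarrow> t"
  then have s0: "0 \<le> s i" for i by auto
  \<comment> \<open>Ordering the two times gives a forward increment, whose characteristic function
    is known; the norm does not see the sign.\<close>
  define W where "W i \<omega> = X (max (s i) t) \<omega> - X (min (s i) t) \<omega>" for i \<omega>
  have [measurable]: "W i \<in> borel_measurable M" for i unfolding W_def[abs_def] by measurable
  have "(\<lambda>i. char_fun (distr M borel (W i)) z) \<longlonglongrightarrow> 1" for z
  proof -
    have "(\<lambda>i. exp (of_real (max (s i) t - min (s i) t) * \<psi> z)) \<longlonglongrightarrow> exp (of_real (max t t - min t t) * \<psi> z)"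
      by (intro tendsto_intros s)
    then show ?thesis using s0 assms by (simp add: W_def[abs_def] char_fun_X_diff)
  qed
  then have "(\<lambda>i. prob {\<omega> \<in> space M. norm (W i \<omega>) > \<epsilon>}) \<longlonglongrightarrow> 0"
    by (intro tendsto_prob_0_of_char_fun assms) measurable
  moreover have "norm (W i \<omega>) = norm (X (s i) \<omega> - X t \<omega>)" for i \<omega>
    by (auto simp: W_def max_def min_def norm_minus_commute)
  ultimately show "(\<lambda>i. prob {\<omega> \<in> space M. norm (X (s i) \<omega> - X t \<omega>) > \<epsilon>}) \<longlonglongrightarrow> 0" by simp
qed

lemma levy_process_X: "levy_process M X"
  unfolding levy_process_def
proof (intro conjI allI impI)
  show "prob_space M" by (rule prob_space_axioms)
  show "AE \<omega> in M. X 0 \<omega> = 0"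
  proof -
    \<comment> \<open>\<open>X 0\<close> is a right limit of Z at 0, so the vanishing of Z at 0 does
      not settle it; its characteristic function does.\<close>
    have eq: "distr M borel (X 0) = return borel 0"
    proof (rule char_fun_unique)
      show "char_fun (distr M borel (X 0)) z = char_fun (return borel 0) z" for z
        using char_fun_X[of 0 z] by (simp add: char_fun_def integral_return)
      show "distr M borel (X 0) \<in> distributions" by (rule distr_in_distributions) simp
    qed (simp add: distributions_def prob_space_return)
    have "AE x in distr M borel (X 0). x = 0" unfolding eq by (subst AE_return) auto
    then show ?thesis by (subst (asm) AE_distr_iff) auto
  qed
  show "indep_vars (\<lambda>_. borel) (\<lambda>i \<omega>. X (t (Suc i)) \<omega> - X (t i) \<omega>) {..<n}"
    if t: "0 \<le> t 0 \<and> (\<forall>i<n. t i \<le> t (Suc i))" for n and t :: "nat \<Rightarrow> real"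
  proof -
    have t0: "0 \<le> t i" if "i \<le> n" for i using that by (induction i) (use t in \<open>auto intro: order_trans\<close>)
    show ?thesis
    proof (rule indep_vars_limit)
      show "indep_vars (\<lambda>_. borel) (\<lambda>i \<omega>. Z (dyadic k (next_dyadic k (t (Suc i)))) \<omega> - Z (dyadic k (next_dyadic k (t i))) \<omega>) {..<n}" for k
        by (rule indep_Z_diff[of n "\<lambda>i. next_dyadic k (t i)" k]) (use t in \<open>auto intro: next_dyadic_mono\<close>)
      show "AE \<omega> in M. (\<lambda>k. Z (dyadic k (next_dyadic k (t (Suc i)))) \<omega> - Z (dyadic k (next_dyadic k (t i))) \<omega>) \<longlonglongrightarrow> X (t (Suc i)) \<omega> - X (t i) \<omega>"
        if "i \<in> {..<n}" for i
        using AE_X_lim by eventually_elim (use t0[of i] t0[of "Suc i"] that in \<open>auto intro!: tendsto_diff\<close>)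
    qed auto
  qed
  show "distr M borel (\<lambda>\<omega>. X (s + h) \<omega> - X s \<omega>) = distr M borel (X h)" if "0 \<le> s" "0 \<le> h" for s h
    by (rule char_fun_unique) (use that in \<open>auto intro!: distr_in_distributions simp: char_fun_X char_fun_X_diff\<close>)
  show "AE \<omega> in M. \<forall>t\<ge>0. continuous (at_right t) (\<lambda>s. X s \<omega>) \<and> (t > 0 \<longrightarrow> (\<exists>l. ((\<lambda>s. X s \<omega>) \<longlongrightarrow> l) (at_left t)))"
    using AE_regular
    by eventually_elim (auto simp: X_def intro: regularize_right_continuous regularize_left_limit)
qed (auto intro: X_continuous_in_prob)

end

text \<open>The roots of order \<open>2 ^ N\<close> from one exponent satisfy the squaring
  condition. The exponent is handed out with the process because the integral over an incomplete
  period is estimated through it.\<close>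

theorem levy_process_exists:
  fixes \<mu> :: "(real ^ 'n) measure"
  assumes "\<mu> \<in> inf_divisible"
  obtains M :: "(real \<Rightarrow> real ^ 'n) measure" and X \<psi> where "levy_process M X" "distr M borel (X 1) = \<mu>"
    "continuous_on UNIV \<psi>" "\<psi> 0 = 0"
    "\<And>t z. 0 \<le> t \<Longrightarrow> char_fun (distr M borel (X t)) z = exp (of_real t * \<psi> z)"
proof -
  obtain \<psi> where \<psi>: "exponent_of \<mu> \<psi>" by (rule inf_divisible_exponent[OF assms])
  have "\<forall>N. \<exists>\<nu>. \<nu> \<in> distributions \<and> (\<forall>z. char_fun \<nu> z = exp (\<psi> z / 2 ^ N))"
  proof
    fix N
    have "\<forall>n\<ge>1. \<exists>\<nu>\<in>distributions. \<forall>z. char_fun \<nu> z = exp (\<psi> z / of_nat n)" using \<psi> by (simp add: exponent_of_def)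
    from this[rule_format, of "2 ^ N"]
    have "\<exists>\<nu>\<in>distributions. \<forall>z. char_fun \<nu> z = exp (\<psi> z / of_nat (2 ^ N))" by simp
    then show "\<exists>\<nu>. \<nu> \<in> distributions \<and> (\<forall>z. char_fun \<nu> z = exp (\<psi> z / 2 ^ N))" by auto
  qed
  from choice[OF this] obtain \<nu> where \<nu>: "\<And>N. \<nu> N \<in> distributions" "\<And>N z. char_fun (\<nu> N) z = exp (\<psi> z / 2 ^ N)" by blast
  have "char_fun (\<nu> N) z = char_fun (\<nu> (Suc N)) z ^ 2" for N z
    by (simp add: \<nu>(2) exp_double[symmetric])
  then obtain M :: "(real \<Rightarrow> real ^ 'n) measure" and Z where Z: "prob_space M" "\<And>N k. Z (dyadic N k) \<in> borel_measurable M"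
    "\<And>N n. prob_space.indep_vars M (\<lambda>_. borel) (\<lambda>i \<omega>. Z (dyadic N (Suc i)) \<omega> - Z (dyadic N i) \<omega>) {..<n}"
    "\<And>N i. distr M borel (\<lambda>\<omega>. Z (dyadic N (Suc i)) \<omega> - Z (dyadic N i) \<omega>) = \<nu> N"
    by (rule dyadic_process_exists[of \<nu>, OF \<nu>(1)]) (rule that)
  interpret prob_space M by (rule Z)
  have [measurable]: "Z 0 \<in> borel_measurable M" using Z(2)[of 0 0] by (simp add: dyadic_def)
  \<comment> \<open>The process is determined through its increments only; subtracting its value at
    0 makes it start at 0 without changing them.\<close>
  interpret dyadic_process M "\<lambda>t \<omega>. Z t \<omega> - Z 0 \<omega>" \<psi>
    by unfold_locales (auto simp: Z(3,4) \<nu>(2) intro!: borel_measurable_diff Z(2))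
  have "distr M borel (X 1) = \<mu>"
  proof (rule char_fun_unique)
    show "char_fun (distr M borel (X 1)) z = char_fun \<mu> z" for z
      using \<psi> by (simp add: char_fun_X exponent_of_def)
  qed (use assms in \<open>auto intro!: distr_in_distributions simp: inf_divisible_def\<close>)
  then show thesis
    using that[of M X \<psi>] levy_process_X char_fun_X \<psi> by (simp add: exponent_of_def)
qed

section \<open>The mapping \<open>\<Phi>\<^sub>b\<close> and semi-selfdecomposability\<close>

lemma levy_processD:
  assumes "levy_process M X"
  shows "prob_space M" "\<And>t. 0 \<le> t \<Longrightarrow> X t \<in> borel_measurable M"
    "\<And>s h. 0 \<le> s \<Longrightarrow> 0 \<le> h \<Longrightarrow> distr M borel (\<lambda>\<omega>. X (s + h) \<omega> - X s \<omega>) = distr M borel (X h)"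
    "\<And>n. prob_space.indep_vars M (\<lambda>_. borel) (\<lambda>i \<omega>. X (real i + 1) \<omega> - X (real i) \<omega>) {..<n}"
proof -
  show "prob_space.indep_vars M (\<lambda>_. borel) (\<lambda>i \<omega>. X (real i + 1) \<omega> - X (real i) \<omega>) {..<n}" for n
  proof -
    have "0 \<le> real 0 \<and> (\<forall>i<n. real i \<le> real (Suc i)) \<longrightarrow>
        prob_space.indep_vars M (\<lambda>_. borel) (\<lambda>i \<omega>. X (real (Suc i)) \<omega> - X (real i) \<omega>) {..<n}"
      using assms unfolding levy_process_def by blast
    then show ?thesis by (simp add: add.commute)
  qed
qed (use assms in \<open>simp_all add: levy_process_def\<close>)

lemma step_integral_of_nat:
  "step_integral b X (real n) \<omega> = (\<Sum>j<n. (1 / b) ^ j *\<^sub>R (X (real j + 1) \<omega> - X (real j) \<omega>))"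
  by (simp add: step_integral_def)

lemma char_fun_step_integral:
  fixes X :: "real \<Rightarrow> 'w \<Rightarrow> real ^ 'n"
  assumes X: "levy_process M X" and \<mu>: "distr M borel (X 1) = \<mu>"
  shows "char_fun (distr M borel (step_integral b X (real n))) z = (\<Prod>j<n. char_fun \<mu> ((1 / b) ^ j *\<^sub>R z))"
proof -
  interpret prob_space M by (rule levy_processD[OF X])
  have m: "(\<lambda>\<omega>. X (real j + 1) \<omega> - X (real j) \<omega>) \<in> borel_measurable M" for j
    by (intro borel_measurable_diff levy_processD[OF X]) auto
  have law: "distr M borel (\<lambda>\<omega>. X (real j + 1) \<omega> - X (real j) \<omega>) = \<mu>" for j
    using levy_processD(3)[OF X, of "real j" 1] \<mu> by simp
  have "indep_vars (\<lambda>_. borel) (\<lambda>j \<omega>. (1 / b) ^ j *\<^sub>R (X (real j + 1) \<omega> - X (real j) \<omega>)) {..<n}"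
    by (rule indep_vars_compose2[OF levy_processD(4)[OF X]]) simp
  then show ?thesis
    unfolding step_integral_of_nat[abs_def] by (subst char_fun_indep_sum) (simp_all only: char_fun_scaleR[OF m] law finite_lessThan)
qed

text \<open>Integer times are enough: there the characteristic functions are partial products. The
  equation determines \<nu>, so the law of the integral does not depend on the choice of the
  process.\<close>

lemma Phi_law_imp_semi_decomp:
  fixes \<mu> \<nu> :: "(real ^ 'n) measure"
  assumes "Phi_law b \<mu> \<nu>"
  shows "\<nu> \<in> distributions" "semi_decomp b \<nu> \<mu>"
proof -
  obtain M :: "(real \<Rightarrow> real ^ 'n) measure" and X Y where X: "levy_process M X" "distr M borel (X 1) = \<mu>"
    and Y: "Y \<in> borel_measurable M" "distr M borel Y = \<nu>"
    and lim: "tendsto_in_prob M (step_integral b X) Y at_top"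
    using assms unfolding Phi_law_def by blast
  interpret prob_space M by (rule levy_processD[OF X(1)])
  show "\<nu> \<in> distributions" using distr_in_distributions[OF Y(1)] Y(2) by simp
  have "step_integral b X (real n) \<in> borel_measurable M" for n
    unfolding step_integral_of_nat[abs_def]
    by (intro borel_measurable_sum borel_measurable_scaleR borel_measurable_const borel_measurable_diff levy_processD[OF X(1)]) auto
  moreover have "tendsto_in_prob M (\<lambda>n. step_integral b X (real n)) Y sequentially"
    using lim unfolding tendsto_in_prob_def by (auto intro: filterlim_compose[OF _ filterlim_real_sequentially])
  ultimately have "(\<lambda>n. char_fun (distr M borel (step_integral b X (real n))) z) \<longlonglongrightarrow> char_fun \<nu> z" for z
    unfolding Y(2)[symmetric] by (intro tendsto_char_fun_in_prob Y(1))
  then show "semi_decomp b \<nu> \<mu>"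
    unfolding char_fun_step_integral[OF X] by (rule semi_decomp_if_limit)
qed

text \<open>At integer times the integral is a partial sum of the geometric series and converges
  almost surely. A real time adds \<open>(1 / b) ^ n\<close> times an increment over at most one
  unit of time, and the exponent shows that this tends to 0 in probability.\<close>

lemma Phi_law_exists:
  fixes \<mu> :: "(real ^ 'n) measure"
  assumes \<mu>: "\<mu> \<in> inf_divisible" "log_moment 1 \<mu>" and b: "1 < b"
  shows "\<exists>\<nu>. Phi_law b \<mu> \<nu>"
proof -
  have \<mu>d: "\<mu> \<in> distributions" using \<mu>(1) by (rule inf_divisible_imp_distributions)
  obtain M :: "(real \<Rightarrow> real ^ 'n) measure" and X \<psi> where X: "levy_process M X" "distr M borel (X 1) = \<mu>"
    and \<psi>: "continuous_on UNIV \<psi>" "\<psi> 0 = 0" "\<And>t z. 0 \<le> t \<Longrightarrow> char_fun (distr M borel (X t)) z = exp (of_real t * \<psi> z)"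
    by (rule levy_process_exists[OF \<mu>(1)]) (rule that)
  interpret prob_space M by (rule levy_processD[OF X(1)])
  have Xm: "0 \<le> t \<Longrightarrow> X t \<in> borel_measurable M" for t by (rule levy_processD(2)[OF X(1)])
  define \<xi> where "\<xi> j \<omega> = X (real j + 1) \<omega> - X (real j) \<omega>" for j \<omega>
  have \<xi>[measurable]: "\<xi> j \<in> borel_measurable M" for j unfolding \<xi>_def[abs_def] by (intro borel_measurable_diff Xm) auto
  have law: "distr M borel (\<xi> j) = \<mu>" for j
    using levy_processD(3)[OF X(1), of "real j" 1] X(2) by (simp add: \<xi>_def[abs_def])
  define S where "S n \<omega> = (\<Sum>j<n. (1 / b) ^ j *\<^sub>R \<xi> j \<omega>)" for n \<omega>
  have [measurable]: "S n \<in> borel_measurable M" for n unfolding S_def[abs_def] by measurable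
  define Y where "Y \<omega> = lim (\<lambda>n. S n \<omega>)" for \<omega>
  have Ym[measurable]: "Y \<in> borel_measurable M" unfolding Y_def[abs_def] by measurable
  have "AE \<omega> in M. (\<lambda>n. S n \<omega>) \<longlonglongrightarrow> Y \<omega>"
    using AE_summable_geometric[of \<mu> b \<xi>, OF \<mu>d \<mu>(2) b \<xi> law]
    by eventually_elim (auto simp: Y_def S_def suminf_eq_lim[symmetric] summable_LIMSEQ)
  then have SY: "AE \<omega> in M. (\<lambda>n. S n \<omega> - Y \<omega>) \<longlonglongrightarrow> 0"
    by eventually_elim (simp add: LIM_zero)
  \<comment> \<open>Almost sure convergence is restated through characteristic functions, so that
    the criterion used for the incomplete period also covers the partial sums.\<close>
  have "(\<lambda>n. char_fun (distr M borel (\<lambda>\<omega>. S n \<omega> - Y \<omega>)) z) \<longlonglongrightarrow> char_fun (distr M borel (\<lambda>\<omega>. 0)) z" for z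
    by (rule tendsto_char_fun_AE) (use SY in auto)
  moreover have "char_fun (distr M borel (\<lambda>\<omega>. 0)) z = 1" for z :: "real ^ 'n"
    by (simp add: char_fun_def integral_return)
  ultimately have SY_char: "(\<lambda>n. char_fun (distr M borel (\<lambda>\<omega>. S n \<omega> - Y \<omega>)) z) \<longlonglongrightarrow> 1" for z by simp
  have step: "step_integral b X t \<omega> = S (nat \<lfloor>t\<rfloor>) \<omega> + (1 / b) ^ nat \<lfloor>t\<rfloor> *\<^sub>R (X t \<omega> - X (real (nat \<lfloor>t\<rfloor>)) \<omega>)" if "0 \<le> t" for t \<omega>
    using that by (simp add: step_integral_def S_def \<xi>_def)
  have "tendsto_in_prob M (step_integral b X) Y at_top"
    unfolding tendsto_in_prob_def
  proof (intro allI impI tendsto_at_topI_sequentially)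
    fix \<epsilon> :: real and t :: "nat \<Rightarrow> real" assume \<epsilon>: "0 < \<epsilon>" and t: "filterlim t at_top sequentially"
    define n where "n i = nat \<lfloor>t i\<rfloor>" for i
    have n: "filterlim n at_top sequentially"
      unfolding n_def by (intro filterlim_compose[OF filterlim_nat_sequentially] filterlim_compose[OF filterlim_floor_sequentially] t)
    \<comment> \<open>The default 0 at negative times keeps \<open>s i\<close> in [0, 1] for every
      i; only finitely many i are concerned, as t tends to infinity.\<close>
    define s where "s i = (if 0 \<le> t i then t i - real (n i) else 0)" for i
    have s: "0 \<le> s i" "s i \<le> 1" for i unfolding s_def n_def by (auto simp: of_nat_nat) linarith+
    have ts: "t i = real (n i) + s i" if "0 \<le> t i" for i using that by (simp add: s_def)
    define W where "W i \<omega> = (1 / b) ^ n i *\<^sub>R (X (real (n i) + s i) \<omega> - X (real (n i)) \<omega>)" for i \<omega>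
    have [measurable]: "(\<lambda>\<omega>. X (real (n i) + s i) \<omega> - X (real (n i)) \<omega>) \<in> borel_measurable M" for i
      using s by (intro borel_measurable_diff Xm) auto
    have Wm[measurable]: "W i \<in> borel_measurable M" for i unfolding W_def[abs_def] by measurable
    have W_char: "char_fun (distr M borel (W i)) z = exp (of_real (s i) * \<psi> ((1 / b) ^ n i *\<^sub>R z))" for i z
      using s levy_processD(3)[OF X(1), of "real (n i)" "s i"]
      by (simp add: W_def[abs_def] char_fun_scaleR \<psi>(3))
    have W0: "(\<lambda>i. char_fun (distr M borel (W i)) z) \<longlonglongrightarrow> 1" for z
    proof -
      have "(\<lambda>i. (1 / b) ^ n i *\<^sub>R z) \<longlonglongrightarrow> 0 *\<^sub>R z"
        by (intro tendsto_scaleR tendsto_const filterlim_compose[OF LIMSEQ_power_zero n]) (use b in auto)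
      then have "(\<lambda>i. \<psi> ((1 / b) ^ n i *\<^sub>R z)) \<longlonglongrightarrow> \<psi> 0"
        using continuous_on_tendsto_compose[OF \<psi>(1)] by auto
      then have 0: "(\<lambda>i. \<psi> ((1 / b) ^ n i *\<^sub>R z)) \<longlonglongrightarrow> 0" by (simp add: \<psi>(2))
      have "(\<lambda>i. of_real (s i) * \<psi> ((1 / b) ^ n i *\<^sub>R z)) \<longlonglongrightarrow> 0"
      proof (rule tendsto_0_le[OF 0, of _ 1], rule always_eventually, rule allI)
        fix i
        have "\<bar>s i\<bar> * norm (\<psi> ((1 / b) ^ n i *\<^sub>R z)) \<le> 1 * norm (\<psi> ((1 / b) ^ n i *\<^sub>R z))"
          using s[of i] by (intro mult_right_mono) auto
        then show "norm (of_real (s i) * \<psi> ((1 / b) ^ n i *\<^sub>R z)) \<le> norm (\<psi> ((1 / b) ^ n i *\<^sub>R z)) * 1"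
          by (simp add: norm_mult)
      qed
      then have "(\<lambda>i. exp (of_real (s i) * \<psi> ((1 / b) ^ n i *\<^sub>R z))) \<longlonglongrightarrow> exp 0" by (rule tendsto_exp)
      then show ?thesis by (simp add: W_char)
    qed
    have "(\<lambda>k. prob {\<omega> \<in> space M. norm (S k \<omega> - Y \<omega>) > \<epsilon> / 2}) \<longlonglongrightarrow> 0"
      by (rule tendsto_prob_0_of_char_fun) (use SY_char \<epsilon> in auto)
    from filterlim_compose[OF this n]
    have 1: "(\<lambda>i. prob {\<omega> \<in> space M. norm (S (n i) \<omega> - Y \<omega>) > \<epsilon> / 2}) \<longlonglongrightarrow> 0" .
    have 2: "(\<lambda>i. prob {\<omega> \<in> space M. norm (W i \<omega>) > \<epsilon> / 2}) \<longlonglongrightarrow> 0"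
      by (rule tendsto_prob_0_of_char_fun) (use W0 \<epsilon> in auto)
    show "(\<lambda>i. prob {\<omega> \<in> space M. norm (step_integral b X (t i) \<omega> - Y \<omega>) > \<epsilon>}) \<longlonglongrightarrow> 0"
    proof (rule tendsto_0_le[where K=1])
      show "(\<lambda>i. prob {\<omega> \<in> space M. norm (S (n i) \<omega> - Y \<omega>) > \<epsilon> / 2} + prob {\<omega> \<in> space M. norm (W i \<omega>) > \<epsilon> / 2}) \<longlonglongrightarrow> 0"
        using tendsto_add[OF 1 2] by simp
      have "\<forall>\<^sub>F i in sequentially. 0 \<le> t i" using t by (simp add: filterlim_at_top)
      then show "\<forall>\<^sub>F i in sequentially. norm (prob {\<omega> \<in> space M. norm (step_integral b X (t i) \<omega> - Y \<omega>) > \<epsilon>})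
        \<le> norm (prob {\<omega> \<in> space M. norm (S (n i) \<omega> - Y \<omega>) > \<epsilon> / 2} + prob {\<omega> \<in> space M. norm (W i \<omega>) > \<epsilon> / 2}) * 1"
      proof eventually_elim
        case (elim i)
        have eq: "step_integral b X (t i) \<omega> = S (n i) \<omega> + W i \<omega>" for \<omega>
          unfolding step[OF elim] W_def n_def[symmetric] ts[OF elim, symmetric] ..
        have "prob {\<omega> \<in> space M. norm (step_integral b X (t i) \<omega> - Y \<omega>) > \<epsilon>} \<le>
          prob ({\<omega> \<in> space M. norm (S (n i) \<omega> - Y \<omega>) > \<epsilon> / 2} \<union> {\<omega> \<in> space M. norm (W i \<omega>) > \<epsilon> / 2})"
        proof (rule finite_measure_mono, safe)
          fix \<omega> assume "\<epsilon> < norm (step_integral b X (t i) \<omega> - Y \<omega>)" "\<not> \<epsilon> / 2 < norm (W i \<omega>)"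
          moreover have "norm (step_integral b X (t i) \<omega> - Y \<omega>) \<le> norm (S (n i) \<omega> - Y \<omega>) + norm (W i \<omega>)"
            using norm_triangle_ineq[of "S (n i) \<omega> - Y \<omega>" "W i \<omega>"] by (simp add: eq algebra_simps)
          ultimately show "\<epsilon> / 2 < norm (S (n i) \<omega> - Y \<omega>)" by simp
        qed measurable
        also have "\<dots> \<le> prob {\<omega> \<in> space M. norm (S (n i) \<omega> - Y \<omega>) > \<epsilon> / 2} + prob {\<omega> \<in> space M. norm (W i \<omega>) > \<epsilon> / 2}"
          by (rule measure_Un_le) measurable
        finally show ?case by simp
      qed
    qed
  qed
  then show ?thesis unfolding Phi_law_def using X Ym by blast
qed

text \<open>Existence of a law and uniqueness of the solution resolve the \<open>THE\<close> in
  \<open>Phi\<close>. From here on \<open>Phi\<close> is handled through \<open>semi_decomp\<close>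
  alone.\<close>

lemma Phi_eq_Some:
  fixes \<mu> \<nu> :: "(real ^ 'n) measure"
  assumes \<mu>: "\<mu> \<in> inf_divisible" "log_moment 1 \<mu>" and b: "1 < b"
    and \<nu>: "\<nu> \<in> distributions" "semi_decomp b \<nu> \<mu>"
  shows "Phi b \<mu> = Some \<nu>"
proof -
  have law: "Phi_law b \<mu> \<nu>' \<longleftrightarrow> \<nu>' = \<nu>" for \<nu>'
    using Phi_law_exists[OF \<mu> b] Phi_law_imp_semi_decomp semi_decomp_unique[OF _ \<nu>(2) _ \<nu>(1) b] by metis
  then have "\<exists>\<nu>'. Phi_law b \<mu> \<nu>'" "(THE \<nu>'. Phi_law b \<mu> \<nu>') = \<nu>" by (blast, intro the_equality) auto
  then show ?thesis using \<mu>(1) by (simp add: Phi_def)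
qed

section \<open>Iterates of the mapping and the two inclusions\<close>

lemma log_moment_0: "\<mu> \<in> distributions \<Longrightarrow> log_moment 0 \<mu>"
  using prob_space.emeasure_space_1[OF distributionsD(1), of \<mu>] by (simp add: log_moment_def)

text \<open>Each application of \<open>Phi\<close> lowers the order by exactly one. The implication
  from \<mu> to \<rho> keeps the next application defined; the converse lifts the moments of \<mu>
  in \<open>L_in_range_Phi_iter\<close>.\<close>

lemma Phi_iter_log_moment:
  fixes \<mu> :: "(real ^ 'n) measure"
  assumes \<mu>: "\<mu> \<in> inf_divisible" "log_moment k \<mu>" and b: "1 < b"
  shows "\<exists>\<rho>\<in>inf_divisible. Phi_iter b k \<mu> = Some \<rho> \<and> (\<forall>j. log_moment (k + j) \<mu> \<longleftrightarrow> log_moment j \<rho>)"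
  using \<mu>(2)
proof (induction k)
  case 0
  then show ?case using \<mu>(1) by auto
next
  case (Suc k)
  have \<mu>d: "\<mu> \<in> distributions" using \<mu>(1) by (rule inf_divisible_imp_distributions)
  have "log_moment k \<mu>" by (rule log_moment_mono[OF \<mu>d Suc.prems]) simp
  then obtain \<rho> where \<rho>: "\<rho> \<in> inf_divisible" "Phi_iter b k \<mu> = Some \<rho>" "\<And>j. log_moment (k + j) \<mu> \<longleftrightarrow> log_moment j \<rho>"
    using Suc.IH by auto
  have \<rho>1: "log_moment 1 \<rho>" using \<rho>(3)[of 1] Suc.prems by simp
  have \<rho>d: "\<rho> \<in> distributions" using \<rho>(1) by (rule inf_divisible_imp_distributions)
  obtain \<nu> where \<nu>: "\<nu> \<in> inf_divisible" "semi_decomp b \<nu> \<rho>" "\<And>j. log_moment (Suc j) \<rho> \<Longrightarrow> log_moment j \<nu>"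
    by (rule geometric_series_inf_divisible[OF \<rho>(1) \<rho>1 b]) (rule that)
  have \<nu>d: "\<nu> \<in> distributions" using \<nu>(1) by (rule inf_divisible_imp_distributions)
  have "Phi_iter b (Suc k) \<mu> = Some \<nu>"
    using Phi_eq_Some[OF \<rho>(1) \<rho>1 b \<nu>d \<nu>(2)] \<rho>(2) by (simp add: map_comp_def)
  moreover have "log_moment (Suc k + j) \<mu> \<longleftrightarrow> log_moment j \<nu>" for j
    using \<rho>(3)[of "Suc j"] \<nu>(3)[of j] semi_decomp_log_moment[OF \<nu>(2) \<nu>d \<rho>d b, of j] by auto
  ultimately show ?case using \<nu>(1) by blast
qed

lemma L_subset_inf_divisible: "L m b \<subseteq> inf_divisible"
  by (cases m) auto

text \<open>With \<mu> fixed, the iterate in \<open>L m b\<close> still has a moment of order 1 by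
  the equivalence of moments. \<open>Phi\<close> thus applies once more, and its value satisfies the
  equation that defines the next class.\<close>

lemma Phi_iter_in_L:
  fixes \<mu> :: "(real ^ 'n) measure"
  assumes \<mu>: "\<mu> \<in> inf_divisible" "log_moment (Suc m) \<mu>" and b: "1 < b"
  shows "\<exists>\<nu>\<in>L m b. Phi_iter b (Suc m) \<mu> = Some \<nu>"
  using \<mu>(2)
proof (induction m)
  case 0
  then have \<mu>1: "log_moment 1 \<mu>" by simp
  obtain \<nu> where \<nu>: "\<nu> \<in> inf_divisible" "semi_decomp b \<nu> \<mu>"
    by (rule geometric_series_inf_divisible[OF \<mu>(1) \<mu>1 b]) (rule that)
  have "Phi b \<mu> = Some \<nu>"
    by (rule Phi_eq_Some[OF \<mu>(1) \<mu>1 b inf_divisible_imp_distributions[OF \<nu>(1)] \<nu>(2)])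
  then have "Phi_iter b (Suc 0) \<mu> = Some \<nu>" by (simp add: map_comp_def)
  moreover have "\<nu> \<in> L 0 b" using \<nu> \<mu>(1) unfolding L.simps semi_decomp_def by blast
  ultimately show ?case by blast
next
  case (Suc m)
  have \<mu>d: "\<mu> \<in> distributions" using \<mu>(1) by (rule inf_divisible_imp_distributions)
  have l: "log_moment (Suc m) \<mu>" by (rule log_moment_mono[OF \<mu>d Suc.prems]) simp
  obtain \<rho> where \<rho>: "\<rho> \<in> L m b" "Phi_iter b (Suc m) \<mu> = Some \<rho>" using Suc.IH[OF l] by blast
  have \<rho>i: "\<rho> \<in> inf_divisible" using \<rho>(1) L_subset_inf_divisible by blast
  have \<rho>1: "log_moment 1 \<rho>"
    using Phi_iter_log_moment[OF \<mu>(1) l b] \<rho>(2) Suc.prems by (metis add.commute option.inject plus_1_eq_Suc)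
  obtain \<nu> where \<nu>: "\<nu> \<in> inf_divisible" "semi_decomp b \<nu> \<rho>"
    by (rule geometric_series_inf_divisible[OF \<rho>i \<rho>1 b]) (rule that)
  have "Phi b \<rho> = Some \<nu>"
    by (rule Phi_eq_Some[OF \<rho>i \<rho>1 b inf_divisible_imp_distributions[OF \<nu>(1)] \<nu>(2)])
  then have "Phi_iter b (Suc (Suc m)) \<mu> = Some \<nu>"
    unfolding Phi_iter.simps(2)[of b "Suc m"] map_comp_def \<rho>(2) by simp
  moreover have "\<nu> \<in> L (Suc m) b" using \<nu> \<rho>(1) unfolding L.simps semi_decomp_def by blast
  ultimately show ?case by blast
qed

text \<open>The factor \<rho> in the equation for \<nu> is the preimage of \<nu> under
  \<open>Phi\<close>. It has a moment of order 1 for free, and this raises the order of the \<mu>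
  that the induction provides for \<rho> from m + 1 to m + 2.\<close>

lemma L_in_range_Phi_iter:
  fixes \<nu> :: "(real ^ 'n) measure"
  assumes b: "1 < b" and "\<nu> \<in> L m b"
  shows "\<exists>\<mu>\<in>I_log (Suc m). Phi_iter b (Suc m) \<mu> = Some \<nu>"
  using assms(2)
proof (induction m arbitrary: \<nu>)
  case 0
  then obtain \<rho> where \<nu>: "\<nu> \<in> inf_divisible" and \<rho>: "\<rho> \<in> inf_divisible" "semi_decomp b \<nu> \<rho>"
    by (auto simp: semi_decomp_def)
  have d: "\<nu> \<in> distributions" "\<rho> \<in> distributions" using \<nu> \<rho>(1) by (simp_all add: inf_divisible_imp_distributions)
  have \<rho>1: "log_moment (Suc 0) \<rho>" by (rule semi_decomp_log_moment[OF \<rho>(2) d b log_moment_0[OF d(1)]])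
  then have "Phi b \<rho> = Some \<nu>" using Phi_eq_Some[OF \<rho>(1) _ b d(1) \<rho>(2)] by simp
  then show ?case using \<rho>(1) \<rho>1 by (intro bexI[of _ \<rho>]) (auto simp: I_log_iff)
next
  case (Suc m)
  then obtain \<rho> where \<nu>: "\<nu> \<in> inf_divisible" and \<rho>: "\<rho> \<in> L m b" "semi_decomp b \<nu> \<rho>"
    by (auto simp: semi_decomp_def)
  have \<rho>i: "\<rho> \<in> inf_divisible" using \<rho>(1) L_subset_inf_divisible by blast
  have d: "\<nu> \<in> distributions" "\<rho> \<in> distributions" using \<nu> \<rho>i by (simp_all add: inf_divisible_imp_distributions)
  have \<rho>1: "log_moment 1 \<rho>" using semi_decomp_log_moment[OF \<rho>(2) d b log_moment_0[OF d(1)]] by simp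
  obtain \<mu> where \<mu>: "\<mu> \<in> inf_divisible" "log_moment (Suc m) \<mu>" "Phi_iter b (Suc m) \<mu> = Some \<rho>"
    using Suc.IH[OF \<rho>(1)] by (auto simp: I_log_iff)
  have "log_moment (Suc (Suc m)) \<mu>"
    using Phi_iter_log_moment[OF \<mu>(1,2) b] \<mu>(3) \<rho>1 by (metis add.commute option.inject plus_1_eq_Suc)
  moreover have "Phi_iter b (Suc (Suc m)) \<mu> = Some \<nu>"
    unfolding Phi_iter.simps(2)[of b "Suc m"] map_comp_def \<mu>(3) using Phi_eq_Some[OF \<rho>i \<rho>1 b d(1) \<rho>(2)] by simp
  ultimately show ?case using \<mu>(1) by (intro bexI[of _ \<mu>]) (auto simp: I_log_iff simp del: Phi_iter.simps)
qed

text \<open>Since the right side contains no \<open>None\<close>, the equation also says that all of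
  \<open>I_log (m + 1)\<close> lies in the domain of the iterate.\<close>

theorem theorem7p3:
  fixes b :: real and m :: nat
  assumes "b > 1"
  shows "Phi_iter b (m + 1) ` (I_log (m + 1) :: (real ^ 'n) measure set) = Some ` L m b"
proof (intro equalityI subsetI)
  fix y assume "y \<in> Phi_iter b (m + 1) ` (I_log (m + 1) :: (real ^ 'n) measure set)"
  then show "y \<in> Some ` L m b"
    using Phi_iter_in_L[OF _ _ assms] by (force simp: I_log_iff simp del: Phi_iter.simps)
next
  fix y :: "(real ^ 'n) measure option" assume "y \<in> Some ` L m b"
  then show "y \<in> Phi_iter b (m + 1) ` I_log (m + 1)"
    using L_in_range_Phi_iter[OF assms] by (force simp del: Phi_iter.simps)
qed

end
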